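(* Consider a branching random walk satisfying all the assumptions listed in the context, with $b\in(0,\frac12)$. Then there exists a constant $a_*\in(0,\infty)$ such that almost surely on the event $\{\#\mathbb T=\infty\}$, $$\inf_{\Theta\in\partial\mathbb T}\ \limsup_{n\to\infty}\frac{V(\Theta_n)}{n^{\frac1{2-b}}}=a_*.$$
   Context: Branching random walk: let $\mathscr L=\sum_{i=1}^\nu\delta_{Y_i}$, where $\nu$ is an $\mathbb N_0$-valued random variable and $(Y_i)_{i\ge1}$ are i.i.d. real random variables independent of $\nu$. One particle (the root $\varnothing$) starts at $0$; at each generation, every particle (at position $x$, say) independently dies and produces children whose positions form an independent copy of the translated point process $x+\mathscr L$. $\mathbb T$ is the genealogical tree, $|u|$ the generation and $V(u)$ the position of $u\in\mathbb T$. $\partial\mathbb T$ is the set of infinite rays, i.e. sequences $\Theta=(\Theta_0=\varnothing,\Theta_1,\Theta_2,\dots)$ in $\mathbb T$ such that $\Theta_n$ is the parent of $\Theta_{n+1}$ for all $n\ge0$. Assumptions. $1<\mathbb E(\nu)<\infty$; $\mathscr L$ is not a.s. supported on a deterministic lattice. With $\phi(\beta):=\log\mathbb E[\sum_{|u|=1}e^{-\beta V(u)}]\in(-\infty,\infty]$: $\phi(1)=0$, the left derivative $\phi'(1-)\in(-\infty,0)$, and $\phi(\beta)=\infty$ for all $\beta>1$. Let $X$ be a real random variable under a probability $\mathbf P$ with law $\mathbf E[g(X)]=\mathbb E[\sum_{|u|=1}g(V(u))e^{-V(u)}]$ for bounded measurable $g$. There are $a\in\mathbb R$, $\lambda>0$,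 $b$, $x_0<0$ and a non-negative function $\ell$ with $\lim_{y\to-\infty}\ell(y)=\ell_\infty\in(0,\infty)$ such that $\mathbf P(X\le x)=\int_{-\infty}^x\ell(y)|y|^ae^{-\lambda|y|^b}dy$ for all $x\le x_0$. With $W_1:=\sum_{|u|=1}e^{-V(u)}$, $\mathbb E(W_1\log_+W_1)<\infty$, where $\log_+x=\max\{\log x,0\}$. *)

theory Defs
  imports "HOL-Probability.Probability"
begin

(* The pair (nu, (Y_i)_i) generating the point process L = sum_{i < nu} delta_{Y_i} is a random
   element of this space; children are numbered from 0. *)
definition offspring_space :: "(nat \<times> (nat \<Rightarrow> real)) measure" where
  "offspring_space = count_space UNIV \<Otimes>\<^sub>M (\<Pi>\<^sub>M i\<in>UNIV. borel)"

(* Ulam-Harris construction: each label u carries an independent copy (\<nu> u, (Y u i)_i) of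
   (nu, (Y_i)_i), which is used only if u is alive; u @ [i] is the child number i of u.
   The case_nat family is the sequence nu, Y_0, Y_1, ..., so its independence means that the Y_i are
   independent of each other and of nu. *)
locale branching_random_walk = prob_space M for M :: "'a measure" +
  fixes \<nu> :: "nat list \<Rightarrow> 'a \<Rightarrow> nat"
    and Y :: "nat list \<Rightarrow> nat \<Rightarrow> 'a \<Rightarrow> real"
  assumes independent_copies:
      "indep_vars (\<lambda>_. offspring_space) (\<lambda>u \<omega>. (\<nu> u \<omega>, \<lambda>i. Y u i \<omega>)) UNIV"
    and identical_copies:
      "\<And>u. distr M offspring_space (\<lambda>\<omega>. (\<nu> u \<omega>, \<lambda>i. Y u i \<omega>)) =
           distr M offspring_space (\<lambda>\<omega>. (\<nu> [] \<omega>, \<lambda>i. Y [] i \<omega>))"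
    and nu_and_displacements_independent:
      "indep_vars (\<lambda>_. borel) (case_nat (\<lambda>\<omega>. real (\<nu> [] \<omega>)) (Y [])) UNIV"
    and displacements_identical: "\<And>i. distr M borel (Y [] i) = distr M borel (Y [] 0)"

definition genealogical_tree :: "(nat list \<Rightarrow> 'a \<Rightarrow> nat) \<Rightarrow> 'a \<Rightarrow> nat list set" where
  "genealogical_tree \<nu> \<omega> = {u. \<forall>k<length u. u ! k < \<nu> (take k u) \<omega>}"

definition generation :: "(nat list \<Rightarrow> 'a \<Rightarrow> nat) \<Rightarrow> 'a \<Rightarrow> nat \<Rightarrow> nat list set" where
  "generation \<nu> \<omega> n = {u \<in> genealogical_tree \<nu> \<omega>. length u = n}"

definition position :: "(nat list \<Rightarrow> nat \<Rightarrow> 'a \<Rightarrow> real) \<Rightarrow> 'a \<Rightarrow> nat list \<Rightarrow> real" where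
  "position Y \<omega> u = (\<Sum>k<length u. Y (take k u) (u ! k) \<omega>)"

definition rays :: "(nat list \<Rightarrow> 'a \<Rightarrow> nat) \<Rightarrow> 'a \<Rightarrow> (nat \<Rightarrow> nat list) set" where
  "rays \<nu> \<omega> = {\<Theta>. \<Theta> 0 = [] \<and> (\<forall>n. \<Theta> n \<in> genealogical_tree \<nu> \<omega>) \<and>
                    (\<forall>n. \<exists>i. \<Theta> (Suc n) = \<Theta> n @ [i])}"

definition ln_ennreal :: "ennreal \<Rightarrow> ereal" where
  "ln_ennreal x = (if x = 0 then -\<infinity> else if x = \<infinity> then \<infinity> else ereal (ln (enn2real x)))"

definition log_laplace ::
  "'a measure \<Rightarrow> (nat list \<Rightarrow> 'a \<Rightarrow> nat) \<Rightarrow> (nat list \<Rightarrow> nat \<Rightarrow> 'a \<Rightarrow> real) \<Rightarrow> real \<Rightarrow> ereal" where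
  "log_laplace M \<nu> Y \<beta> =
     ln_ennreal (\<integral>\<^sup>+ \<omega>. ennreal (\<Sum>u\<in>generation \<nu> \<omega> 1. exp (- \<beta> * position Y \<omega> u)) \<partial>M)"

definition W1 ::
  "(nat list \<Rightarrow> 'a \<Rightarrow> nat) \<Rightarrow> (nat list \<Rightarrow> nat \<Rightarrow> 'a \<Rightarrow> real) \<Rightarrow> 'a \<Rightarrow> real" where
  "W1 \<nu> Y \<omega> = (\<Sum>u\<in>generation \<nu> \<omega> 1. exp (- position Y \<omega> u))"

(* ln 0 = 0 in HOL, so this is also right at x = 0, where log 0 = -\<infinity> in the usual convention. *)
definition log_plus :: "real \<Rightarrow> real" where
  "log_plus x = max (ln x) 0"

end

theory Submission
  imports Defs "HOL-Real_Asymp.Real_Asymp"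
begin

text \<open>The infimum \<open>A\<close> is inherited: it is the minimum of the corresponding values of the subtrees of
the children of the root. Hence, for every \<open>a > 0\<close>, the probability of \<open>A \<ge> a\<close> is a fixed point of the
generating function of \<open>\<nu>\<close>, so it is either the extinction probability or \<open>1\<close>, and \<open>A\<close> is almost
surely constant on survival. It remains to bound \<open>A\<close> away from \<open>0\<close> and \<open>\<infinity>\<close>, which only takes estimates of
the right order. Put \<open>p = 1 / (2 - b)\<close> and \<open>m = E X > 0\<close>.

Lower bound. No particle goes below \<open>-L\<close> up to generation \<open>N\<close>, except with probability \<open>N exp (-L)\<close>.
For a path confined to \<open>[-L, L]\<close> all jumps exceed \<open>-2L\<close>, and on this range \<open>\<theta> = c L powr (b - 1)\<close> satisfies
\<open>\<theta> |x| \<le> 2 c |x| powr b\<close>, so that the truncated transform of \<open>exp (-\<theta> X)\<close> is at most \<open>exp (-\<theta> m / 2)\<close>. By the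
many-to-one formula a confined path of length \<open>N\<close> exists with probability at most
\<open>exp ((1 + \<theta>) L - N \<theta> m / 2)\<close>, which tends to \<open>0\<close> if \<open>L\<close> is a small multiple of \<open>N powr p\<close>.

Upper bound. Starting from height \<open>0\<close>, particles that follow the drift are near \<open>m T\<close> at time \<open>T\<close>, and there are
about \<open>exp (m T)\<close> of them; one of them has a child that jumps back to height \<open>O(T powr b)\<close>. Concatenating blocks of
length \<open>T \<approx> n powr p\<close> at generation \<open>n\<close> keeps the path below a multiple of \<open>n powr p\<close>. If the
blocks to come succeed with probability at least \<open>\<epsilon>\<close> from a suitable height, then a whole block followed by them
succeeds with probability at least the same \<open>\<epsilon>\<close>, because \<open>\<epsilon>\<close> is absorbed in the choice of the final height; so
backward induction over the blocks applies. Inside a block, the success probability from \<open>x\<close>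
with \<open>k\<close> steps to go is at least \<open>s exp (-x) (1 - U x - B k x)\<close>, where \<open>B\<close> bounds the probability that the walk with
increments \<open>X\<close> leaves the strip, and \<open>U\<close> is a superharmonic function for this walk dominating the second
order terms; it is finite by the \<open>L log L\<close> condition.\<close>

section \<open>The branching property\<close>

definition subtree :: "nat \<Rightarrow> (nat list \<Rightarrow> 'c) \<Rightarrow> nat list \<Rightarrow> 'c" where
  "subtree i \<omega> = (\<lambda>v. \<omega> (i # v))"

locale offspring_law = prob_space \<mu> for \<mu> :: "(nat \<times> (nat \<Rightarrow> real)) measure" +
  assumes sets_offspring [measurable_cong]: "sets \<mu> = sets offspring_space"
begin

text \<open>The labels of all words, alive or not, are i.i.d., so the subtree at every index
  \<open>i\<close> is defined, has this same law again, and is independent of the other subtrees and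
  of the root label.\<close>

definition tree_law :: "(nat list \<Rightarrow> nat \<times> (nat \<Rightarrow> real)) measure" where
  "tree_law = (\<Pi>\<^sub>M u\<in>UNIV. \<mu>)"

lemma sets_tree_law [measurable_cong]: "sets tree_law = sets (\<Pi>\<^sub>M u\<in>UNIV. \<mu>)"
  by (simp add: tree_law_def)

sublocale tree: prob_space tree_law
  unfolding tree_law_def by (intro prob_space_PiM) (rule prob_space_axioms)

lemma space_tree_law [simp]: "space tree_law = UNIV"
  using sets_eq_imp_space_eq[OF sets_offspring]
  by (auto simp: tree_law_def space_PiM PiE_def offspring_space_def space_pair_measure)

lemma space_offspring [simp]: "space \<mu> = UNIV"
  using sets_eq_imp_space_eq[OF sets_offspring]
  by (auto simp: space_PiM PiE_def offspring_space_def space_pair_measure)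

lemma measurable_fst_offspring [measurable]: "fst \<in> \<mu> \<rightarrow>\<^sub>M count_space UNIV"
proof -
  have "fst \<in> offspring_space \<rightarrow>\<^sub>M count_space UNIV"
    unfolding offspring_space_def by measurable
  then show ?thesis using sets_offspring by (simp cong: measurable_cong_sets)
qed

lemma measurable_snd_offspring [measurable]: "(\<lambda>z. snd z i) \<in> borel_measurable \<mu>"
proof -
  have "(\<lambda>z. snd z i) \<in> borel_measurable offspring_space"
    unfolding offspring_space_def by measurable
  then show ?thesis using sets_offspring by (simp cong: measurable_cong_sets)
qed

lemma measurable_coord [measurable]: "(\<lambda>\<omega>. \<omega> u) \<in> tree_law \<rightarrow>\<^sub>M \<mu>"
  unfolding tree_law_def by measurable

lemma measurable_subtree [measurable]: "subtree i \<in> tree_law \<rightarrow>\<^sub>M tree_law"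
  unfolding tree_law_def subtree_def by (rule measurable_PiM_single') (auto simp: tree_law_def)

lemma indep_coordinates: "tree.indep_vars (\<lambda>_. \<mu>) (\<lambda>u \<omega>. \<omega> u) UNIV"
proof -
  interpret product_prob_space "\<lambda>_. \<mu>" UNIV by unfold_locales
  have "distr tree_law (\<Pi>\<^sub>M u\<in>UNIV. \<mu>) (\<lambda>\<omega>. \<lambda>u\<in>UNIV. \<omega> u) = (\<Pi>\<^sub>M u\<in>UNIV. distr tree_law \<mu> (\<lambda>\<omega>. \<omega> u))"
    by (simp add: tree_law_def PiM_component restrict_UNIV distr_id)
  then show ?thesis
    by (subst tree.indep_vars_iff_distr_eq_PiM) auto
qed

lemma distr_coord: "distr tree_law \<mu> (\<lambda>\<omega>. \<omega> u) = \<mu>"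
proof -
  interpret product_prob_space "\<lambda>_. \<mu>" UNIV by unfold_locales
  show ?thesis by (simp add: tree_law_def PiM_component)
qed

lemma distr_subtree: "distr tree_law tree_law (subtree i) = tree_law"
proof -
  have "distr (PiM UNIV (\<lambda>_. \<mu>)) (PiM UNIV (\<lambda>v. \<mu>)) (\<lambda>\<omega>. \<lambda>v\<in>UNIV. \<omega> (i # v)) = PiM UNIV (\<lambda>v. \<mu>)"
    using distr_PiM_reindex[where K=UNIV and M="\<lambda>_. \<mu>" and I=UNIV and f="Cons i"]
    by (simp add: prob_space_axioms)
  then show ?thesis by (simp add: tree_law_def subtree_def[abs_def] restrict_UNIV)
qed

lemma indep_subtrees: "tree.indep_vars (\<lambda>_. tree_law) subtree UNIV"
proof -
  have "tree.indep_vars (\<lambda>i. PiM (range (Cons i)) (\<lambda>_. \<mu>)) (\<lambda>i \<omega>. restrict (\<lambda>u. \<omega> u) (range (Cons i))) UNIV"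
    by (rule tree.indep_vars_restrict[OF indep_coordinates]) (auto simp: disjoint_family_on_def)
  then have "tree.indep_vars (\<lambda>_. tree_law) (\<lambda>i \<omega>. (\<lambda>r v. r (i # v)) (restrict (\<lambda>u. \<omega> u) (range (Cons i)))) UNIV"
    by (rule tree.indep_vars_compose2) (auto simp: tree_law_def intro!: measurable_PiM_single' measurable_component_singleton)
  then show ?thesis by (simp add: subtree_def[abs_def])
qed

text \<open>The root label is independent of all other labels and the subtrees are i.i.d. copies of
  the whole tree, so integrating over the root label last factorizes the product. In both
  applications \<open>h\<close> is an indicator: an event required of every child is such a
  product.\<close>

lemma branching_property:
  fixes h :: "nat \<times> (nat \<Rightarrow> real) \<Rightarrow> nat \<Rightarrow> (nat list \<Rightarrow> nat \<times> (nat \<Rightarrow> real)) \<Rightarrow> ennreal"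
  assumes [measurable]: "\<And>i. (\<lambda>(z, \<omega>). h z i \<omega>) \<in> borel_measurable (\<mu> \<Otimes>\<^sub>M tree_law)"
  shows "(\<integral>\<^sup>+\<omega>. (\<Prod>i<fst (\<omega> []). h (\<omega> []) i (subtree i \<omega>)) \<partial>tree_law) =
         (\<integral>\<^sup>+z. (\<Prod>i<fst z. \<integral>\<^sup>+\<omega>. h z i \<omega> \<partial>tree_law) \<partial>\<mu>)"
proof -
  let ?B = "UNIV - {[]} :: nat list set" and ?R = "PiM (UNIV - {[]} :: nat list set) (\<lambda>_. \<mu>)"
  let ?r = "\<lambda>\<omega>. restrict (\<lambda>u. \<omega> u) ?B"
  let ?root = "\<lambda>\<omega>. restrict (\<lambda>u. \<omega> u) {[]}"
  have [measurable]: "?root \<in> tree_law \<rightarrow>\<^sub>M PiM {[]} (\<lambda>_. \<mu>)" unfolding tree_law_def by (rule measurable_restrict) auto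
  have [measurable]: "(\<lambda>r. r []) \<in> PiM {[]} (\<lambda>_. \<mu>) \<rightarrow>\<^sub>M \<mu>" by (rule measurable_component_singleton) auto
  have [measurable]: "?r \<in> tree_law \<rightarrow>\<^sub>M ?R" unfolding tree_law_def by (rule measurable_restrict) auto
  have meas_v [measurable]: "(\<lambda>r v. r (i # v)) \<in> ?R \<rightarrow>\<^sub>M tree_law" for i
    unfolding tree_law_def
    by (intro measurable_PiM_single' measurable_component_singleton) (auto simp: PiE_def)
  have "tree.indep_var (PiM {[]} (\<lambda>_. \<mu>)) (\<lambda>\<omega>. restrict (\<lambda>u. \<omega> u) {[]}) ?R ?r"
    by (rule tree.indep_var_restrict[OF indep_coordinates]) auto
  then have pair: "distr tree_law (PiM {[]} (\<lambda>_. \<mu>) \<Otimes>\<^sub>M ?R) (\<lambda>\<omega>. (?root \<omega>, ?r \<omega>)) =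
      distr tree_law (PiM {[]} (\<lambda>_. \<mu>)) ?root \<Otimes>\<^sub>M distr tree_law ?R ?r"
    by (simp add: tree.indep_var_distribution_eq)
  interpret R: prob_space "distr tree_law ?R ?r" by (rule tree.prob_space_distr) measurable
  let ?F = "\<lambda>z r. \<Prod>i<fst z. h z i (\<lambda>v. r (i # v))"
  have cs: "(\<lambda>x. g (fst x) x) \<in> borel_measurable M'" if "fst \<in> M' \<rightarrow>\<^sub>M count_space UNIV" "\<And>n. g n \<in> borel_measurable M'"
    for g :: "nat \<Rightarrow> _ \<Rightarrow> ennreal" and M' using that by measurable
  have [measurable]: "(\<lambda>(z, r). ?F z r) \<in> borel_measurable (\<mu> \<Otimes>\<^sub>M ?R)" by measurable
  have "(\<integral>\<^sup>+\<omega>. (\<Prod>i<fst (\<omega> []). h (\<omega> []) i (subtree i \<omega>)) \<partial>tree_law) =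
        (\<integral>\<^sup>+x. (\<lambda>(z, r). ?F (z []) r) x \<partial>distr tree_law (PiM {[]} (\<lambda>_. \<mu>) \<Otimes>\<^sub>M ?R) (\<lambda>\<omega>. (?root \<omega>, ?r \<omega>)))"
    by (subst nn_integral_distr) (auto simp: subtree_def[abs_def])
  also have "\<dots> = (\<integral>\<^sup>+z. \<integral>\<^sup>+r. ?F (z []) r \<partial>distr tree_law ?R ?r \<partial>distr tree_law (PiM {[]} (\<lambda>_. \<mu>)) ?root)"
    unfolding pair by (subst R.nn_integral_fst[symmetric]) auto
  also have "\<dots> = (\<integral>\<^sup>+\<omega>. \<integral>\<^sup>+r. ?F (\<omega> []) r \<partial>distr tree_law ?R ?r \<partial>tree_law)"
    by (subst nn_integral_distr) auto
  also have "\<dots> = (\<integral>\<^sup>+z. \<integral>\<^sup>+r. ?F z r \<partial>distr tree_law ?R ?r \<partial>distr tree_law \<mu> (\<lambda>\<omega>. \<omega> []))"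
    by (subst nn_integral_distr) auto
  also have "\<dots> = (\<integral>\<^sup>+z. \<integral>\<^sup>+r. ?F z r \<partial>distr tree_law ?R ?r \<partial>\<mu>)"
    by (simp only: distr_coord)
  also have "\<dots> = (\<integral>\<^sup>+z. \<integral>\<^sup>+\<omega>. (\<Prod>i<fst z. h z i (subtree i \<omega>)) \<partial>tree_law \<partial>\<mu>)"
    by (intro nn_integral_cong, subst nn_integral_distr) (auto simp: subtree_def[abs_def])
  also have "\<dots> = (\<integral>\<^sup>+z. (\<Prod>i<fst z. \<integral>\<^sup>+\<omega>. h z i \<omega> \<partial>tree_law) \<partial>\<mu>)"
  proof (intro nn_integral_cong)
    fix z
    have [measurable]: "h z i \<in> borel_measurable tree_law" for i
      by measurable
    have "tree.indep_vars (\<lambda>_. borel) (\<lambda>i \<omega>. h z i (subtree i \<omega>)) {..<fst z}"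
      by (rule tree.indep_vars_compose2[OF tree.indep_vars_subset[OF indep_subtrees]]) auto
    then have "(\<integral>\<^sup>+\<omega>. (\<Prod>i<fst z. h z i (subtree i \<omega>)) \<partial>tree_law) = (\<Prod>i<fst z. \<integral>\<^sup>+\<omega>. h z i (subtree i \<omega>) \<partial>tree_law)"
      by (intro tree.indep_vars_nn_integral) auto
    also have "\<dots> = (\<Prod>i<fst z. \<integral>\<^sup>+\<omega>. h z i \<omega> \<partial>tree_law)"
    proof (rule prod.cong[OF refl])
      fix i
      have "(\<integral>\<^sup>+\<omega>. h z i \<omega> \<partial>tree_law) = (\<integral>\<^sup>+\<omega>. h z i \<omega> \<partial>distr tree_law tree_law (subtree i))"
        by (simp only: distr_subtree)
      then show "(\<integral>\<^sup>+\<omega>. h z i (subtree i \<omega>) \<partial>tree_law) = (\<integral>\<^sup>+\<omega>. h z i \<omega> \<partial>tree_law)"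
        by (subst (asm) nn_integral_distr) auto
    qed
    finally show "(\<integral>\<^sup>+\<omega>. (\<Prod>i<fst z. h z i (subtree i \<omega>)) \<partial>tree_law) = (\<Prod>i<fst z. \<integral>\<^sup>+\<omega>. h z i \<omega> \<partial>tree_law)" .
  qed
  finally show ?thesis .
qed

end

section \<open>Paths below a barrier\<close>

text \<open>The recursion is on the first step of the line of descent, not the last: it moves to the
  subtree of a child and shifts the barrier, which is the form that the branching property can
  use.\<close>

primrec reach :: "nat \<Rightarrow> (nat \<Rightarrow> real) \<Rightarrow> real \<Rightarrow> (nat list \<Rightarrow> nat \<times> (nat \<Rightarrow> real)) \<Rightarrow> bool" where
  "reach 0 \<beta> x \<omega> \<longleftrightarrow> x \<le> \<beta> 0"
| "reach (Suc N) \<beta> x \<omega> \<longleftrightarrow> x \<le> \<beta> 0 \<and>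
     (\<exists>i<fst (\<omega> []). reach N (\<lambda>k. \<beta> (Suc k)) (x + snd (\<omega> []) i) (subtree i \<omega>))"

text \<open>Finite horizons make measurability and continuity from above immediate; as offspring
  numbers are finite, this amounts to an infinite line of descent below the barrier.\<close>

definition stays :: "(nat \<Rightarrow> real) \<Rightarrow> real \<Rightarrow> (nat list \<Rightarrow> nat \<times> (nat \<Rightarrow> real)) \<Rightarrow> bool" where
  "stays \<beta> x \<omega> \<longleftrightarrow> (\<forall>N. reach N \<beta> x \<omega>)"

lemma reach_start: "reach N \<beta> x \<omega> \<Longrightarrow> x \<le> \<beta> 0"
  by (cases N) auto

lemma reach_Suc_imp: "reach (Suc N) \<beta> x \<omega> \<Longrightarrow> reach N \<beta> x \<omega>"
proof (induction N arbitrary: \<beta> x \<omega>)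
  case (Suc N)
  from Suc.prems obtain i where "x \<le> \<beta> 0" "i < fst (\<omega> [])"
      "reach (Suc N) (\<lambda>k. \<beta> (Suc k)) (x + snd (\<omega> []) i) (subtree i \<omega>)"
    by (subst (asm) reach.simps(2)) blast
  then show ?case using Suc.IH by (subst reach.simps(2)) blast
qed simp

lemma reach_horizon_mono: "reach N \<beta> x \<omega> \<Longrightarrow> N' \<le> N \<Longrightarrow> reach N' \<beta> x \<omega>"
  by (induction N) (metis le_Suc_eq reach_Suc_imp le_zero_eq)+

lemma reach_mono:
  "reach N \<beta> x \<omega> \<Longrightarrow> y \<le> x \<Longrightarrow> (\<And>k. k \<le> N \<Longrightarrow> \<beta> k \<le> \<beta>' k) \<Longrightarrow> reach N \<beta>' y \<omega>"
proof (induction N arbitrary: \<beta> \<beta>' x y \<omega>)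
  case 0
  then show ?case by force
next
  case (Suc N)
  from Suc.prems(1) obtain i where i: "i < fst (\<omega> [])"
      "reach N (\<lambda>k. \<beta> (Suc k)) (x + snd (\<omega> []) i) (subtree i \<omega>)" and x: "x \<le> \<beta> 0" by auto
  have "reach N (\<lambda>k. \<beta>' (Suc k)) (y + snd (\<omega> []) i) (subtree i \<omega>)"
    by (rule Suc.IH[OF i(2)]) (use Suc.prems in auto)
  moreover have "y \<le> \<beta>' 0" using x Suc.prems(2) Suc.prems(3)[of 0] by simp
  ultimately show ?case using i by auto
qed

lemma stays_mono: "stays \<beta> x \<omega> \<Longrightarrow> y \<le> x \<Longrightarrow> (\<And>k. \<beta> k \<le> \<beta>' k) \<Longrightarrow> stays \<beta>' y \<omega>"
  unfolding stays_def using reach_mono by blast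

lemma reach_shift: "reach N (\<lambda>k. \<beta> k + c) (x + c) \<omega> \<longleftrightarrow> reach N \<beta> x \<omega>"
proof (induction N arbitrary: \<beta> x \<omega>)
  case (Suc N)
  have "x + c + y = x + y + c" for y :: real by simp
  then show ?case by (simp only: reach.simps Suc[of "\<lambda>k. \<beta> (Suc k)"]) simp
qed simp

lemma stays_shift: "stays (\<lambda>k. \<beta> k + c) (x + c) \<omega> \<longleftrightarrow> stays \<beta> x \<omega>"
  by (simp add: stays_def reach_shift)

text \<open>Compactness at the root: only finitely many children compete, so if each horizon is
  served by some child, a single child serves all horizons.\<close>

lemma stays_rec:
  "stays \<beta> x \<omega> \<longleftrightarrow> x \<le> \<beta> 0 \<and>
     (\<exists>i<fst (\<omega> []). stays (\<lambda>k. \<beta> (Suc k)) (x + snd (\<omega> []) i) (subtree i \<omega>))"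
proof
  assume st: "stays \<beta> x \<omega>"
  let ?R = "\<lambda>N i. reach N (\<lambda>k. \<beta> (Suc k)) (x + snd (\<omega> []) i) (subtree i \<omega>)"
  have ex: "\<exists>i<fst (\<omega> []). ?R N i" for N
    using st unfolding stays_def by (metis reach.simps(2))
  have "\<exists>i<fst (\<omega> []). \<forall>N. ?R N i"
  proof (rule ccontr)
    assume "\<not> ?thesis"
    then obtain f where f: "\<And>i. i < fst (\<omega> []) \<Longrightarrow> \<not> ?R (f i) i" by metis
    \<comment> \<open>The sum of the failing horizons is at least each of them, so by monotonicity
      in the horizon no child can reach it.\<close>
    obtain i where i: "i < fst (\<omega> [])" "?R (\<Sum>i<fst (\<omega> []). f i) i" using ex by blast
    have "f i \<le> (\<Sum>i<fst (\<omega> []). f i)" using i(1) by (intro member_le_sum) auto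
    then show False using f[OF i(1)] i(2) reach_horizon_mono by blast
  qed
  then show "x \<le> \<beta> 0 \<and> (\<exists>i<fst (\<omega> []). stays (\<lambda>k. \<beta> (Suc k)) (x + snd (\<omega> []) i) (subtree i \<omega>))"
    using st unfolding stays_def by (metis reach_start)
next
  assume "x \<le> \<beta> 0 \<and> (\<exists>i<fst (\<omega> []). stays (\<lambda>k. \<beta> (Suc k)) (x + snd (\<omega> []) i) (subtree i \<omega>))"
  then show "stays \<beta> x \<omega>" unfolding stays_def
    by (metis reach.simps not0_implies_Suc)
qed

section \<open>Staying below a barrier in terms of rays of the genealogical tree\<close>

abbreviation tree_nu :: "nat list \<Rightarrow> (nat list \<Rightarrow> nat \<times> (nat \<Rightarrow> real)) \<Rightarrow> nat" where
  "tree_nu \<equiv> \<lambda>u \<omega>. fst (\<omega> u)"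

abbreviation tree_Y :: "nat list \<Rightarrow> nat \<Rightarrow> (nat list \<Rightarrow> nat \<times> (nat \<Rightarrow> real)) \<Rightarrow> real" where
  "tree_Y \<equiv> \<lambda>u i \<omega>. snd (\<omega> u) i"

lemma position_Nil [simp]: "position Y \<omega> [] = 0"
  by (simp add: position_def)

lemma position_snoc: "position Y \<omega> (u @ [i]) = position Y \<omega> u + Y u i \<omega>"
  by (simp add: position_def nth_append)

lemma genealogical_tree_Nil [simp]: "[] \<in> genealogical_tree \<nu> \<omega>"
  by (simp add: genealogical_tree_def)

lemma genealogical_tree_snoc:
  "u @ [i] \<in> genealogical_tree \<nu> \<omega> \<longleftrightarrow> u \<in> genealogical_tree \<nu> \<omega> \<and> i < \<nu> u \<omega>"
  by (auto simp: genealogical_tree_def nth_append less_Suc_eq split: if_splits)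

lemma genealogical_tree_Cons:
  "i # u \<in> genealogical_tree tree_nu \<omega> \<longleftrightarrow> i < fst (\<omega> []) \<and> u \<in> genealogical_tree tree_nu (subtree i \<omega>)"
  unfolding genealogical_tree_def subtree_def mem_Collect_eq
  by (simp only: length_Cons All_less_Suc2) simp

lemma rays_length: "\<Theta> \<in> rays \<nu> \<omega> \<Longrightarrow> length (\<Theta> n) = n"
proof (induction n)
  case 0 then show ?case by (simp add: rays_def)
next
  case (Suc n)
  then obtain i where "\<Theta> (Suc n) = \<Theta> n @ [i]" by (auto simp: rays_def)
  with Suc show ?case by simp
qed

text \<open>Repeated use of \<open>stays_rec\<close> selects child after child, and dependent choice
  assembles the ray; conversely, a ray witnesses every finite horizon. Existence over uncountably
  many rays thereby becomes a measurable event.\<close>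

lemma stays_iff_ray:
  "stays \<beta> 0 \<omega> \<longleftrightarrow> (\<exists>\<Theta>\<in>rays tree_nu \<omega>. \<forall>k. position tree_Y \<omega> (\<Theta> k) \<le> \<beta> k)"
proof
  let ?P = "\<lambda>n u. u \<in> genealogical_tree tree_nu \<omega> \<and>
      stays (\<lambda>k. \<beta> (n + k)) (position tree_Y \<omega> u) (\<lambda>v. \<omega> (u @ v))"
  assume st: "stays \<beta> 0 \<omega>"
  have "\<exists>\<Theta>. \<forall>n. (?P n (\<Theta> n) \<and> (n = 0 \<longrightarrow> \<Theta> n = [])) \<and> (\<exists>i. \<Theta> (Suc n) = \<Theta> n @ [i])"
  proof (rule dependent_nat_choice)
    show "\<exists>x. ?P 0 x \<and> (0 = (0::nat) \<longrightarrow> x = [])" using st by (intro exI[of _ "[]"]) simp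
  next
    fix u n assume u: "?P n u \<and> (n = 0 \<longrightarrow> u = [])"
    then obtain i where i: "i < fst (\<omega> u)"
      "stays (\<lambda>k. \<beta> (n + Suc k)) (position tree_Y \<omega> u + snd (\<omega> u) i) (subtree i (\<lambda>v. \<omega> (u @ v)))"
      by (subst (asm) stays_rec) auto
    then have "?P (Suc n) (u @ [i])"
      using u by (simp add: genealogical_tree_snoc position_snoc subtree_def)
    then show "\<exists>y. (?P (Suc n) y \<and> (Suc n = 0 \<longrightarrow> y = [])) \<and> (\<exists>i. y = u @ [i])" by blast
  qed
  then obtain \<Theta> where \<Theta>: "\<And>n. ?P n (\<Theta> n)" "\<Theta> 0 = []" "\<And>n. \<exists>i. \<Theta> (Suc n) = \<Theta> n @ [i]" by auto
  have "position tree_Y \<omega> (\<Theta> n) \<le> \<beta> n" for n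
    using \<Theta>(1)[of n] stays_rec[of "\<lambda>k. \<beta> (n + k)"] by auto
  then show "\<exists>\<Theta>\<in>rays tree_nu \<omega>. \<forall>k. position tree_Y \<omega> (\<Theta> k) \<le> \<beta> k"
    using \<Theta> unfolding rays_def by (intro bexI[of _ \<Theta>]) auto
next
  assume "\<exists>\<Theta>\<in>rays tree_nu \<omega>. \<forall>k. position tree_Y \<omega> (\<Theta> k) \<le> \<beta> k"
  then obtain \<Theta> where \<Theta>: "\<Theta> 0 = []" "\<And>n. \<Theta> n \<in> genealogical_tree tree_nu \<omega>"
    "\<And>n. \<exists>i. \<Theta> (Suc n) = \<Theta> n @ [i]" "\<And>k. position tree_Y \<omega> (\<Theta> k) \<le> \<beta> k"
    by (auto simp: rays_def)
  have "reach N (\<lambda>k. \<beta> (n + k)) (position tree_Y \<omega> (\<Theta> n)) (\<lambda>v. \<omega> (\<Theta> n @ v))" for N n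
  proof (induction N arbitrary: n)
    case 0 then show ?case using \<Theta> by simp
  next
    case (Suc N)
    obtain i where i: "\<Theta> (Suc n) = \<Theta> n @ [i]" using \<Theta>(3) by blast
    have "i < fst (\<omega> (\<Theta> n))" using \<Theta>(2)[of "Suc n"] unfolding i genealogical_tree_snoc by simp
    with Suc[of "Suc n"] \<Theta>(4)[of n] show ?case
      by (auto simp: i position_snoc subtree_def intro!: exI[of _ i])
  qed
  from this[of _ 0] show "stays \<beta> 0 \<omega>" by (simp add: stays_def \<Theta>)
qed

lemma infinite_tree_rec:
  "infinite (genealogical_tree tree_nu \<omega>) \<longleftrightarrow>
     (\<exists>i<fst (\<omega> []). infinite (genealogical_tree tree_nu (subtree i \<omega>)))"
proof -
  have eq: "genealogical_tree tree_nu \<omega> =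
      insert [] (\<Union>i<fst (\<omega> []). Cons i ` genealogical_tree tree_nu (subtree i \<omega>))" (is "?A = ?B")
  proof (rule set_eqI)
    fix u show "u \<in> ?A \<longleftrightarrow> u \<in> ?B" by (cases u) (auto simp: genealogical_tree_Cons)
  qed
  show ?thesis
    by (subst eq) (auto simp: finite_image_iff)
qed

lemma ray_imp_infinite_tree:
  assumes "\<Theta> \<in> rays \<nu> \<omega>" shows "infinite (genealogical_tree \<nu> \<omega>)"
proof -
  have "inj \<Theta>" using rays_length[OF assms] by (metis injI)
  moreover have "range \<Theta> \<subseteq> genealogical_tree \<nu> \<omega>" using assms by (auto simp: rays_def)
  ultimately show ?thesis using finite_imageD finite_subset infinite_UNIV_nat by metis
qed

section \<open>Probabilities of staying below a barrier\<close>

context offspring_law begin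

lemma measurable_reach [measurable]:
  "Measurable.pred (borel \<Otimes>\<^sub>M tree_law) (\<lambda>(x, \<omega>). reach N \<beta> x \<omega>)"
proof (induction N arbitrary: \<beta>)
  case 0
  show ?case by simp
next
  case (Suc N)
  note [measurable] = Suc[of "\<lambda>k. \<beta> (Suc k)"]
  have "Measurable.pred (borel \<Otimes>\<^sub>M tree_law)
      (\<lambda>p. (\<lambda>(x, \<omega>). reach N (\<lambda>k. \<beta> (Suc k)) x \<omega>) (fst p + snd (snd p []) i, subtree i (snd p)))" for i
    by measurable
  then have [measurable]: "Measurable.pred (borel \<Otimes>\<^sub>M tree_law)
      (\<lambda>p. reach N (\<lambda>k. \<beta> (Suc k)) (fst p + snd (snd p []) i) (subtree i (snd p)))" for i
    by simp
  show ?case unfolding reach.simps case_prod_beta by measurable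
qed

lemma measurable_reach1 [measurable]: "Measurable.pred tree_law (reach N \<beta> x)"
proof -
  have "Measurable.pred tree_law (\<lambda>\<omega>. (\<lambda>(x, \<omega>). reach N \<beta> x \<omega>) (x, \<omega>))" by measurable
  then show ?thesis by simp
qed

lemma measurable_stays [measurable]: "Measurable.pred tree_law (stays \<beta> x)"
  unfolding stays_def[abs_def] by measurable

definition reach_prob :: "nat \<Rightarrow> (nat \<Rightarrow> real) \<Rightarrow> real \<Rightarrow> real" where
  "reach_prob N \<beta> x = tree.prob {\<omega>. reach N \<beta> x \<omega>}"

lemma reach_prob_nonneg [simp]: "0 \<le> reach_prob N \<beta> x" and reach_prob_le_1 [simp]: "reach_prob N \<beta> x \<le> 1"
  by (auto simp: reach_prob_def)

lemma sets_reach [measurable]: "{\<omega>. reach N \<beta> x \<omega>} \<in> tree.events"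
  using measurable_reach1[of N \<beta> x] by (simp add: pred_def)

lemma reach_prob_mono: "y \<le> x \<Longrightarrow> (\<And>k. k \<le> N \<Longrightarrow> \<beta> k \<le> \<beta>' k) \<Longrightarrow> reach_prob N \<beta> x \<le> reach_prob N \<beta>' y"
  unfolding reach_prob_def by (intro tree.finite_measure_mono) (auto intro: reach_mono)

lemma reach_prob_horizon: "N' \<le> N \<Longrightarrow> reach_prob N \<beta> x \<le> reach_prob N' \<beta> x"
  unfolding reach_prob_def by (intro tree.finite_measure_mono) (auto intro: reach_horizon_mono)

lemma reach_prob_0: "reach_prob 0 \<beta> x = (if x \<le> \<beta> 0 then 1 else 0)"
  by (simp add: reach_prob_def tree.prob_space[simplified])

lemma borel_measurable_reach_prob [measurable]: "reach_prob N \<beta> \<in> borel_measurable borel"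
proof -
  have *: "(\<lambda>(x, \<omega>). indicator {\<omega>. reach N \<beta> x \<omega>} \<omega> :: real) = (\<lambda>p. indicator {p. (\<lambda>(x, \<omega>). reach N \<beta> x \<omega>) p} p)"
    by (auto simp: indicator_def)
  have [measurable]: "(\<lambda>(x, \<omega>). indicator {\<omega>. reach N \<beta> x \<omega>} \<omega> :: real) \<in> borel_measurable (borel \<Otimes>\<^sub>M tree_law)"
    unfolding * by (intro borel_measurable_indicator) (use measurable_reach[of N \<beta>] in \<open>simp add: pred_def space_pair_measure case_prod_beta'\<close>)
  have "(\<lambda>x. \<integral>\<omega>. (\<lambda>x \<omega>. indicator {\<omega>. reach N \<beta> x \<omega>} \<omega> :: real) x \<omega> \<partial>tree_law) \<in> borel_measurable borel"
    by (rule tree.borel_measurable_lebesgue_integral[where f="\<lambda>x \<omega>. indicator {\<omega>. reach N \<beta> x \<omega>} \<omega>"]) measurable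
  then show ?thesis by (simp add: reach_prob_def[abs_def])
qed

text \<open>Failure means that every child fails; given the root label, these failures are
  independent and have the probabilities in the product.\<close>

lemma reach_prob_Suc:
  assumes "x \<le> \<beta> 0"
  shows "reach_prob (Suc N) \<beta> x =
     1 - (\<integral>z. (\<Prod>i<fst z. 1 - reach_prob N (\<lambda>k. \<beta> (Suc k)) (x + snd z i)) \<partial>\<mu>)"
proof -
  let ?\<beta> = "\<lambda>k. \<beta> (Suc k)"
  let ?h = "\<lambda>z i \<omega>. if reach N ?\<beta> (x + snd z i) \<omega> then 0 else (1::ennreal)"
  have meas: "(\<lambda>(z, \<omega>). ?h z i \<omega>) \<in> borel_measurable (\<mu> \<Otimes>\<^sub>M tree_law)" for i
  proof -
    have "Measurable.pred (\<mu> \<Otimes>\<^sub>M tree_law) (\<lambda>p. (\<lambda>(x, \<omega>). reach N ?\<beta> x \<omega>) (x + snd (fst p) i, snd p))"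
      by measurable
    then have [measurable]: "Measurable.pred (\<mu> \<Otimes>\<^sub>M tree_law) (\<lambda>p. reach N ?\<beta> (x + snd (fst p) i) (snd p))" by simp
    show ?thesis unfolding case_prod_beta by measurable
  qed
  have prodh: "(\<Prod>i<n. if Q i then 0 else (1::ennreal)) = (if \<exists>i<n. Q i then 0 else 1)" for n and Q :: "nat \<Rightarrow> bool"
    by (induction n) (auto simp: less_Suc_eq)
  have inner: "(\<integral>\<^sup>+\<omega>. ?h z i \<omega> \<partial>tree_law) = ennreal (1 - reach_prob N ?\<beta> (x + snd z i))" for z i
  proof -
    have "(\<integral>\<^sup>+\<omega>. ?h z i \<omega> \<partial>tree_law) = (\<integral>\<^sup>+\<omega>. indicator (space tree_law - {\<omega>. reach N ?\<beta> (x + snd z i) \<omega>}) \<omega> \<partial>tree_law)"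
      by (intro nn_integral_cong) (auto simp: indicator_def)
    also have "\<dots> = emeasure tree_law (space tree_law - {\<omega>. reach N ?\<beta> (x + snd z i) \<omega>})"
      by (intro nn_integral_indicator) measurable
    also have "\<dots> = ennreal (1 - reach_prob N ?\<beta> (x + snd z i))"
      by (subst tree.emeasure_eq_measure, subst tree.prob_compl) (auto simp: reach_prob_def)
    finally show ?thesis .
  qed
  have "ennreal (1 - reach_prob (Suc N) \<beta> x) = emeasure tree_law (space tree_law - {\<omega>. reach (Suc N) \<beta> x \<omega>})"
    by (subst tree.emeasure_eq_measure, subst tree.prob_compl) (auto simp: reach_prob_def simp del: reach.simps)
  also have "\<dots> = (\<integral>\<^sup>+\<omega>. indicator (space tree_law - {\<omega>. reach (Suc N) \<beta> x \<omega>}) \<omega> \<partial>tree_law)"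
    by (intro nn_integral_indicator[symmetric] sets.compl_sets sets_reach)
  also have "\<dots> = (\<integral>\<^sup>+\<omega>. (\<Prod>i<fst (\<omega> []). ?h (\<omega> []) i (subtree i \<omega>)) \<partial>tree_law)"
    by (intro nn_integral_cong) (simp add: prodh indicator_def assms)
  also have "\<dots> = (\<integral>\<^sup>+z. (\<Prod>i<fst z. \<integral>\<^sup>+\<omega>. ?h z i \<omega> \<partial>tree_law) \<partial>\<mu>)"
    by (rule branching_property[OF meas])
  also have "\<dots> = (\<integral>\<^sup>+z. ennreal (\<Prod>i<fst z. 1 - reach_prob N ?\<beta> (x + snd z i)) \<partial>\<mu>)"
    unfolding inner by (intro nn_integral_cong) (simp add: prod_ennreal)
  also have "\<dots> = ennreal (\<integral>z. (\<Prod>i<fst z. 1 - reach_prob N ?\<beta> (x + snd z i)) \<partial>\<mu>)"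
  proof (rule nn_integral_eq_integral)
    have [measurable]: "(\<lambda>z. \<Prod>i<fst z. 1 - reach_prob N ?\<beta> (x + snd z i)) \<in> borel_measurable \<mu>"
      by measurable
    show "integrable \<mu> (\<lambda>z. \<Prod>i<fst z. 1 - reach_prob N ?\<beta> (x + snd z i))"
      by (rule integrable_const_bound[of _ 1]) (auto simp: abs_prod intro!: prod_le_1)
  qed (auto intro!: prod_nonneg)
  finally have "1 - reach_prob (Suc N) \<beta> x = (\<integral>z. (\<Prod>i<fst z. 1 - reach_prob N ?\<beta> (x + snd z i)) \<partial>\<mu>)"
    by (subst (asm) ennreal_inj) (auto intro!: integral_nonneg_AE prod_nonneg)
  then show ?thesis by simp
qed

text \<open>Given the number of children, their subtrees have the property independently and with
  the same probability, which is therefore a fixed point of the generating function of the offspring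
  number.\<close>

lemma hereditary_fixpoint:
  assumes [measurable]: "Measurable.pred tree_law Q"
    and rec: "\<And>\<omega>. Q \<omega> \<longleftrightarrow> (\<forall>i<fst (\<omega> []). Q (subtree i \<omega>))"
  shows "tree.prob {\<omega>. Q \<omega>} = (\<integral>z. tree.prob {\<omega>. Q \<omega>} ^ fst z \<partial>\<mu>)"
proof -
  have ev [measurable]: "{\<omega>. Q \<omega>} \<in> tree.events" using assms(1) by (simp add: pred_def)
  let ?h = "\<lambda>(z :: nat \<times> (nat \<Rightarrow> real)) (i :: nat) \<omega>. indicator {\<omega>. Q \<omega>} \<omega> :: ennreal"
  have prodh: "(\<Prod>i<n. indicator {\<omega>. Q \<omega>} (f i) :: ennreal) = (if \<forall>i<n. Q (f i) then 1 else 0)" for n and f :: "nat \<Rightarrow> _"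
    by (induction n) (auto simp: less_Suc_eq)
  have "ennreal (tree.prob {\<omega>. Q \<omega>}) = (\<integral>\<^sup>+\<omega>. indicator {\<omega>. Q \<omega>} \<omega> \<partial>tree_law)"
    by (simp add: tree.emeasure_eq_measure)
  also have "\<dots> = (\<integral>\<^sup>+\<omega>. (\<Prod>i<fst (\<omega> []). ?h (\<omega> []) i (subtree i \<omega>)) \<partial>tree_law)"
    by (intro nn_integral_cong, subst prodh, subst rec[symmetric]) (simp add: indicator_def)
  also have "\<dots> = (\<integral>\<^sup>+z. (\<Prod>i<fst z. \<integral>\<^sup>+\<omega>. ?h z i \<omega> \<partial>tree_law) \<partial>\<mu>)"
    by (rule branching_property) measurable
  also have "\<dots> = (\<integral>\<^sup>+z. ennreal (tree.prob {\<omega>. Q \<omega>} ^ fst z) \<partial>\<mu>)"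
    by (intro nn_integral_cong) (simp add: tree.emeasure_eq_measure ennreal_power)
  also have "\<dots> = ennreal (\<integral>z. tree.prob {\<omega>. Q \<omega>} ^ fst z \<partial>\<mu>)"
    by (rule nn_integral_eq_integral, rule integrable_const_bound[of _ 1]) (auto intro!: power_le_one)
  finally show ?thesis by (subst (asm) ennreal_inj) (auto intro!: integral_nonneg_AE)
qed

end

section \<open>The rate is almost surely constant on survival\<close>

text \<open>Convexity of the power function without quotients: the chord over \<open>[q, t]\<close>
  is no steeper than the one over \<open>[t, 1]\<close>, and strictly less steep from exponent
  \<open>2\<close> on. Geometric sums factorize the difference.\<close>

lemma power_convex_gap:
  fixes q t :: real
  assumes "0 \<le> q" "q < t" "t < 1"
  shows "(t - q) * (1 - t ^ n) \<ge> (1 - t) * (t ^ n - q ^ n)"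
    and "2 \<le> n \<Longrightarrow> (t - q) * (1 - t ^ n) > (1 - t) * (t ^ n - q ^ n)"
proof -
  have key: "(t - q) * (1 - t ^ n) - (1 - t) * (t ^ n - q ^ n) =
      (t - q) * (1 - t) * (\<Sum>i<n. t ^ i * (1 - q ^ (n - 1 - i)))"
  proof (cases n)
    case (Suc m)
    have 1: "1 - t ^ n = (1 - t) * (\<Sum>i<n. t ^ i)"
      using one_diff_power_eq[of t n] by simp
    have 2: "t ^ n - q ^ n = (t - q) * (\<Sum>i<n. t ^ i * q ^ (n - 1 - i))"
      using diff_power_eq_sum[of t m q] Suc by simp
    have "(t - q) * (1 - t ^ n) - (1 - t) * (t ^ n - q ^ n) =
        (t - q) * (1 - t) * ((\<Sum>i<n. t ^ i) - (\<Sum>i<n. t ^ i * q ^ (n - 1 - i)))"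
      unfolding 1 2 by (simp only: algebra_simps)
    also have "(\<Sum>i<n. t ^ i) - (\<Sum>i<n. t ^ i * q ^ (n - 1 - i)) = (\<Sum>i<n. t ^ i * (1 - q ^ (n - 1 - i)))"
      by (simp add: sum_subtractf right_diff_distrib)
    finally show ?thesis .
  qed simp
  have nn: "0 \<le> t ^ i * (1 - q ^ (n - 1 - i))" for i
    using assms by (intro mult_nonneg_nonneg) (auto intro!: power_le_one)
  have s: "0 \<le> (\<Sum>i<n. t ^ i * (1 - q ^ (n - 1 - i)))" by (intro sum_nonneg nn)
  then have "0 \<le> (t - q) * (1 - t) * (\<Sum>i<n. t ^ i * (1 - q ^ (n - 1 - i)))"
    using assms by (intro mult_nonneg_nonneg) auto
  then show "(t - q) * (1 - t ^ n) \<ge> (1 - t) * (t ^ n - q ^ n)" using key by simp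
  assume n: "2 \<le> n"
  have "0 < t ^ 0 * (1 - q ^ (n - 1 - 0))" using assms n by (simp add: power_less_one_iff)
  then have "0 < (\<Sum>i<n. t ^ i * (1 - q ^ (n - 1 - i)))"
    by (intro sum_pos2[of _ 0]) (use n nn in auto)
  then have "0 < (t - q) * (1 - t) * (\<Sum>i<n. t ^ i * (1 - q ^ (n - 1 - i)))"
    using assms by (intro mult_pos_pos) auto
  then show "(t - q) * (1 - t ^ n) > (1 - t) * (t ^ n - q ^ n)" using key by simp
qed

text \<open>Division by \<open>1 + x\<close> reduces this to \<open>u \<le> u powr p\<close> on the
  unit interval. It later absorbs the shift of time by one generation.\<close>

lemma one_add_powr_le:
  fixes p x :: real
  assumes "0 \<le> p" "p \<le> 1" "0 \<le> x" shows "(1 + x) powr p \<le> x powr p + 1"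
proof -
  let ?u = "1 + x"
  have u: "0 < ?u" using assms by simp
  have "1 / ?u \<le> (1 / ?u) powr p"
    using powr_mono'[of p 1 "1 / ?u"] assms u by simp
  moreover have "x / ?u \<le> (x / ?u) powr p"
    using powr_mono'[of p 1 "x / ?u"] assms u by simp
  ultimately have "1 / ?u + x / ?u \<le> (1 + x powr p) / ?u powr p"
    using assms u by (simp add: powr_divide add_divide_distrib)
  moreover have "1 / ?u + x / ?u = 1" using u by (simp flip: add_divide_distrib)
  ultimately show ?thesis using u by (simp add: field_simps)
qed

lemma ereal_less_rat:
  fixes I :: ereal
  assumes "I < ereal a" "0 < a"
  obtains r where "r \<in> \<rat>" "0 \<le> r" "r < a" "I < ereal r"
proof -
  have "max I 0 < ereal a" using assms by simp
  then obtain r0 where r0: "max I 0 < ereal r0" "ereal r0 < ereal a" using ereal_dense2 by blast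
  obtain r where r: "r \<in> \<rat>" "r0 < r" "r < a" using Rats_dense_in_real[of r0 a] r0 by auto
  have "0 < r0" using r0 by (simp flip: zero_ereal_def)
  moreover have "I < ereal r" using r0 r by (auto intro: less_trans)
  ultimately show ?thesis using r that[of r] by simp
qed

text \<open>Only countably many null sets can be discarded, so the value has to be identified by
  comparison with rational levels.\<close>

lemma ereal_eqI_rat:
  fixes I :: ereal
  assumes "0 < a"
    and lower: "\<And>r. r \<in> \<rat> \<Longrightarrow> 0 < r \<Longrightarrow> r < a \<Longrightarrow> \<not> I < ereal r"
    and upper: "\<And>r. r \<in> \<rat> \<Longrightarrow> a < r \<Longrightarrow> I < ereal r"
  shows "I = ereal a"
proof (rule antisym)
  show "I \<le> ereal a"
  proof (rule ccontr)
    assume "\<not> I \<le> ereal a"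
    then obtain r0 where r0: "ereal a < ereal r0" "ereal r0 < I" using ereal_dense2[of "ereal a" I] by (auto simp: not_le)
    obtain r where r: "r \<in> \<rat>" "a < r" "r < r0" using Rats_dense_in_real[of a r0] r0 by auto
    have "I < ereal r0" using upper[OF r(1,2)] r(3) by (auto intro: less_trans)
    then show False using r0 by auto
  qed
  show "ereal a \<le> I"
  proof (rule ccontr)
    assume "\<not> ereal a \<le> I"
    then obtain r where r: "r \<in> \<rat>" "0 \<le> r" "r < a" "I < ereal r"
      using ereal_less_rat[of I a] \<open>0 < a\<close> by (auto simp: not_le)
    obtain r' where r': "r' \<in> \<rat>" "r < r'" "r' < a" using Rats_dense_in_real[OF r(3)] by blast
    have "I < ereal r'" using r r' by (auto intro: less_trans)
    then show False using lower[of r'] r r' by auto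
  qed
qed

section \<open>Fixed points of the generating function and the critical rate\<close>

context offspring_law begin

text \<open>If \<open>q < t < 1\<close>, the convex generating function meets the diagonal at the
  three points \<open>q\<close>, \<open>t\<close> and \<open>1\<close>. The mean of the nonnegative
  convexity gap is then \<open>0\<close>, so the gap vanishes almost surely, which forces at most
  one child.\<close>

lemma generating_function_fixpoints:
  fixes q t :: real
  assumes "0 \<le> q" "q \<le> t" "t \<le> 1"
    and q: "q = (\<integral>z. q ^ fst z \<partial>\<mu>)" and t: "t = (\<integral>z. t ^ fst z \<partial>\<mu>)"
    and nontriv: "\<not> (AE z in \<mu>. fst z \<le> 1)"
  shows "t = q \<or> t = 1"
proof (rule ccontr)
  assume "\<not> (t = q \<or> t = 1)"
  then have qt: "q < t" "t < 1" using assms by auto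
  let ?f = "\<lambda>z. (t - q) * (1 - t ^ fst z) - (1 - t) * (t ^ fst z - q ^ fst z)"
  have [measurable]: "(\<lambda>z. x ^ fst z) \<in> borel_measurable \<mu>" for x :: real by measurable
  have int: "integrable \<mu> (\<lambda>z. x ^ fst z)" if "0 \<le> x" "x \<le> 1" for x :: real
    by (rule integrable_const_bound[of _ 1]) (use that in \<open>auto intro!: power_le_one\<close>)
  have ints: "integrable \<mu> (\<lambda>z. q ^ fst z)" "integrable \<mu> (\<lambda>z. t ^ fst z)" using assms qt by (auto intro!: int)
  have "(\<integral>z. ?f z \<partial>\<mu>) = (t - q) * (1 - (\<integral>z. t ^ fst z \<partial>\<mu>)) - (1 - t) * ((\<integral>z. t ^ fst z \<partial>\<mu>) - (\<integral>z. q ^ fst z \<partial>\<mu>))"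
    using ints prob_space[simplified] by simp
  also have "\<dots> = 0" unfolding q[symmetric] t[symmetric] by (simp only: algebra_simps)
  finally have "AE z in \<mu>. ?f z = 0"
    using power_convex_gap(1)[OF assms(1) qt] ints by (subst (asm) integral_nonneg_eq_0_iff_AE) auto
  then have "AE z in \<mu>. fst z \<le> 1"
  proof eventually_elim
    case (elim z)
    then show ?case using power_convex_gap(2)[OF assms(1) qt, of "fst z"] by (cases "2 \<le> fst z") auto
  qed
  then show False using nontriv by simp
qed

text \<open>The offset \<open>D\<close> forgets any finite initial piece of a ray, and a slope
  strictly below \<open>a\<close> encodes a limsup strictly below \<open>a\<close>. Rational slopes
  and integer offsets make the event a countable union.\<close>

definition below_rate :: "real \<Rightarrow> real \<Rightarrow> (nat list \<Rightarrow> nat \<times> (nat \<Rightarrow> real)) \<Rightarrow> bool" where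
  "below_rate p a \<omega> \<longleftrightarrow> (\<exists>r\<in>{r\<in>\<rat>. 0 \<le> r \<and> r < a}. \<exists>D::nat. stays (\<lambda>k. real D + r * real k powr p) 0 \<omega>)"

lemma measurable_below_rate [measurable]: "Measurable.pred tree_law (below_rate p a)"
proof -
  have c: "countable {r\<in>\<rat>. 0 \<le> r \<and> r < a}" by (rule countable_subset[OF _ countable_rat]) auto
  show ?thesis unfolding below_rate_def[abs_def]
    by (rule measurable_pred_countable(2)[OF c]) measurable
qed

lemma below_rate_mono: "below_rate p a \<omega> \<Longrightarrow> a \<le> a' \<Longrightarrow> below_rate p a' \<omega>"
  unfolding below_rate_def by force

lemma below_rate_infinite_tree: "below_rate p a \<omega> \<Longrightarrow> infinite (genealogical_tree tree_nu \<omega>)"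
  unfolding below_rate_def stays_iff_ray by (auto dest: ray_imp_infinite_tree)

text \<open>A tree is finite iff it is contained in one of the countably many finite sets of
  words.\<close>

lemma measurable_finite_tree [measurable]:
  "Measurable.pred tree_law (\<lambda>\<omega>. finite (genealogical_tree tree_nu \<omega>))"
proof -
  have eq: "finite (genealogical_tree tree_nu \<omega>) \<longleftrightarrow>
      (\<exists>F\<in>Collect finite. \<forall>u. u \<in> genealogical_tree tree_nu \<omega> \<longrightarrow> u \<in> F)" for \<omega>
    by (auto intro: finite_subset[of "genealogical_tree tree_nu \<omega>"])
  have "countable (Collect finite :: nat list set set)" by (rule countable_Collect_finite)
  then have "Measurable.pred tree_law
      (\<lambda>\<omega>. \<exists>F\<in>Collect finite. \<forall>u. u \<in> genealogical_tree tree_nu \<omega> \<longrightarrow> u \<in> F)"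
    unfolding genealogical_tree_def mem_Collect_eq
    by (rule measurable_pred_countable(2)) measurable
  then show ?thesis by (simp only: eq[symmetric])
qed

text \<open>Passing to a child shifts time by one and height by the displacement; a larger offset
  absorbs both.\<close>

lemma below_rate_rec:
  assumes p: "0 < p" "p \<le> 1"
  shows "below_rate p a \<omega> \<longleftrightarrow> (\<exists>i<fst (\<omega> []). below_rate p a (subtree i \<omega>))"
proof
  assume "below_rate p a \<omega>"
  then obtain r D where r: "r \<in> \<rat>" "0 \<le> r" "r < a" "stays (\<lambda>k. real D + r * real k powr p) 0 \<omega>"
    by (auto simp: below_rate_def)
  then obtain i where i: "i < fst (\<omega> [])"
    "stays (\<lambda>k. real D + r * real (Suc k) powr p) (snd (\<omega> []) i) (subtree i \<omega>)"
    by (subst (asm) (2) stays_rec) auto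
  let ?y = "snd (\<omega> []) i"
  \<comment> \<open>The summand \<open>r\<close> pays for the time shift, since
    \<open>(k + 1) powr p \<le> k powr p + 1\<close>.\<close>
  obtain D' :: nat where D': "real D + r - ?y \<le> real D'" using real_arch_simple by blast
  have "stays (\<lambda>k. real D + r * real (Suc k) powr p + - ?y) (?y + - ?y) (subtree i \<omega>)"
    using i(2) by (subst stays_shift)
  then have "stays (\<lambda>k. real D' + r * real k powr p) 0 (subtree i \<omega>)"
  proof (rule stays_mono)
    fix k
    have "r * real (Suc k) powr p \<le> r * (real k powr p + 1)"
      using one_add_powr_le[of p "real k"] p r by (intro mult_left_mono) auto
    then show "real D + r * real (Suc k) powr p + - ?y \<le> real D' + r * real k powr p"
      using D' by (simp add: algebra_simps)
  qed simp
  then show "\<exists>i<fst (\<omega> []). below_rate p a (subtree i \<omega>)" using i r unfolding below_rate_def by blast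
next
  assume "\<exists>i<fst (\<omega> []). below_rate p a (subtree i \<omega>)"
  then obtain i r D where i: "i < fst (\<omega> [])" and r: "r \<in> \<rat>" "0 \<le> r" "r < a"
    and st: "stays (\<lambda>k. real D + r * real k powr p) 0 (subtree i \<omega>)"
    by (auto simp: below_rate_def)
  let ?y = "snd (\<omega> []) i"
  obtain D' :: nat where D': "real D + \<bar>?y\<bar> \<le> real D'" using real_arch_simple by blast
  have "stays (\<lambda>k. real D + r * real k powr p + ?y) (0 + ?y) (subtree i \<omega>)"
    using st by (subst stays_shift)
  then have "stays (\<lambda>k. real D' + r * real (Suc k) powr p) (0 + ?y) (subtree i \<omega>)"
  proof (rule stays_mono)
    fix k
    have "r * real k powr p \<le> r * real (Suc k) powr p"
      using p r by (intro mult_left_mono powr_mono2) auto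
    then show "real D + r * real k powr p + ?y \<le> real D' + r * real (Suc k) powr p"
      using D' by linarith
  qed simp
  then have "stays (\<lambda>k. real D' + r * real k powr p) 0 \<omega>"
    using i by (subst stays_rec) auto
  then show "below_rate p a \<omega>" using r unfolding below_rate_def by blast
qed

text \<open>A limsup below \<open>a\<close> leaves room for a rational slope in between, and the
  finitely many exceptional positions go into \<open>D\<close>. Conversely, \<open>D\<close>
  disappears after division by \<open>n powr p\<close>.\<close>

lemma inf_limsup_less_iff:
  assumes p: "0 < p" and a: "0 < a"
  shows "(INF \<Theta>\<in>rays tree_nu \<omega>. limsup (\<lambda>n. ereal (position tree_Y \<omega> (\<Theta> n) / real n powr p))) < ereal a
    \<longleftrightarrow> below_rate p a \<omega>"
proof
  assume "(INF \<Theta>\<in>rays tree_nu \<omega>. limsup (\<lambda>n. ereal (position tree_Y \<omega> (\<Theta> n) / real n powr p))) < ereal a"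
  then obtain \<Theta> where \<Theta>: "\<Theta> \<in> rays tree_nu \<omega>"
    and ls: "limsup (\<lambda>n. ereal (position tree_Y \<omega> (\<Theta> n) / real n powr p)) < ereal a"
    unfolding INF_less_iff by blast
  obtain r where r: "r \<in> \<rat>" "0 \<le> r" "r < a"
    and lr: "limsup (\<lambda>n. ereal (position tree_Y \<omega> (\<Theta> n) / real n powr p)) < ereal r"
    using ereal_less_rat[OF ls a] by blast
  have "\<forall>\<^sub>F n in sequentially. ereal (position tree_Y \<omega> (\<Theta> n) / real n powr p) < ereal r"
    by (rule Limsup_lessD[OF lr])
  then obtain N where N: "\<And>n. n \<ge> N \<Longrightarrow> position tree_Y \<omega> (\<Theta> n) / real n powr p < r"
    by (auto simp: eventually_sequentially)
  obtain D :: nat where D: "(\<Sum>k\<le>N. \<bar>position tree_Y \<omega> (\<Theta> k)\<bar>) \<le> real D" using real_arch_simple by blast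
  have "position tree_Y \<omega> (\<Theta> k) \<le> real D + r * real k powr p" for k
  proof (cases "k \<le> N")
    case True
    have "\<bar>position tree_Y \<omega> (\<Theta> k)\<bar> \<le> (\<Sum>k\<le>N. \<bar>position tree_Y \<omega> (\<Theta> k)\<bar>)"
      using True by (intro member_le_sum) auto
    moreover have "0 \<le> r * real k powr p" using r by simp
    ultimately show ?thesis using D by linarith
  next
    case False
    then have "position tree_Y \<omega> (\<Theta> k) < r * real k powr p"
      using N[of k] by (simp add: pos_divide_less_eq)
    then show ?thesis by linarith
  qed
  then have "stays (\<lambda>k. real D + r * real k powr p) 0 \<omega>" using \<Theta> by (auto simp: stays_iff_ray)
  then show "below_rate p a \<omega>" using r by (auto simp: below_rate_def)
next
  assume "below_rate p a \<omega>"
  then obtain r D \<Theta> where r: "0 \<le> r" "r < a" and \<Theta>: "\<Theta> \<in> rays tree_nu \<omega>"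
    and le: "\<And>k. position tree_Y \<omega> (\<Theta> k) \<le> real D + r * real k powr p"
    by (auto simp: below_rate_def stays_iff_ray)
  have "limsup (\<lambda>n. ereal (position tree_Y \<omega> (\<Theta> n) / real n powr p)) \<le> limsup (\<lambda>n. ereal (real D / real n powr p + r))"
  proof (rule Limsup_mono)
    show "\<forall>\<^sub>F n in sequentially. ereal (position tree_Y \<omega> (\<Theta> n) / real n powr p) \<le> ereal (real D / real n powr p + r)"
      using eventually_gt_at_top[of 0]
    proof eventually_elim
      case (elim n)
      have "position tree_Y \<omega> (\<Theta> n) / real n powr p \<le> (real D + r * real n powr p) / real n powr p"
        using le[of n] by (intro divide_right_mono) auto
      then show ?case using elim by (simp add: field_simps)
    qed
  qed
  also have "(\<lambda>n. real D / real n powr p + r) \<longlonglongrightarrow> 0 + r"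
  proof (intro tendsto_add tendsto_const)
    have "filterlim (\<lambda>n. real n powr p) at_top sequentially"
      using p by real_asymp
    then show "(\<lambda>n. real D / real n powr p) \<longlonglongrightarrow> 0" by (rule real_tendsto_divide_at_top[OF tendsto_const])
  qed
  then have "limsup (\<lambda>n. ereal (real D / real n powr p + r)) = ereal r"
    by (intro lim_imp_Limsup) auto
  finally have "limsup (\<lambda>n. ereal (position tree_Y \<omega> (\<Theta> n) / real n powr p)) < ereal a"
    by (rule le_less_trans) (simp add: r)
  then show "(INF \<Theta>\<in>rays tree_nu \<omega>. limsup (\<lambda>n. ereal (position tree_Y \<omega> (\<Theta> n) / real n powr p))) < ereal a"
    unfolding INF_less_iff using \<Theta> by blast
qed

text \<open>The probability \<open>t a\<close> of failing at level \<open>a\<close> is nonincreasing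
  in \<open>a\<close> and can only be \<open>1\<close> or the extinction probability
  \<open>q\<close>. The constant is the level at which it drops; the hypotheses on \<open>c\<close>
  and \<open>C0\<close> keep this level positive and finite.\<close>

lemma constant_rate:
  assumes p: "0 < p" "p \<le> 1" and nontriv: "\<not> (AE z in \<mu>. fst z \<le> 1)"
    and c: "0 < c" "\<And>r D. 0 \<le> r \<Longrightarrow> r < c \<Longrightarrow> tree.prob {\<omega>. stays (\<lambda>k. real D + r * real k powr p) 0 \<omega>} = 0"
    and C: "0 < tree.prob {\<omega>. stays (\<lambda>k. real D0 + C0 * real k powr p) 0 \<omega>}"
  shows "\<exists>a>0. AE \<omega> in tree_law. infinite (genealogical_tree tree_nu \<omega>) \<longrightarrow>
     (INF \<Theta>\<in>rays tree_nu \<omega>. limsup (\<lambda>n. ereal (position tree_Y \<omega> (\<Theta> n) / real n powr p))) = ereal a"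
proof -
  define t where "t a = tree.prob {\<omega>. \<not> below_rate p a \<omega>}" for a
  define q where "q = tree.prob {\<omega>. finite (genealogical_tree tree_nu \<omega>)}"
  have ev [measurable]: "{\<omega>. below_rate p a \<omega>} \<in> tree.events" "{\<omega>. \<not> below_rate p a \<omega>} \<in> tree.events"
    "{\<omega>. finite (genealogical_tree tree_nu \<omega>)} \<in> tree.events" for a
  proof -
    show "{\<omega>. below_rate p a \<omega>} \<in> tree.events" using measurable_below_rate by (simp add: pred_def)
    have "Measurable.pred tree_law (\<lambda>\<omega>. \<not> below_rate p a \<omega>)" by measurable
    then show "{\<omega>. \<not> below_rate p a \<omega>} \<in> tree.events" by (simp add: pred_def)
    show "{\<omega>. finite (genealogical_tree tree_nu \<omega>)} \<in> tree.events" using measurable_finite_tree by (simp add: pred_def)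
  qed
  have q: "q = (\<integral>z. q ^ fst z \<partial>\<mu>)"
    unfolding q_def by (rule hereditary_fixpoint[OF measurable_finite_tree]) (subst infinite_tree_rec[THEN arg_cong[of _ _ Not], simplified], simp)
  have t: "t a = (\<integral>z. t a ^ fst z \<partial>\<mu>)" for a
    unfolding t_def by (rule hereditary_fixpoint) (measurable, subst below_rate_rec[OF p], simp)
  have qt: "q \<le> t a" for a
    unfolding q_def t_def using below_rate_infinite_tree by (intro tree.finite_measure_mono) auto
  have dich: "t a = q \<or> t a = 1" for a
    by (rule generating_function_fixpoints[OF _ qt _ q t nontriv]) (auto simp: q_def t_def)
  have t_anti: "t a' \<le> t a" if "a \<le> a'" for a a'
    unfolding t_def using below_rate_mono that by (intro tree.finite_measure_mono) auto
  have t_eq: "t a = 1 - tree.prob {\<omega>. below_rate p a \<omega>}" for a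
    using tree.prob_compl[of "{\<omega>. below_rate p a \<omega>}"] by (simp add: t_def Compl_eq Compl_eq_Diff_UNIV[symmetric])
  have AE1: "AE \<omega> in tree_law. \<not> below_rate p a \<omega>" if "t a = 1" for a
    using that unfolding t_def by (subst (asm) tree.prob_eq_1) auto
  have "t c = 1"
  proof -
    have "AE \<omega> in tree_law. \<forall>r\<in>{r\<in>\<rat>. 0 \<le> r \<and> r < c}. \<forall>D::nat. \<not> stays (\<lambda>k. real D + r * real k powr p) 0 \<omega>"
    proof (subst AE_ball_countable)
      show "countable {r\<in>\<rat>. 0 \<le> r \<and> r < c}" by (rule countable_subset[OF _ countable_rat]) auto
      show "\<forall>r\<in>{r\<in>\<rat>. 0 \<le> r \<and> r < c}. AE \<omega> in tree_law. \<forall>D::nat. \<not> stays (\<lambda>k. real D + r * real k powr p) 0 \<omega>"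
      proof
        fix r assume "r \<in> {r\<in>\<rat>. 0 \<le> r \<and> r < c}"
        then have z: "tree.prob {\<omega>. stays (\<lambda>k. real D + r * real k powr p) 0 \<omega>} = 0" for D using c(2) by auto
        show "AE \<omega> in tree_law. \<forall>D::nat. \<not> stays (\<lambda>k. real D + r * real k powr p) 0 \<omega>"
          unfolding AE_all_countable
        proof
          fix D
          show "AE \<omega> in tree_law. \<not> stays (\<lambda>k. real D + r * real k powr p) 0 \<omega>"
            using z[of D] measurable_stays
            by (intro AE_I[of _ _ "{\<omega>. stays (\<lambda>k. real D + r * real k powr p) 0 \<omega>}"])
              (auto simp: tree.emeasure_eq_measure pred_def)
        qed
      qed
    qed
    then have "AE \<omega> in tree_law. \<not> below_rate p c \<omega>" by eventually_elim (auto simp: below_rate_def)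
    then show ?thesis unfolding t_def by (subst tree.prob_eq_1) auto
  qed
  \<comment> \<open>Slopes in \<open>below_rate\<close> are rational and strictly below the level,
    hence a rational \<open>C\<close> above \<open>C0\<close> and the level
    \<open>C + 1\<close>.\<close>
  obtain C where C': "C \<in> \<rat>" "max 0 C0 < C" using Rats_dense_in_real[of "max 0 C0" "max 0 C0 + 1"] by auto
  have "tree.prob {\<omega>. stays (\<lambda>k. real D0 + C0 * real k powr p) 0 \<omega>} \<le> tree.prob {\<omega>. below_rate p (C + 1) \<omega>}"
  proof (intro tree.finite_measure_mono subsetI)
    fix \<omega> assume "\<omega> \<in> {\<omega>. stays (\<lambda>k. real D0 + C0 * real k powr p) 0 \<omega>}"
    then have "stays (\<lambda>k. real D0 + C0 * real k powr p) 0 \<omega>" by simp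
    then have "stays (\<lambda>k. real D0 + C * real k powr p) 0 \<omega>"
      by (rule stays_mono) (use C' in \<open>auto intro!: mult_right_mono\<close>)
    then show "\<omega> \<in> {\<omega>. below_rate p (C + 1) \<omega>}" using C' by (auto simp: below_rate_def intro!: bexI[of _ C])
  qed simp
  then have tC: "t (C + 1) < 1" using C by (simp add: t_eq)
  define S where "S = {a. 0 < a \<and> t a = 1}"
  have cS: "c \<in> S" using c \<open>t c = 1\<close> by (simp add: S_def)
  have S_less: "a \<le> C + 1" if "a \<in> S" for a
    using that tC t_anti[of "C + 1" a] by (force simp: S_def not_le)
  define a where "a = Sup S"
  have bdd: "bdd_above S" using S_less by (meson bdd_aboveI)
  have "c \<le> a" unfolding a_def using cS bdd by (rule cSup_upper)
  then have "0 < a" using c by simp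
  have low: "t r = 1" if r: "r < a" for r
  proof -
    obtain r' where "r' \<in> S" "r < r'" using r cS unfolding a_def by (metis empty_iff less_cSup_iff bdd)
    then show ?thesis using t_anti[of r r'] by (simp add: S_def t_def antisym)
  qed
  have high: "t r = q" if r: "a < r" for r
    using dich[of r] r \<open>0 < a\<close> cSup_upper[OF _ bdd, of r] by (auto simp: S_def a_def)
  \<comment> \<open>Extinction is contained in failure, so equal probabilities make the difference a
    null set.\<close>
  have AE2: "AE \<omega> in tree_law. infinite (genealogical_tree tree_nu \<omega>) \<longrightarrow> below_rate p r \<omega>" if "a < r" for r
  proof -
    have sub: "{\<omega>. finite (genealogical_tree tree_nu \<omega>)} \<subseteq> {\<omega>. \<not> below_rate p r \<omega>}"
      using below_rate_infinite_tree by auto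
    have "tree.prob ({\<omega>. \<not> below_rate p r \<omega>} - {\<omega>. finite (genealogical_tree tree_nu \<omega>)}) = 0"
      using high[OF that] by (subst tree.finite_measure_Diff[OF _ _ sub]) (auto simp: t_def q_def)
    then show ?thesis
      by (intro AE_I[of _ _ "{\<omega>. \<not> below_rate p r \<omega>} - {\<omega>. finite (genealogical_tree tree_nu \<omega>)}"])
        (auto simp: tree.emeasure_eq_measure)
  qed
  have "AE \<omega> in tree_law. \<forall>r\<in>\<rat>. (r < a \<longrightarrow> \<not> below_rate p r \<omega>) \<and>
      (a < r \<longrightarrow> infinite (genealogical_tree tree_nu \<omega>) \<longrightarrow> below_rate p r \<omega>)"
    unfolding AE_ball_countable[OF countable_rat]
  proof
    fix r
    consider "r < a" | "r = a" | "a < r" by linarith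
    then show "AE \<omega> in tree_law. (r < a \<longrightarrow> \<not> below_rate p r \<omega>) \<and>
        (a < r \<longrightarrow> infinite (genealogical_tree tree_nu \<omega>) \<longrightarrow> below_rate p r \<omega>)"
    proof cases
      case 1
      show ?thesis using AE1[OF low[OF 1]] by eventually_elim (use 1 in simp)
    next
      case 2
      then show ?thesis by simp
    next
      case 3
      show ?thesis using AE2[OF 3] by eventually_elim (use 3 in simp)
    qed
  qed
  then have "AE \<omega> in tree_law. infinite (genealogical_tree tree_nu \<omega>) \<longrightarrow>
     (INF \<Theta>\<in>rays tree_nu \<omega>. limsup (\<lambda>n. ereal (position tree_Y \<omega> (\<Theta> n) / real n powr p))) = ereal a"
  proof eventually_elim
    case (elim \<omega>)
    show ?case
    proof (intro impI ereal_eqI_rat[OF \<open>0 < a\<close>])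
      fix r :: real assume "r \<in> \<rat>" "0 < r" "r < a"
      then show "\<not> (INF \<Theta>\<in>rays tree_nu \<omega>. limsup (\<lambda>n. ereal (position tree_Y \<omega> (\<Theta> n) / real n powr p))) < ereal r"
        unfolding inf_limsup_less_iff[OF p(1) \<open>0 < r\<close>] using elim by blast
    next
      fix r :: real assume "infinite (genealogical_tree tree_nu \<omega>)" "r \<in> \<rat>" and r: "a < r"
      moreover have "0 < r" using r \<open>0 < a\<close> by simp
      ultimately show "(INF \<Theta>\<in>rays tree_nu \<omega>. limsup (\<lambda>n. ereal (position tree_Y \<omega> (\<Theta> n) / real n powr p))) < ereal r"
        using elim by (subst inf_limsup_less_iff[OF p(1)]) blast+
    qed
  qed
  with \<open>0 < a\<close> show ?thesis by (intro exI[of _ a] conjI)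
qed

end

section \<open>Slow rays do not exist\<close>

text \<open>For \<open>t \<ge> 0\<close> apply \<open>exp t - 1 \<le> t * exp t\<close> twice; for
  \<open>t = - s < 0\<close> use \<open>exp (- s) \<le> 1 / (1 + s) \<le> 1 - s + s\<^sup>2\<close>.
  The exponential factor sees only positive \<open>t\<close>, so each application needs a moment on
  one side only.\<close>

lemma exp_le_quadratic:
  fixes t :: real
  shows "exp t \<le> 1 + t + t\<^sup>2 * exp (max 0 t)"
proof (cases "0 \<le> t")
  case True
  have "exp t * (1 - t) \<le> exp t * exp (- t)"
    using exp_ge_add_one_self[of "- t"] by (intro mult_left_mono) auto
  then have "exp t - 1 \<le> t * exp t" by (simp add: algebra_simps flip: exp_add)
  then have "t * (exp t - 1) \<le> t * (t * exp t)" using True by (rule mult_left_mono)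
  with \<open>exp t - 1 \<le> t * exp t\<close> show ?thesis using True by (simp add: algebra_simps power2_eq_square)
next
  case False
  define s where "s = - t"
  have s: "0 < s" using False by (simp add: s_def)
  have "(1 + s) * (1 - s + s\<^sup>2) = 1 + s * s\<^sup>2" by (simp add: algebra_simps power2_eq_square)
  also have "\<dots> \<ge> 1" using s by simp
  finally have "1 / (1 + s) \<le> 1 - s + s\<^sup>2" using s by (simp add: field_simps)
  moreover have "exp (- s) \<le> 1 / (1 + s)"
    using exp_ge_add_one_self[of s] s by (simp add: exp_minus field_simps)
  ultimately show ?thesis using False by (simp add: s_def)
qed

lemma one_minus_prod_le_sum:
  fixes r :: "nat \<Rightarrow> real"
  assumes "\<And>i. 0 \<le> r i" "\<And>i. r i \<le> 1"
  shows "1 - (\<Prod>i<n. 1 - r i) \<le> (\<Sum>i<n. r i)"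
proof (induction n)
  case (Suc n)
  have "(\<Prod>i<n. 1 - r i) \<le> 1" using assms by (intro prod_le_1) auto
  then have "(\<Prod>i<n. 1 - r i) * r n \<le> 1 * r n" using assms by (intro mult_right_mono) auto
  with Suc show ?case by (simp add: algebra_simps)
qed simp

lemma power_le_exp_powr:
  fixes c b :: real
  assumes "0 < c" "0 < b"
  obtains K where "0 < K" "\<And>x. 0 \<le> x \<Longrightarrow> x ^ j \<le> K * exp (c * x powr b)"
proof -
  have "\<forall>\<^sub>F x :: real in at_top. x ^ j \<le> exp (c * x powr b)" using assms by real_asymp
  then obtain x1 where x1: "\<And>x. x1 \<le> x \<Longrightarrow> x ^ j \<le> exp (c * x powr b)"
    by (auto simp: eventually_at_top_linorder)
  let ?K = "1 + \<bar>x1\<bar> ^ j"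
  show ?thesis
  proof (rule that[of ?K])
    fix x :: real assume x: "0 \<le> x"
    have e: "1 \<le> exp (c * x powr b)" using assms by simp
    have K: "1 \<le> ?K" by simp
    show "x ^ j \<le> ?K * exp (c * x powr b)"
    proof (cases "x1 \<le> x")
      case True
      then have "x ^ j \<le> 1 * exp (c * x powr b)" using x1 by simp
      also have "\<dots> \<le> ?K * exp (c * x powr b)" by (intro mult_right_mono) auto
      finally show ?thesis .
    next
      case False
      then have "x ^ j \<le> \<bar>x1\<bar> ^ j" using x by (intro power_mono) auto
      also have "\<dots> \<le> ?K * 1" by simp
      also have "\<dots> \<le> ?K * exp (c * x powr b)" using e by (intro mult_left_mono) auto
      finally show ?thesis .
    qed
  qed (simp add: add_pos_nonneg)
qed

text \<open>The law \<open>\<kappa>\<close> of \<open>X\<close>, reduced to what the estimates use: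
  a stretched exponential moment of the negative part and an exponential moment on the
  right.\<close>

locale stretched_left_tail = X: real_distribution \<kappa> for \<kappa> :: "real measure" +
  fixes b c1 \<eta>0 :: real
  assumes b: "0 < b" "b < 1"
    and left_moment: "0 < c1" "integrable \<kappa> (\<lambda>x. exp (c1 * max 0 (- x) powr b))"
    and right_moment: "0 < \<eta>0" "integrable \<kappa> (\<lambda>x. exp (\<eta>0 * x))"
begin

text \<open>On the left, half of \<open>c1\<close> is given up to dominate the power; on the right,
  the exponential moment dominates it.\<close>

lemma integrable_moment_exp: "integrable \<kappa> (\<lambda>x. \<bar>x\<bar> ^ j * exp (c1 / 2 * max 0 (- x) powr b))"
proof -
  obtain K where K: "0 < K" "\<And>x. 0 \<le> x \<Longrightarrow> x ^ j \<le> K * exp (c1 / 2 * x powr b)"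
    using power_le_exp_powr[of "c1 / 2" b j] left_moment b by auto
  obtain K' where K': "0 < K'" "\<And>x. 0 \<le> x \<Longrightarrow> x ^ j \<le> K' * exp (\<eta>0 * x powr 1)"
    using power_le_exp_powr[of \<eta>0 1 j] right_moment by auto
  show ?thesis
  proof (rule Bochner_Integration.integrable_bound)
    show "integrable \<kappa> (\<lambda>x. K * exp (c1 * max 0 (- x) powr b) + K' * exp (\<eta>0 * x))"
      using left_moment right_moment by auto
    show "AE x in \<kappa>. norm (\<bar>x\<bar> ^ j * exp (c1 / 2 * max 0 (- x) powr b)) \<le>
        norm (K * exp (c1 * max 0 (- x) powr b) + K' * exp (\<eta>0 * x))"
    proof (rule AE_I2)
      fix x
      have nn: "0 \<le> K * exp (c1 * max 0 (- x) powr b)" "0 \<le> K' * exp (\<eta>0 * x)" using K K' by auto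
      have "\<bar>x\<bar> ^ j * exp (c1 / 2 * max 0 (- x) powr b) \<le>
          K * exp (c1 * max 0 (- x) powr b) + K' * exp (\<eta>0 * x)"
      proof (cases "0 \<le> x")
        case True
        then show ?thesis using K'(2)[of x] nn b by simp
      next
        case False
        let ?e = "exp (c1 / 2 * max 0 (- x) powr b)"
        have "\<bar>x\<bar> ^ j * ?e \<le> (K * ?e) * ?e"
          using K(2)[of "- x"] False by (intro mult_right_mono) auto
        also have "\<dots> = K * exp (c1 * max 0 (- x) powr b)" by (simp add: mult.assoc flip: exp_add)
        finally show ?thesis using nn by simp
      qed
      then show "norm (\<bar>x\<bar> ^ j * exp (c1 / 2 * max 0 (- x) powr b)) \<le>
          norm (K * exp (c1 * max 0 (- x) powr b) + K' * exp (\<eta>0 * x))"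
        using nn by simp
    qed
  qed simp
qed

lemma integrable_moment: "integrable \<kappa> (\<lambda>x. \<bar>x\<bar> ^ j)"
proof (rule Bochner_Integration.integrable_bound[OF integrable_moment_exp[of j]])
  show "AE x in \<kappa>. norm (\<bar>x\<bar> ^ j) \<le> norm (\<bar>x\<bar> ^ j * exp (c1 / 2 * max 0 (- x) powr b))"
  proof (rule AE_I2)
    fix x
    have "\<bar>x\<bar> ^ j * 1 \<le> \<bar>x\<bar> ^ j * exp (c1 / 2 * max 0 (- x) powr b)"
      using left_moment by (intro mult_left_mono) auto
    then show "norm (\<bar>x\<bar> ^ j) \<le> norm (\<bar>x\<bar> ^ j * exp (c1 / 2 * max 0 (- x) powr b))" by simp
  qed
qed simp

lemma integrable_id [simp]: "integrable \<kappa> (\<lambda>x. x)"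
  using integrable_moment[of 1] by (simp add: integrable_abs_iff)

lemma integrable_square [simp]: "integrable \<kappa> (\<lambda>x. x\<^sup>2)"
  using integrable_moment[of 2] by simp

lemma prob_UNIV [simp]: "X.prob UNIV = 1"
  using X.prob_space by simp

lemma integrable_square_exp: "integrable \<kappa> (\<lambda>x. x\<^sup>2 * exp (\<eta>0 / 2 * max 0 x))"
proof -
  obtain K where K: "0 < K" "\<And>x. 0 \<le> x \<Longrightarrow> x ^ 2 \<le> K * exp (\<eta>0 / 2 * x powr 1)"
    using power_le_exp_powr[of "\<eta>0 / 2" 1 2] right_moment by auto
  show ?thesis
  proof (rule Bochner_Integration.integrable_bound)
    show "integrable \<kappa> (\<lambda>x. x\<^sup>2 + K * exp (\<eta>0 * x))" using right_moment by auto
    show "AE x in \<kappa>. norm (x\<^sup>2 * exp (\<eta>0 / 2 * max 0 x)) \<le> norm (x\<^sup>2 + K * exp (\<eta>0 * x))"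
    proof (rule AE_I2)
      fix x
      have nn: "0 \<le> x\<^sup>2" "0 \<le> K * exp (\<eta>0 * x)" using K by auto
      have "x\<^sup>2 * exp (\<eta>0 / 2 * max 0 x) \<le> x\<^sup>2 + K * exp (\<eta>0 * x)"
      proof (cases "0 \<le> x")
        case True
        let ?e = "exp (\<eta>0 / 2 * x)"
        have "x\<^sup>2 * ?e \<le> (K * ?e) * ?e" using K(2)[of x] True by (intro mult_right_mono) auto
        also have "\<dots> = K * exp (\<eta>0 * x)" by (simp add: mult.assoc flip: exp_add)
        finally show ?thesis using True by (simp add: add_increasing)
      qed (use nn in simp)
      then show "norm (x\<^sup>2 * exp (\<eta>0 / 2 * max 0 x)) \<le> norm (x\<^sup>2 + K * exp (\<eta>0 * x))"
        using nn by simp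
    qed
  qed simp
qed

text \<open>The mean is the right derivative of the moment generating function at \<open>0\<close>:
  the quadratic bound gives \<open>1 + \<delta> * t \<le> 1 + t * m + t\<^sup>2 * G\<close>, where
  \<open>m\<close> is the mean. Divide by \<open>t\<close> and let \<open>t\<close> tend to
  \<open>0\<close>.\<close>

lemma drift_ge:
  assumes "0 < t1" and mgf: "\<And>t. 0 < t \<Longrightarrow> t < t1 \<Longrightarrow> integrable \<kappa> (\<lambda>x. exp (t * x)) \<and> 1 + \<delta> * t \<le> (\<integral>x. exp (t * x) \<partial>\<kappa>)"
  shows "\<delta> \<le> (\<integral>x. x \<partial>\<kappa>)"
proof -
  define G where "G = (\<integral>x. x\<^sup>2 * exp (\<eta>0 / 2 * max 0 x) \<partial>\<kappa>)"
  have "\<forall>\<^sub>F t in at_right 0. t < min t1 (\<eta>0 / 2)"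
    using assms(1) right_moment by (intro order_tendstoD(2)[OF tendsto_ident_at]) auto
  then have ev: "\<forall>\<^sub>F t in at_right 0. \<delta> \<le> (\<integral>x. x \<partial>\<kappa>) + t * G"
    using eventually_at_right_less[of "0 :: real"]
  proof eventually_elim
    case (elim t)
    have "1 + \<delta> * t \<le> (\<integral>x. exp (t * x) \<partial>\<kappa>)" using mgf elim by simp
    also have "\<dots> \<le> (\<integral>x. 1 + t * x + t\<^sup>2 * (x\<^sup>2 * exp (\<eta>0 / 2 * max 0 x)) \<partial>\<kappa>)"
    proof (rule integral_mono)
      show "integrable \<kappa> (\<lambda>x. exp (t * x))" using mgf elim by simp
      show "integrable \<kappa> (\<lambda>x. 1 + t * x + t\<^sup>2 * (x\<^sup>2 * exp (\<eta>0 / 2 * max 0 x)))"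
        using integrable_square_exp by auto
      fix x
      have "max 0 (t * x) \<le> \<eta>0 / 2 * max 0 x"
      proof (cases "0 \<le> x")
        case True
        then have "t * x \<le> \<eta>0 / 2 * x" using elim by (intro mult_right_mono) auto
        then show ?thesis using True elim by simp
      qed (use elim in \<open>auto simp: max_def zero_le_mult_iff\<close>)
      then have "(t * x)\<^sup>2 * exp (max 0 (t * x)) \<le> (t * x)\<^sup>2 * exp (\<eta>0 / 2 * max 0 x)"
        by (intro mult_left_mono) auto
      then show "exp (t * x) \<le> 1 + t * x + t\<^sup>2 * (x\<^sup>2 * exp (\<eta>0 / 2 * max 0 x))"
        using exp_le_quadratic[of "t * x"] by (simp add: power_mult_distrib mult.assoc)
    qed
    also have "\<dots> = 1 + t * (\<integral>x. x \<partial>\<kappa>) + t\<^sup>2 * G"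
      using integrable_square_exp by (simp add: G_def)
    finally have "t * \<delta> \<le> t * ((\<integral>x. x \<partial>\<kappa>) + t * G)" by (simp add: algebra_simps power2_eq_square)
    then show ?case using elim by simp
  qed
  have "((\<lambda>t. (\<integral>x. x \<partial>\<kappa>) + t * G) \<longlongrightarrow> (\<integral>x. x \<partial>\<kappa>) + 0 * G) (at_right 0)"
    by (intro tendsto_intros)
  then have "\<delta> \<le> (\<integral>x. x \<partial>\<kappa>) + 0 * G"
    by (rule tendsto_lowerbound[OF _ ev]) simp
  then show ?thesis by simp
qed

end

text \<open>\<open>many_to_one\<close> includes unbounded \<open>g\<close> because it is applied to
  success probabilities multiplied by \<open>exp y\<close>.\<close>

locale tilted_offspring = offspring_law \<mu> + stretched_left_tail \<kappa> b c1 \<eta>0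
  for \<mu> :: "(nat \<times> (nat \<Rightarrow> real)) measure" and \<kappa> b c1 \<eta>0 +
  assumes many_to_one: "\<And>g. g \<in> borel_measurable borel \<Longrightarrow> (\<And>x. 0 \<le> g x) \<Longrightarrow>
      (\<integral>\<^sup>+z. ennreal (\<Sum>i<fst z. g (snd z i) * exp (- snd z i)) \<partial>\<mu>) = (\<integral>\<^sup>+x. ennreal (g x) \<partial>\<kappa>)"
    and drift: "0 < (\<integral>x. x \<partial>\<kappa>)"
begin

definition m :: real where "m = (\<integral>x. x \<partial>\<kappa>)"

lemma m_pos: "0 < m" using drift by (simp add: m_def)

text \<open>Right of the cut at \<open>- 2 * L\<close>, negative \<open>x\<close> satisfy
  \<open>\<theta> * \<bar>x\<bar> \<le> c1 / 2 * \<bar>x\<bar> powr b\<close>, so the second order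
  term is at most \<open>\<theta>\<^sup>2\<close> times the integral of \<open>G\<close>. Since
  \<open>\<theta>\<close> tends to \<open>0\<close> as \<open>L\<close> grows, it finally costs at
  most half of the drift term \<open>\<theta> * m\<close>.\<close>

lemma truncated_laplace:
  "\<forall>\<^sub>F L in at_top. (\<integral>\<^sup>+x. ennreal (exp (- (c1 / 4 * L powr (b - 1)) * x)) * indicator {- 2 * L..} x \<partial>\<kappa>)
     \<le> ennreal (exp (- (c1 / 4 * L powr (b - 1)) * (m / 2)))"
proof -
  define G where "G = (\<lambda>x. \<bar>x\<bar> ^ 2 * exp (c1 / 2 * max 0 (- x) powr b))"
  have G: "integrable \<kappa> G" unfolding G_def by (rule integrable_moment_exp)
  have G_nn: "0 \<le> G x" for x by (simp add: G_def)
  have "((\<lambda>L. c1 / 4 * L powr (b - 1) * C) \<longlongrightarrow> 0) at_top" for C :: real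
    using b by real_asymp
  then have "\<forall>\<^sub>F L in at_top. c1 / 4 * L powr (b - 1) * (\<integral>x. G x \<partial>\<kappa>) < m / 2"
    by (rule order_tendstoD) (use m_pos in simp)
  then show ?thesis using eventually_gt_at_top[of 0]
  proof eventually_elim
    case (elim L)
    define \<theta> where "\<theta> = c1 / 4 * L powr (b - 1)"
    have \<theta>: "0 < \<theta>" using left_moment elim by (simp add: \<theta>_def)
    let ?f = "\<lambda>x. 1 - \<theta> * x + \<theta>\<^sup>2 * G x"
    have pw: "exp (- \<theta> * x) * indicator {- 2 * L..} x \<le> ?f x" for x
    proof (cases "- 2 * L \<le> x")
      case True
      have "max 0 (- \<theta> * x) \<le> c1 / 2 * max 0 (- x) powr b"
      proof (cases "x < 0")
        case neg: True
        have "\<theta> * (- x) = \<theta> * ((- x) powr b * (- x) powr (1 - b))"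
          using neg by (simp flip: powr_add)
        also have "(- x) powr (1 - b) \<le> (2 * L) powr (1 - b)"
          using neg True b by (intro powr_mono2) auto
        also have "\<dots> = 2 powr (1 - b) * L powr (1 - b)" using elim by (simp add: powr_mult)
        also have "\<dots> \<le> 2 powr 1 * L powr (1 - b)" using b elim by (intro mult_right_mono powr_mono) auto
        also have "\<theta> * ((- x) powr b * (2 powr 1 * L powr (1 - b))) =
            c1 / 2 * (- x) powr b * (L powr (b - 1) * L powr (1 - b))" by (simp add: \<theta>_def)
        also have "L powr (b - 1) * L powr (1 - b) = 1" using elim by (simp flip: powr_add)
        finally show ?thesis using neg \<theta> left_moment by (simp add: mult_left_mono max_def)
      qed (use \<theta> left_moment in \<open>auto simp: max_def zero_le_mult_iff mult_le_0_iff\<close>)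
      then have "(- \<theta> * x)\<^sup>2 * exp (max 0 (- \<theta> * x)) \<le> (- \<theta> * x)\<^sup>2 * exp (c1 / 2 * max 0 (- x) powr b)"
        by (intro mult_left_mono) auto
      then show ?thesis using exp_le_quadratic[of "- \<theta> * x"] True by (simp add: G_def power_mult_distrib mult.assoc)
    next
      case False
      \<comment> \<open>Left of the cut the indicator vanishes, and the quadratic bound is
        nonnegative because \<open>- \<theta> * x\<close> is.\<close>
      have "\<theta> * x \<le> 0" using \<theta> False elim by (intro mult_nonneg_nonpos) auto
      then show ?thesis using False \<theta> G_nn[of x] by (simp add: indicator_def)
    qed
    have f_nn: "0 \<le> ?f x" for x
      by (rule order_trans[OF _ pw]) (simp add: indicator_def)
    have int: "integrable \<kappa> ?f" using G by auto
    have "(\<integral>\<^sup>+x. ennreal (exp (- \<theta> * x)) * indicator {- 2 * L..} x \<partial>\<kappa>) \<le> (\<integral>\<^sup>+x. ennreal (?f x) \<partial>\<kappa>)"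
    proof (rule nn_integral_mono)
      fix x
      show "ennreal (exp (- \<theta> * x)) * indicator {- 2 * L..} x \<le> ennreal (?f x)"
        using pw[of x] by (cases "- 2 * L \<le> x") (auto intro: ennreal_leI)
    qed
    also have "\<dots> = ennreal (\<integral>x. ?f x \<partial>\<kappa>)"
      using int f_nn by (intro nn_integral_eq_integral) auto
    also have "(\<integral>x. ?f x \<partial>\<kappa>) = 1 - \<theta> * m + \<theta>\<^sup>2 * (\<integral>x. G x \<partial>\<kappa>)"
      using G by (simp add: m_def)
    also have "\<dots> \<le> 1 - \<theta> * (m / 2)"
    proof -
      have "\<theta> * (\<theta> * (\<integral>x. G x \<partial>\<kappa>)) \<le> \<theta> * (m / 2)"
        using elim(1) \<theta> by (intro mult_left_mono) (auto simp: \<theta>_def)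
      then show ?thesis by (simp add: power2_eq_square algebra_simps)
    qed
    also have "\<dots> \<le> exp (- \<theta> * (m / 2))"
      using exp_ge_add_one_self[of "- \<theta> * (m / 2)"] by simp
    finally show ?case unfolding \<theta>_def by (simp add: ennreal_leI)
  qed
qed

text \<open>Union bound over the children, then the many-to-one formula; the factor
  \<open>exp y\<close> undoes the tilt.\<close>

lemma reach_prob_Suc_le:
  assumes "x \<le> \<beta> 0"
  shows "ennreal (reach_prob (Suc N) \<beta> x) \<le>
     (\<integral>\<^sup>+y. ennreal (exp y * reach_prob N (\<lambda>k. \<beta> (Suc k)) (x + y)) \<partial>\<kappa>)"
proof -
  let ?p = "\<lambda>y. reach_prob N (\<lambda>k. \<beta> (Suc k)) (x + y)"
  let ?\<Pi> = "\<lambda>z. \<Prod>i<fst z. 1 - ?p (snd z i)"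
  have nn: "0 \<le> ?\<Pi> z" "?\<Pi> z \<le> 1" for z by (auto intro!: prod_nonneg prod_le_1)
  have [measurable]: "?\<Pi> \<in> borel_measurable \<mu>" by measurable
  have int: "integrable \<mu> ?\<Pi>" by (rule integrable_const_bound[of _ 1]) (auto simp: nn)
  have "ennreal (reach_prob (Suc N) \<beta> x) = ennreal (\<integral>z. 1 - ?\<Pi> z \<partial>\<mu>)"
    using int prob_space[simplified] by (subst reach_prob_Suc) (use assms in auto)
  also have "\<dots> = (\<integral>\<^sup>+z. ennreal (1 - ?\<Pi> z) \<partial>\<mu>)"
    using int by (intro nn_integral_eq_integral[symmetric] AE_I2) (simp_all only: nn diff_ge_0_iff_ge Bochner_Integration.integrable_diff integrable_const)
  also have "\<dots> \<le> (\<integral>\<^sup>+z. ennreal (\<Sum>i<fst z. (exp (snd z i) * ?p (snd z i)) * exp (- snd z i)) \<partial>\<mu>)"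
    using one_minus_prod_le_sum[of "\<lambda>i. ?p (snd z i)" "fst z" for z]
    by (intro nn_integral_mono ennreal_leI) (simp add: exp_minus field_simps)
  also have "\<dots> = (\<integral>\<^sup>+y. ennreal (exp y * ?p y) \<partial>\<kappa>)"
    by (rule many_to_one) auto
  finally show ?thesis .
qed

text \<open>The first summand accounts for lines confined to the strip, all of whose jumps are at
  least \<open>- 2 * L\<close>; the second for dropping below \<open>- L\<close> at one of
  \<open>k\<close> times, at cost \<open>exp (- x - L)\<close> each. The induction step
  distinguishes whether the next position is below, above or inside the strip.\<close>

lemma reach_prob_strip:
  assumes L: "0 \<le> L" and \<theta>: "0 < \<theta>"
    and lap: "(\<integral>\<^sup>+x. ennreal (exp (- \<theta> * x)) * indicator {- 2 * L..} x \<partial>\<kappa>) \<le> ennreal (exp (- \<eta>))"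
    and "- L \<le> x" "x \<le> L"
  shows "reach_prob k (\<lambda>_. L) x \<le> exp ((1 + \<theta>) * (L - x) - real k * \<eta>) + real k * exp (- x - L)"
  using assms(4,5)
proof (induction k arbitrary: x)
  case 0
  have "0 \<le> (1 + \<theta>) * (L - x)" using 0 \<theta> by (intro mult_nonneg_nonneg) auto
  then show ?case using 0 by (simp add: reach_prob_0)
next
  case (Suc k)
  let ?A = "exp ((1 + \<theta>) * (L - x) - real k * \<eta>)" and ?B = "(real k + 1) * exp (- x - L)"
  have pw: "exp y * reach_prob k (\<lambda>_. L) (x + y) \<le> ?A * (exp (- \<theta> * y) * indicator {- 2 * L..} y) + ?B" for y
  proof -
    consider "x + y < - L" | "L < x + y" | "- L \<le> x + y" "x + y \<le> L" by linarith
    then show ?thesis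
    proof cases
      case 1
      have "exp y * reach_prob k (\<lambda>_. L) (x + y) \<le> exp (- x - L) * 1"
        using 1 by (intro mult_mono) auto
      also have "\<dots> \<le> ?B" by simp
      also have "\<dots> \<le> ?A * (exp (- \<theta> * y) * indicator {- 2 * L..} y) + ?B" by (simp add: indicator_def)
      finally show ?thesis .
    next
      case 2
      then have "reach_prob k (\<lambda>_. L) (x + y) \<le> 0"
        using reach_prob_horizon[of 0 k "\<lambda>_. L" "x + y"] by (simp add: reach_prob_0)
      then have "reach_prob k (\<lambda>_. L) (x + y) = 0" by (simp add: antisym)
      then show ?thesis by (simp add: indicator_def)
    next
      case 3
      have "exp y * reach_prob k (\<lambda>_. L) (x + y) \<le>
          exp y * (exp ((1 + \<theta>) * (L - (x + y)) - real k * \<eta>) + real k * exp (- (x + y) - L))"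
        using 3 by (intro mult_left_mono Suc.IH) auto
      also have "\<dots> = ?A * exp (- \<theta> * y) + real k * exp (- x - L)"
        by (simp add: algebra_simps flip: exp_add)
      also have "\<dots> \<le> ?A * exp (- \<theta> * y) + ?B" by simp
      finally show ?thesis using 3 Suc.prems by (simp add: indicator_def)
    qed
  qed
  have "ennreal (reach_prob (Suc k) (\<lambda>_. L) x) \<le> (\<integral>\<^sup>+y. ennreal (exp y * reach_prob k (\<lambda>_. L) (x + y)) \<partial>\<kappa>)"
    using reach_prob_Suc_le[of x "\<lambda>_. L" k] Suc.prems by simp
  also have "\<dots> \<le> (\<integral>\<^sup>+y. ennreal ?A * (ennreal (exp (- \<theta> * y)) * indicator {- 2 * L..} y) + ennreal ?B \<partial>\<kappa>)"
  proof (rule nn_integral_mono)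
    fix y
    have "ennreal (exp y * reach_prob k (\<lambda>_. L) (x + y)) \<le> ennreal (?A * (exp (- \<theta> * y) * indicator {- 2 * L..} y) + ?B)"
      by (rule ennreal_leI[OF pw])
    also have "\<dots> = ennreal ?A * (ennreal (exp (- \<theta> * y)) * indicator {- 2 * L..} y) + ennreal ?B"
      by (simp add: ennreal_mult ennreal_plus indicator_def)
    finally show "ennreal (exp y * reach_prob k (\<lambda>_. L) (x + y)) \<le> \<dots>" .
  qed
  also have "\<dots> = ennreal ?A * (\<integral>\<^sup>+y. ennreal (exp (- \<theta> * y)) * indicator {- 2 * L..} y \<partial>\<kappa>) + ennreal ?B"
    using X.emeasure_space_1 by (simp add: nn_integral_add nn_integral_cmult)
  also have "\<dots> \<le> ennreal ?A * ennreal (exp (- \<eta>)) + ennreal ?B"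
    by (intro add_mono mult_left_mono lap) auto
  also have "\<dots> = ennreal (?A * exp (- \<eta>) + ?B)" by (subst ennreal_plus) (auto simp: ennreal_mult)
  finally have "reach_prob (Suc k) (\<lambda>_. L) x \<le> ?A * exp (- \<eta>) + ?B"
    by (subst (asm) ennreal_le_iff) (auto intro!: add_nonneg_nonneg)
  also have "?A * exp (- \<eta>) = exp ((1 + \<theta>) * (L - x) - real (Suc k) * \<eta>)"
    by (simp add: algebra_simps flip: exp_add)
  finally show ?case by (simp add: add.commute)
qed

lemma slow_rays_null:
  defines "p \<equiv> 1 / (2 - b)"
  shows "\<exists>c>0. \<forall>r D. 0 \<le> r \<longrightarrow> r < c \<longrightarrow> tree.prob {\<omega>. stays (\<lambda>k. real D + r * real k powr p) 0 \<omega>} = 0"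
proof -
  have p: "0 < p" using b by (simp add: p_def)
  \<comment> \<open>For \<open>\<theta> = c1 / 4 * L powr (b - 1)\<close>, the gain
    \<open>\<theta> * m / 2\<close> per step equals
    \<open>\<delta> * L powr (b - 1)\<close>.\<close>
  define \<delta> where "\<delta> = c1 * m / 8"
  have \<delta>: "0 < \<delta>" using left_moment m_pos by (simp add: \<delta>_def)
  \<comment> \<open>With \<open>N = w powr (2 - b)\<close> and \<open>L \<le> 2 * c * w\<close>, the
    gain over \<open>N\<close> steps is then at least \<open>4 * c * w\<close>, twice the bound
    \<open>2 * c * w\<close> on the main cost \<open>L\<close>.\<close>
  define c where "c = (\<delta> / 8) powr p"
  have c: "0 < c" using \<delta> by (simp add: c_def)
  have c2: "c powr (2 - b) = \<delta> / 8" using \<delta> b by (simp add: c_def powr_powr p_def)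
  have cb: "\<delta> * (2 * c) powr (b - 1) \<ge> 4 * c"
  proof -
    have "8 * c = 8 * (c powr (2 - b) * c powr (b - 1))" using c by (simp flip: powr_add)
    also have "\<dots> = \<delta> * c powr (b - 1)" by (simp add: c2)
    finally have "8 * c * 2 powr (b - 1) = \<delta> * (2 * c) powr (b - 1)" using c by (simp add: powr_mult)
    moreover have "2 powr (b - 1) \<ge> 2 powr (- 1 :: real)" using b by (intro powr_mono) auto
    then have "8 * c * 2 powr (b - 1) \<ge> 8 * c * (1 / 2)" using c by (intro mult_left_mono) (auto simp: powr_minus_divide)
    ultimately show ?thesis by simp
  qed
  have "tree.prob {\<omega>. stays (\<lambda>k. real D + r * real k powr p) 0 \<omega>} = 0" if r: "0 \<le> r" "r < c" for r and D :: nat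
  proof -
    define w where "w = (\<lambda>N. real N powr p)"
    define L where "L = (\<lambda>N. real D + c * w N)"
    have w_lim: "filterlim w at_top sequentially" unfolding w_def using p by real_asymp
    have L_lim: "filterlim L at_top sequentially" unfolding L_def w_def using p c by real_asymp
    \<comment> \<open>Doubling \<open>c\<close> absorbs the offset \<open>D\<close>.\<close>
    have L_le: "\<forall>\<^sub>F N in sequentially. L N \<le> 2 * c * w N"
      unfolding L_def w_def using p c by real_asymp
    let ?bound = "\<lambda>N. exp (- 2 * c * w N + c1 / 4 * (2 * c * w N) powr b) + w N powr (2 - b) * exp (- (c * w N))"
    have bd: "\<forall>\<^sub>F N in sequentially. tree.prob {\<omega>. stays (\<lambda>k. real D + r * real k powr p) 0 \<omega>} \<le> ?bound N"
      using L_le eventually_compose_filterlim[OF truncated_laplace L_lim] eventually_gt_at_top[of 0]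
    proof eventually_elim
      case (elim N)
      have w: "0 < w N" using elim by (simp add: w_def)
      have N: "real N = w N powr (2 - b)" using elim b by (simp add: w_def powr_powr p_def)
      have L: "0 < L N" using c w by (simp add: L_def add_nonneg_pos)
      define \<theta> where "\<theta> = c1 / 4 * L N powr (b - 1)"
      have \<theta>: "0 < \<theta>" using left_moment L by (simp add: \<theta>_def)
      have "tree.prob {\<omega>. stays (\<lambda>k. real D + r * real k powr p) 0 \<omega>} \<le> reach_prob N (\<lambda>k. real D + r * real k powr p) 0"
        unfolding reach_prob_def by (intro tree.finite_measure_mono) (auto simp: stays_def)
      also have "\<dots> \<le> reach_prob N (\<lambda>_. L N) 0"
        using r p by (intro reach_prob_mono) (auto simp: L_def w_def intro!: mult_mono powr_mono2)
      also have "\<dots> \<le> exp ((1 + \<theta>) * (L N - 0) - real N * (\<theta> * (m / 2))) + real N * exp (- 0 - L N)"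
        using elim(2) L \<theta> by (intro reach_prob_strip) (auto simp: \<theta>_def)
      also have "\<dots> \<le> ?bound N"
      proof (intro add_mono mult_mono)
        have "\<theta> * L N = c1 / 4 * (L N powr (b - 1) * L N powr 1)" using L by (simp add: \<theta>_def)
        also have "L N powr (b - 1) * L N powr 1 = L N powr b" by (simp only: powr_add[symmetric]) simp
        also have "c1 / 4 * L N powr b \<le> c1 / 4 * (2 * c * w N) powr b"
          using elim(1) L left_moment b by (intro mult_left_mono powr_mono2) auto
        finally have 1: "\<theta> * L N \<le> c1 / 4 * (2 * c * w N) powr b" .
        have "4 * c * w N \<le> \<delta> * (2 * c) powr (b - 1) * w N" using cb w by (intro mult_right_mono) auto
        also have "\<dots> = \<delta> * ((2 * c) powr (b - 1) * (w N powr (2 - b) * w N powr (b - 1)))"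
          using w by (simp flip: powr_add)
        also have "\<dots> = real N * \<delta> * (2 * c * w N) powr (b - 1)"
          using c w N by (simp add: powr_mult)
        also have "\<dots> \<le> real N * \<delta> * L N powr (b - 1)"
          using elim(1) L b \<delta> by (intro mult_left_mono powr_mono2') auto
        also have "\<dots> = real N * (\<theta> * (m / 2))" by (simp add: \<theta>_def \<delta>_def)
        finally have 2: "4 * c * w N \<le> real N * (\<theta> * (m / 2))" .
        show "exp ((1 + \<theta>) * (L N - 0) - real N * (\<theta> * (m / 2))) \<le> exp (- 2 * c * w N + c1 / 4 * (2 * c * w N) powr b)"
          using 1 2 elim(1) by (simp add: algebra_simps)
        show "exp (- 0 - L N) \<le> exp (- (c * w N))" by (simp add: L_def)
      qed (auto simp: N)
      finally show ?case .
    qed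
    have "((\<lambda>w. exp (- 2 * c * w + c1 / 4 * (2 * c * w) powr b) + w powr (2 - b) * exp (- (c * w))) \<longlongrightarrow> 0) at_top"
      using b c left_moment by real_asymp
    then have "?bound \<longlonglongrightarrow> 0" by (rule filterlim_compose[OF _ w_lim])
    then have "tree.prob {\<omega>. stays (\<lambda>k. real D + r * real k powr p) 0 \<omega>} \<le> 0"
      by (rule tendsto_lowerbound[OF _ bd]) simp
    then show ?thesis by (simp add: antisym)
  qed
  then show ?thesis using c by blast
qed

end

section \<open>A superharmonic function for the tilted walk\<close>

text \<open>The product is at most \<open>exp (- z)\<close> with \<open>z\<close> the sum of the
  \<open>r i\<close>. The truncation of the error at \<open>w\<close> is essential: later
  \<open>w\<close> is a multiple of \<open>W\<close>, for which only \<open>L log L\<close>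
  integrability is given, not a second moment.\<close>

lemma one_minus_prod_ge:
  fixes r :: "nat \<Rightarrow> real"
  assumes r: "\<And>i. 0 \<le> r i" "\<And>i. r i \<le> 1" and w: "(\<Sum>i<n. r i) \<le> w"
  shows "(\<Sum>i<n. r i) - w * min 1 w \<le> 1 - (\<Prod>i<n. 1 - r i)"
proof -
  define z where "z = (\<Sum>i<n. r i)"
  have z: "0 \<le> z" "z \<le> w" using r w by (auto simp: z_def intro: sum_nonneg)
  have "(\<Prod>i<n. 1 - r i) \<le> (\<Prod>i<n. exp (- r i))"
  proof (intro prod_mono conjI)
    show "1 - r i \<le> exp (- r i)" for i using exp_ge_add_one_self[of "- r i"] by simp
  qed (use r in auto)
  also have "\<dots> = exp (- z)" by (simp add: z_def exp_sum flip: sum_negf)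
  finally have le: "(\<Prod>i<n. 1 - r i) \<le> exp (- z)" .
  have "z - z * min 1 z \<le> 1 - exp (- z)"
  proof (cases "z \<le> 1")
    case True
    then show ?thesis using exp_le_quadratic[of "- z"] z by (simp add: power2_eq_square)
  qed (use z in simp)
  moreover have "z * min 1 z \<le> w * min 1 w" using z by (intro mult_mono) auto
  ultimately show ?thesis using le by (simp add: z_def)
qed

text \<open>The slope of this convex function decays only quadratically, which makes it slowly varying with respect to the
stretched exponential jumps of the walk and still integrable, as the \<open>L log L\<close> condition requires.\<close>

definition conv_decr :: "real \<Rightarrow> real" where
  "conv_decr y = (if y \<le> 0 then 1 - y else 1 / (1 + y))"

text \<open>Minus the derivative of \<open>conv_decr\<close>.\<close>

definition conv_slope :: "real \<Rightarrow> real" where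
  "conv_slope y = (if y \<le> 0 then 1 else 1 / (1 + y)\<^sup>2)"

lemma conv_decr_pos: "0 < conv_decr y"
  by (auto simp: conv_decr_def)

lemma conv_decr_le: "conv_decr y \<le> 1 + max 0 (- y)"
  by (auto simp: conv_decr_def field_simps)

lemma conv_decr_antimono: "x \<le> y \<Longrightarrow> conv_decr y \<le> conv_decr x"
  by (auto simp: conv_decr_def frac_le) (smt (verit) divide_le_eq_1)

lemma measurable_conv_decr [measurable]: "conv_decr \<in> borel_measurable borel"
  unfolding conv_decr_def[abs_def] by measurable

text \<open>A Taylor bound whose whole error is proportional to the slope at the starting point,
  however large the jump. For a jump from \<open>y > 0\<close> to below \<open>0\<close> the slope
  \<open>1 / (1 + y)\<^sup>2\<close> may be small, but then \<open>\<bar>z\<bar>\<close> exceeds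
  \<open>y\<close>, and the quadratic and cubic terms compensate.\<close>

lemma conv_decr_step:
  "conv_decr (y + z) - conv_decr y \<le> conv_slope y * (- z + 2 * z\<^sup>2 + \<bar>z\<bar> ^ 3)"
proof -
  have nn: "0 \<le> z\<^sup>2" "0 \<le> \<bar>z\<bar> ^ 3" by auto
  consider "y \<le> 0" "y + z \<le> 0" | "y \<le> 0" "0 < y + z" | "0 < y" "0 \<le> y + z" | "0 < y" "y + z < 0" by linarith
  then show ?thesis
  proof cases
    case 1
    then show ?thesis using nn by (simp add: conv_decr_def conv_slope_def)
  next
    case 2
    define w where "w = y + z"
    have "1 / (1 + w) \<le> 1 - w + w\<^sup>2"
    proof -
      have "(1 + w) * (1 - w + w\<^sup>2) = 1 + w * w\<^sup>2" by (simp add: algebra_simps power2_eq_square)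
      also have "\<dots> \<ge> 1" using 2 by (simp add: w_def)
      finally show ?thesis using 2 by (simp add: w_def field_simps)
    qed
    moreover have "w\<^sup>2 \<le> z\<^sup>2" using 2 by (intro power_mono) (auto simp: w_def)
    moreover have "conv_decr (y + z) = 1 / (1 + w)" using 2 by (simp add: conv_decr_def w_def)
    moreover have "y = w - z" by (simp add: w_def)
    ultimately have "conv_decr (y + z) - (1 - y) \<le> - z + 2 * z\<^sup>2 + \<bar>z\<bar> ^ 3" using nn by linarith
    then show ?thesis using 2 by (simp add: conv_decr_def conv_slope_def)
  next
    case 3
    have "1 / (1 + (y + z)) - 1 / (1 + y) + z * (1 / (1 + y)\<^sup>2) = z\<^sup>2 / ((1 + y)\<^sup>2 * (1 + (y + z)))"
      using 3 by (simp add: divide_simps) (simp add: algebra_simps power2_eq_square)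
    also have "\<dots> \<le> z\<^sup>2 / ((1 + y)\<^sup>2 * 1)" using 3 by (intro divide_left_mono mult_left_mono mult_pos_pos) auto
    also have "\<dots> \<le> (2 * z\<^sup>2 + \<bar>z\<bar> ^ 3) / (1 + y)\<^sup>2" using nn 3 by (intro frac_le) auto
    finally have "1 / (1 + (y + z)) - 1 / (1 + y) \<le> (- z + 2 * z\<^sup>2 + \<bar>z\<bar> ^ 3) / (1 + y)\<^sup>2"
      by (simp add: add_divide_distrib diff_divide_distrib)
    moreover have "conv_decr (y + z) = 1 / (1 + (y + z))" using 3 by (auto simp: conv_decr_def)
    ultimately show ?thesis using 3 by (simp add: conv_decr_def conv_slope_def)
  next
    case 4
    define t where "t = - z"
    have t: "y < t" "0 < y" using 4 by (auto simp: t_def)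
    have "(1 - y + t) * (1 + y)\<^sup>2 - (1 + y) = t + t * (2 * y + y\<^sup>2) - (1 + y) * y\<^sup>2"
      by (simp add: algebra_simps power2_eq_square)
    also have "\<dots> \<le> t + t * (2 * t + t\<^sup>2)"
    proof -
      have "y\<^sup>2 \<le> t\<^sup>2" using t by (intro power_mono) auto
      then have "t * (2 * y + y\<^sup>2) \<le> t * (2 * t + t\<^sup>2)" using t by (intro mult_left_mono add_mono) auto
      moreover have "0 \<le> (1 + y) * y\<^sup>2" using t by simp
      ultimately show ?thesis by linarith
    qed
    also have "\<dots> = - z + 2 * z\<^sup>2 + \<bar>z\<bar> ^ 3"
      using t by (simp add: t_def algebra_simps power2_eq_square power3_eq_cube abs_if)
    finally have "(1 - (y + z)) * (1 + y)\<^sup>2 - (1 + y) \<le> - z + 2 * z\<^sup>2 + \<bar>z\<bar> ^ 3"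
      by (simp add: t_def algebra_simps)
    then have "((1 - (y + z)) * (1 + y)\<^sup>2 - (1 + y)) / (1 + y)\<^sup>2 \<le> (- z + 2 * z\<^sup>2 + \<bar>z\<bar> ^ 3) / (1 + y)\<^sup>2"
      by (intro divide_right_mono) auto
    moreover have "((1 - (y + z)) * (1 + y)\<^sup>2 - (1 + y)) / (1 + y)\<^sup>2 = 1 - (y + z) - 1 / (1 + y)"
      using t by (simp add: diff_divide_distrib power2_eq_square)
    ultimately show ?thesis using 4 by (simp add: conv_decr_def conv_slope_def)
  qed
qed

text \<open>For \<open>u > 0\<close>, \<open>(1 + \<eta> * u)\<^sup>2 \<le> (1 + u / 2)\<^sup>2
  \<le> exp u\<close>. At \<open>u = x - ln (s * W z)\<close> the left side becomes the truncated
  factor in \<open>loss\<close>.\<close>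

lemma conv_slope_ge:
  assumes "0 < \<eta>" "\<eta> \<le> 1 / 2"
  shows "min 1 (exp (- u)) \<le> conv_slope (\<eta> * u)"
proof (cases "u \<le> 0")
  case True
  then show ?thesis using assms by (simp add: conv_slope_def mult_le_0_iff)
next
  case False
  have "(1 + \<eta> * u)\<^sup>2 \<le> (exp (u / 2))\<^sup>2"
  proof (intro power_mono)
    have "1 + \<eta> * u \<le> 1 + u / 2" using assms False by simp
    also have "\<dots> \<le> exp (u / 2)" by simp
    finally show "1 + \<eta> * u \<le> exp (u / 2)" .
  qed (use assms False in auto)
  also have "\<dots> = exp u" by (simp add: power2_eq_square flip: exp_add)
  finally have "1 / exp u \<le> 1 / (1 + \<eta> * u)\<^sup>2"
    using assms False by (intro divide_left_mono) (auto intro!: mult_pos_pos zero_less_power add_pos_pos)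
  then show ?thesis using assms False by (simp add: conv_slope_def zero_less_mult_iff not_le exp_minus inverse_eq_divide)
qed

text \<open>The first child alone provides the jump back. In \<open>lower_tail\<close>,
  \<open>exp (- max 0 z)\<close> comes from removing the tilt, and \<open>lam'\<close> may exceed
  the true rate so as to absorb powers.\<close>

locale leaping_offspring = tilted_offspring +
  fixes c2 lam' :: real
  assumes lower_tail: "0 < c2" "0 < lam'"
      "\<And>z. c2 * exp (- max 0 z - lam' * max 0 z powr b) \<le> prob {y. 1 \<le> fst y \<and> snd y 0 \<le> - z}"
    and LlogL: "integrable \<mu> (\<lambda>z. (\<Sum>i<fst z. exp (- snd z i)) * log_plus (\<Sum>i<fst z. exp (- snd z i)))"
begin

definition W :: "nat \<times> (nat \<Rightarrow> real) \<Rightarrow> real" where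
  "W z = (\<Sum>i<fst z. exp (- snd z i))"

lemma W_nonneg [simp]: "0 \<le> W z"
  by (simp add: W_def sum_nonneg)

lemma measurable_W [measurable]: "W \<in> borel_measurable \<mu>"
  unfolding W_def[abs_def] by measurable

lemma integrable_W [simp]: "integrable \<mu> W"
proof (rule integrableI_nonneg)
  show "(\<integral>\<^sup>+x. ennreal (W x) \<partial>\<mu>) < \<infinity>"
    using many_to_one[of "\<lambda>_. 1"] X.emeasure_space_1 by (simp add: W_def)
qed auto

lemma integrable_W_logW: "integrable \<mu> (\<lambda>z. W z * log_plus (W z))"
  using LlogL by (simp add: W_def)

text \<open>The scale at which the quadratic and cubic errors of \<open>conv_decr_step\<close> use
  up at most half of the drift; the summand \<open>1\<close> keeps the denominator positive.\<close>

definition \<eta> :: real where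
  "\<eta> = min (1 / 2) (m / (4 * (\<integral>x. x\<^sup>2 \<partial>\<kappa>) + 2 * (\<integral>x. \<bar>x\<bar> ^ 3 \<partial>\<kappa>) + 1))"

lemma \<eta>: "0 < \<eta>" "\<eta> \<le> 1 / 2"
  "\<eta> * (2 * (\<integral>x. x\<^sup>2 \<partial>\<kappa>)) + \<eta>\<^sup>2 * (\<integral>x. \<bar>x\<bar> ^ 3 \<partial>\<kappa>) \<le> m / 2"
proof -
  let ?a = "\<integral>x. x\<^sup>2 \<partial>\<kappa>" and ?b = "\<integral>x. \<bar>x\<bar> ^ 3 \<partial>\<kappa>"
  have nn: "0 \<le> ?a" "0 \<le> ?b" by (auto intro: integral_nonneg_AE)
  then have pos: "0 < 4 * ?a + 2 * ?b + 1" by linarith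
  show 1: "0 < \<eta>" using pos m_pos by (simp add: \<eta>_def)
  show 2: "\<eta> \<le> 1 / 2" unfolding \<eta>_def by (rule min.cobounded1)
  have "\<eta> \<le> m / (4 * ?a + 2 * ?b + 1)" by (simp add: \<eta>_def)
  then have 3: "\<eta> * (4 * ?a + 2 * ?b + 1) \<le> m" using pos by (simp add: field_simps)
  have "\<eta>\<^sup>2 * ?b \<le> \<eta> * ?b"
    using 1 2 nn by (intro mult_right_mono) (auto simp: power2_eq_square mult_left_le)
  then show "\<eta> * (2 * ?a) + \<eta>\<^sup>2 * ?b \<le> m / 2" using 3 1 by (simp add: algebra_simps)
qed

text \<open>Integration of \<open>conv_decr_step\<close> at \<open>z = \<eta> * x\<close>; by the
  choice of \<open>\<eta>\<close>, half of the drift survives.\<close>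

lemma conv_decr_drift:
  shows "integrable \<kappa> (\<lambda>x. conv_decr (y + \<eta> * x))"
    and "(\<integral>x. conv_decr (y + \<eta> * x) \<partial>\<kappa>) \<le> conv_decr y - \<eta> * m / 2 * conv_slope y"
proof -
  show int: "integrable \<kappa> (\<lambda>x. conv_decr (y + \<eta> * x))"
  proof (rule Bochner_Integration.integrable_bound)
    show "integrable \<kappa> (\<lambda>x. 1 + \<bar>y\<bar> + \<eta> * \<bar>x\<bar>)" using integrable_moment[of 1] by simp
    show "AE x in \<kappa>. norm (conv_decr (y + \<eta> * x)) \<le> norm (1 + \<bar>y\<bar> + \<eta> * \<bar>x\<bar>)"
    proof (rule AE_I2)
      fix x
      have "conv_decr (y + \<eta> * x) \<le> 1 + max 0 (- (y + \<eta> * x))" by (rule conv_decr_le)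
      also have "\<dots> \<le> 1 + \<bar>y\<bar> + \<bar>\<eta> * x\<bar>" by auto
      also have "\<bar>\<eta> * x\<bar> = \<eta> * \<bar>x\<bar>" using \<eta> by (simp add: abs_mult)
      finally show "norm (conv_decr (y + \<eta> * x)) \<le> norm (1 + \<bar>y\<bar> + \<eta> * \<bar>x\<bar>)"
        using conv_decr_pos[of "y + \<eta> * x"] by simp
    qed
  qed simp
  let ?k = "conv_slope y"
  let ?f = "\<lambda>x. conv_decr y + ?k * (- (\<eta> * x) + 2 * (\<eta>\<^sup>2 * x\<^sup>2) + \<eta> ^ 3 * \<bar>x\<bar> ^ 3)"
  have k: "0 \<le> ?k" by (simp add: conv_slope_def)
  have "(\<integral>x. conv_decr (y + \<eta> * x) \<partial>\<kappa>) \<le> (\<integral>x. ?f x \<partial>\<kappa>)"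
  proof (rule integral_mono[OF int])
    show "integrable \<kappa> ?f" using integrable_moment[of 3] by simp
    fix x
    show "conv_decr (y + \<eta> * x) \<le> ?f x"
      using conv_decr_step[of y "\<eta> * x"] \<eta> by (simp add: power_mult_distrib abs_mult)
  qed
  also have "\<dots> = conv_decr y + ?k * (- (\<eta> * m) + 2 * (\<eta>\<^sup>2 * (\<integral>x. x\<^sup>2 \<partial>\<kappa>)) + \<eta> ^ 3 * (\<integral>x. \<bar>x\<bar> ^ 3 \<partial>\<kappa>))"
    using integrable_moment[of 3] by (simp add: m_def)
  also have "\<dots> = conv_decr y + ?k * \<eta> * (- m + \<eta> * (2 * (\<integral>x. x\<^sup>2 \<partial>\<kappa>)) + \<eta>\<^sup>2 * (\<integral>x. \<bar>x\<bar> ^ 3 \<partial>\<kappa>))"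
    by (simp add: algebra_simps power2_eq_square power3_eq_cube)
  also have "\<dots> \<le> conv_decr y + ?k * \<eta> * (- m + m / 2)"
    using \<eta> k by (intro add_left_mono mult_left_mono) auto
  finally show "(\<integral>x. conv_decr (y + \<eta> * x) \<partial>\<kappa>) \<le> conv_decr y - \<eta> * m / 2 * ?k"
    by (simp add: algebra_simps)
qed

text \<open>The expected second order error of \<open>one_minus_prod_ge\<close> when success from
  height \<open>x\<close> has probability at most \<open>s * exp (- x)\<close>, with this factor
  taken out.\<close>

definition loss :: "real \<Rightarrow> real \<Rightarrow> real" where
  "loss s x = (\<integral>z. W z * min 1 (s * exp (- x) * W z) \<partial>\<mu>)"

text \<open>A mixture of shifted copies of \<open>conv_decr\<close>; the shift
  \<open>ln (s * W z)\<close> is where the minimum in \<open>loss\<close> changes branch. The factor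
  \<open>2 / (m * \<eta>)\<close> turns the surviving half of the drift into exactly
  \<open>W z\<close> times the slope.\<close>

definition potential :: "real \<Rightarrow> real \<Rightarrow> real" where
  "potential s x = (\<integral>z. 2 / (m * \<eta>) * W z * conv_decr (\<eta> * (x - ln (s * W z))) \<partial>\<mu>)"

text \<open>The linear growth of \<open>conv_decr\<close> at minus infinity becomes a logarithm of
  \<open>W z\<close>; this is where the \<open>L log L\<close> condition enters.\<close>

lemma potential_integrand_le:
  assumes "0 < s"
  shows "W z * conv_decr (\<eta> * (x - ln (s * W z))) \<le> W z * (1 + \<eta> * (\<bar>x\<bar> + \<bar>ln s\<bar>)) + \<eta> * (W z * log_plus (W z))"
proof (cases "W z = 0")
  case False
  then have Wp: "0 < W z" using W_nonneg[of z] by linarith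
  have "conv_decr (\<eta> * (x - ln (s * W z))) \<le> 1 + max 0 (\<eta> * (ln s + ln (W z) - x))"
    using conv_decr_le[of "\<eta> * (x - ln (s * W z))"] Wp assms by (simp add: ln_mult algebra_simps)
  also have "\<dots> \<le> 1 + \<eta> * (\<bar>x\<bar> + \<bar>ln s\<bar> + log_plus (W z))"
    using \<eta> by (auto simp: max_def log_plus_def intro!: mult_left_mono)
  finally have "W z * conv_decr (\<eta> * (x - ln (s * W z))) \<le> W z * (1 + \<eta> * (\<bar>x\<bar> + \<bar>ln s\<bar> + log_plus (W z)))"
    by (intro mult_left_mono) auto
  then show ?thesis by (simp add: algebra_simps)
qed simp

lemma integrable_potential:
  assumes "0 < s"
  shows "integrable \<mu> (\<lambda>z. W z * conv_decr (\<eta> * (x - ln (s * W z))))"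
proof (rule Bochner_Integration.integrable_bound)
  show "integrable \<mu> (\<lambda>z. W z * (1 + \<eta> * (\<bar>x\<bar> + \<bar>ln s\<bar>)) + \<eta> * (W z * log_plus (W z)))"
    using integrable_W_logW by auto
  show "AE z in \<mu>. norm (W z * conv_decr (\<eta> * (x - ln (s * W z)))) \<le>
      norm (W z * (1 + \<eta> * (\<bar>x\<bar> + \<bar>ln s\<bar>)) + \<eta> * (W z * log_plus (W z)))"
  proof (rule AE_I2)
    fix z
    have "0 \<le> W z * conv_decr (\<eta> * (x - ln (s * W z)))" using conv_decr_pos by (simp add: less_imp_le)
    then show "norm (W z * conv_decr (\<eta> * (x - ln (s * W z)))) \<le>
      norm (W z * (1 + \<eta> * (\<bar>x\<bar> + \<bar>ln s\<bar>)) + \<eta> * (W z * log_plus (W z)))"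
      using potential_integrand_le[OF assms, of z x] by simp
  qed
qed measurable

lemma potential_nonneg: "0 \<le> potential s x"
  unfolding potential_def using m_pos \<eta> conv_decr_pos
  by (intro integral_nonneg_AE AE_I2) (simp add: less_imp_le)

lemma measurable_potential [measurable]: "potential s \<in> borel_measurable borel"
  unfolding potential_def[abs_def] by (rule borel_measurable_lebesgue_integral) measurable

text \<open>For a fixed label \<open>z\<close>, one step of the walk lowers the shifted
  \<open>conv_decr\<close> by a multiple of its slope, which dominates the integrand of
  \<open>loss\<close>; Fubini averages over \<open>z\<close>. Hence the potential pays for the
  losses accumulated along the walk.\<close>

lemma potential_superharmonic:
  assumes s: "0 < s"
  shows "integrable \<kappa> (\<lambda>y. potential s (x + y))"
    and "(\<integral>y. potential s (x + y) \<partial>\<kappa>) + loss s x \<le> potential s x"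
proof -
  let ?c = "2 / (m * \<eta>)"
  let ?u = "\<lambda>z. \<eta> * (x - ln (s * W z))"
  interpret pair_sigma_finite \<kappa> \<mu> by unfold_locales
  have c: "0 < ?c" using m_pos \<eta> by simp
  have int1: "integrable \<mu> (\<lambda>z. ?c * W z * conv_decr (?u z))"
    using integrable_mult_right[OF integrable_potential[OF s, of x], of ?c] by (simp add: mult.assoc)
  have int2: "integrable \<mu> (\<lambda>z. W z * min 1 (s * exp (- x) * W z))"
    by (rule Bochner_Integration.integrable_bound[OF integrable_W]) (use s in \<open>auto simp: mult_left_le intro!: AE_I2\<close>)
  have mean: "?c * W z * (\<integral>y. conv_decr (?u z + \<eta> * y) \<partial>\<kappa>) \<le>
      ?c * W z * conv_decr (?u z) - W z * min 1 (s * exp (- x) * W z)" for z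
  proof (cases "W z = 0")
    case False
    then have Wp: "0 < W z" using W_nonneg[of z] by linarith
    have "?c * W z * (\<integral>y. conv_decr (?u z + \<eta> * y) \<partial>\<kappa>) \<le>
        ?c * W z * (conv_decr (?u z) - \<eta> * m / 2 * conv_slope (?u z))"
      using c by (intro mult_left_mono conv_decr_drift(2)) auto
    also have "\<dots> = ?c * W z * conv_decr (?u z) - W z * conv_slope (?u z)"
      using m_pos \<eta> by (simp add: field_simps)
    also have "\<dots> \<le> ?c * W z * conv_decr (?u z) - W z * min 1 (s * exp (- x) * W z)"
    proof -
      have "exp (- (x - ln (s * W z))) = s * exp (- x) * W z"
        using s Wp by (simp add: exp_diff exp_minus field_simps)
      then have "min 1 (s * exp (- x) * W z) \<le> conv_slope (?u z)"
        using conv_slope_ge[OF \<eta>(1,2), of "x - ln (s * W z)"] by simp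
      then show ?thesis by (intro diff_left_mono mult_left_mono) auto
    qed
    finally show ?thesis .
  qed simp
  have mean_nn: "0 \<le> ?c * W z * (\<integral>y. conv_decr (?u z + \<eta> * y) \<partial>\<kappa>)" for z
    using c conv_decr_pos by (intro mult_nonneg_nonneg integral_nonneg_AE AE_I2) (auto simp: less_imp_le)
  have diff_nn: "0 \<le> ?c * W z * conv_decr (?u z) - W z * min 1 (s * exp (- x) * W z)" for z
    using mean_nn mean by (rule order_trans)
  have pw: "(\<integral>\<^sup>+y. ennreal (?c * W z * conv_decr (\<eta> * (x + y - ln (s * W z)))) \<partial>\<kappa>) \<le>
      ennreal (?c * W z * conv_decr (?u z) - W z * min 1 (s * exp (- x) * W z))" for z
  proof -
    have "(\<integral>\<^sup>+y. ennreal (?c * W z * conv_decr (\<eta> * (x + y - ln (s * W z)))) \<partial>\<kappa>) =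
        (\<integral>\<^sup>+y. ennreal (?c * W z * conv_decr (?u z + \<eta> * y)) \<partial>\<kappa>)"
      by (simp add: algebra_simps)
    also have "\<dots> = ennreal (\<integral>y. ?c * W z * conv_decr (?u z + \<eta> * y) \<partial>\<kappa>)"
      using conv_decr_drift(1)[of "?u z"] c conv_decr_pos by (intro nn_integral_eq_integral) (auto intro!: AE_I2 simp: less_imp_le)
    also have "(\<integral>y. ?c * W z * conv_decr (?u z + \<eta> * y) \<partial>\<kappa>) = ?c * W z * (\<integral>y. conv_decr (?u z + \<eta> * y) \<partial>\<kappa>)"
      by simp
    finally show ?thesis using mean[of z] by (simp add: ennreal_leI)
  qed
  have nn: "0 \<le> ?c * W z * conv_decr y" for z y
    using c conv_decr_pos[of y] by (simp add: less_imp_le)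
  \<comment> \<open>Nonnegative integrals come first because integrability of the shifted potential
    is itself part of the claim.\<close>
  have "(\<integral>\<^sup>+y. ennreal (potential s (x + y)) \<partial>\<kappa>) =
      (\<integral>\<^sup>+y. \<integral>\<^sup>+z. ennreal (?c * W z * conv_decr (\<eta> * (x + y - ln (s * W z)))) \<partial>\<mu> \<partial>\<kappa>)"
  proof (intro nn_integral_cong)
    fix y
    have "integrable \<mu> (\<lambda>z. ?c * W z * conv_decr (\<eta> * (x + y - ln (s * W z))))"
      using integrable_mult_right[OF integrable_potential[OF s, of "x + y"], of ?c] by (simp add: mult.assoc)
    then show "ennreal (potential s (x + y)) = (\<integral>\<^sup>+z. ennreal (?c * W z * conv_decr (\<eta> * (x + y - ln (s * W z)))) \<partial>\<mu>)"
      unfolding potential_def by (rule nn_integral_eq_integral[symmetric]) (simp only: nn AE_I2)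
  qed
  also have "\<dots> = (\<integral>\<^sup>+z. \<integral>\<^sup>+y. ennreal (?c * W z * conv_decr (\<eta> * (x + y - ln (s * W z)))) \<partial>\<kappa> \<partial>\<mu>)"
    by (rule Fubini'[symmetric]) measurable
  also have "\<dots> \<le> (\<integral>\<^sup>+z. ennreal (?c * W z * conv_decr (?u z) - W z * min 1 (s * exp (- x) * W z)) \<partial>\<mu>)"
    by (intro nn_integral_mono pw)
  also have "\<dots> = ennreal (\<integral>z. ?c * W z * conv_decr (?u z) - W z * min 1 (s * exp (- x) * W z) \<partial>\<mu>)"
    using int1 int2 by (intro nn_integral_eq_integral Bochner_Integration.integrable_diff AE_I2 diff_nn)
  also have "\<dots> = ennreal (potential s x - loss s x)"
    unfolding potential_def loss_def using int1 int2 by simp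
  finally have fin: "(\<integral>\<^sup>+y. ennreal (potential s (x + y)) \<partial>\<kappa>) \<le> ennreal (potential s x - loss s x)" .
  show int: "integrable \<kappa> (\<lambda>y. potential s (x + y))"
    using fin by (intro integrableI_nonneg) (auto simp: potential_nonneg intro: le_less_trans)
  have "0 \<le> (\<integral>z. ?c * W z * conv_decr (?u z) - W z * min 1 (s * exp (- x) * W z) \<partial>\<mu>)"
    by (intro integral_nonneg_AE AE_I2 diff_nn)
  then have "0 \<le> potential s x - loss s x"
    unfolding potential_def loss_def using int1 int2 by simp
  then show "(\<integral>y. potential s (x + y) \<partial>\<kappa>) + loss s x \<le> potential s x"
    using fin int by (simp add: nn_integral_eq_integral potential_nonneg ennreal_le_iff)
qed

end

section \<open>Fast rays exist\<close>

text \<open>Mean value theorem, with intermediate point at most \<open>2 * u\<close> because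
  \<open>w \<le> u\<close>. Over a block of length \<open>u powr p\<close> the admissible starting
  height grows by this order, which has to pay for the height left after the jump back.\<close>

lemma powr_increment:
  fixes u w p :: real
  assumes p: "0 < p" "p < 1" and u: "1 \<le> u" and w: "w = u powr p"
  shows "p / 2 * u powr (2 * p - 1) \<le> (u + w) powr p - u powr p"
proof -
  have w1: "0 < w" "w \<le> u" using u p powr_mono[of p 1 u] by (auto simp: w)
  obtain z where z: "u < z" "z < u + w" "(u + w) powr p - u powr p = (u + w - u) * (p * z powr (p - 1))"
  proof -
    have "\<exists>z>u. z < u + w \<and> (u + w) powr p - u powr p = (u + w - u) * (p * z powr (p - 1))"
    proof (rule MVT2)
      show "u < u + w" using w1 by simp
      fix x assume "u \<le> x"
      then show "((\<lambda>x. x powr p) has_real_derivative p * x powr (p - 1)) (at x)"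
        using u by (intro has_real_derivative_powr) auto
    qed
    then show ?thesis using that by blast
  qed
  have "(2 * u) powr (p - 1) \<le> z powr (p - 1)" using z u w1 p by (intro powr_mono2') auto
  moreover have "1 / 2 * u powr (p - 1) \<le> (2 * u) powr (p - 1)"
  proof -
    have "2 powr (- 1 :: real) \<le> 2 powr (p - 1)" using p by (intro powr_mono) auto
    then show ?thesis using u by (auto simp: powr_mult powr_minus_divide intro!: mult_right_mono)
  qed
  ultimately have "1 / 2 * u powr (p - 1) \<le> z powr (p - 1)" by linarith
  then have "w * (p * (1 / 2 * u powr (p - 1))) \<le> w * (p * z powr (p - 1))"
    using w1 p by (intro mult_left_mono) auto
  also have "w * (p * (1 / 2 * u powr (p - 1))) = p / 2 * (u powr p * u powr (p - 1))" by (simp add: w)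
  also have "u powr p * u powr (p - 1) = u powr (2 * p - 1)" by (simp flip: powr_add)
  finally show ?thesis using z(3) by simp
qed

context leaping_offspring begin

text \<open>Dominated convergence along \<open>s = 1 / (n + 1)\<close>: the arguments of
  \<open>conv_decr\<close> tend to infinity, and the integrand for \<open>s = 1\<close>
  dominates.\<close>

lemma potential_small: "\<exists>s. 0 < s \<and> s \<le> 1 \<and> potential s 0 \<le> 1 / 4"
proof -
  let ?c = "2 / (m * \<eta>)"
  let ?f = "\<lambda>s z. ?c * W z * conv_decr (\<eta> * (0 - ln (s * W z)))"
  have c: "0 < ?c" using m_pos \<eta> by simp
  have v0: "(conv_decr \<longlongrightarrow> 0) at_top"
  proof (rule Lim_transform_eventually)
    show "((\<lambda>y :: real. 1 / (1 + y)) \<longlongrightarrow> 0) at_top" by real_asymp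
    show "\<forall>\<^sub>F y in at_top. 1 / (1 + y) = conv_decr y"
      using eventually_gt_at_top[of 0] by eventually_elim (simp add: conv_decr_def)
  qed
  have "(\<lambda>n. potential (1 / (real n + 1)) 0) \<longlonglongrightarrow> (\<integral>z. 0 \<partial>\<mu>)"
    unfolding potential_def
  proof (rule integral_dominated_convergence)
    show "integrable \<mu> (\<lambda>z. ?f 1 z)"
      using integrable_mult_right[OF integrable_potential[of 1 0], of ?c] by (simp add: mult.assoc)
    show "AE z in \<mu>. (\<lambda>n. ?f (1 / (real n + 1)) z) \<longlonglongrightarrow> 0"
    proof (rule AE_I2)
      fix z
      show "(\<lambda>n. ?f (1 / (real n + 1)) z) \<longlonglongrightarrow> 0"
      proof (cases "W z = 0")
        case False
        then have Wp: "0 < W z" using W_nonneg[of z] by linarith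
        have "filterlim (\<lambda>n. \<eta> * (0 - ln (1 / (real n + 1) * W z))) at_top sequentially"
          using Wp \<eta>(1) by real_asymp
        then have "(\<lambda>n. conv_decr (\<eta> * (0 - ln (1 / (real n + 1) * W z)))) \<longlonglongrightarrow> 0"
          by (rule filterlim_compose[OF v0])
        then have "(\<lambda>n. ?c * W z * conv_decr (\<eta> * (0 - ln (1 / (real n + 1) * W z)))) \<longlonglongrightarrow> ?c * W z * 0"
          by (rule tendsto_mult_left)
        then show ?thesis by simp
      qed simp
    qed
    fix n
    show "AE z in \<mu>. norm (?f (1 / (real n + 1)) z) \<le> ?f 1 z"
    proof (rule AE_I2)
      fix z
      show "norm (?f (1 / (real n + 1)) z) \<le> ?f 1 z"
      proof (cases "W z = 0")
        case False
        then have Wp: "0 < W z" using W_nonneg[of z] by linarith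
        have "ln (1 / (real n + 1) * W z) \<le> ln (1 * W z)"
          using Wp by (intro ln_mono mult_right_mono) auto
        then have "conv_decr (\<eta> * (0 - ln (1 / (real n + 1) * W z))) \<le> conv_decr (\<eta> * (0 - ln (1 * W z)))"
          using \<eta> by (intro conv_decr_antimono mult_left_mono) auto
        then have le: "?f (1 / (real n + 1)) z \<le> ?f 1 z"
          using c by (intro mult_left_mono) auto
        have "0 \<le> ?f (1 / (real n + 1)) z"
          using c conv_decr_pos by (intro mult_nonneg_nonneg) (auto simp: less_imp_le)
        then show ?thesis using le by (simp only: real_norm_def abs_of_nonneg)
      qed simp
    qed
  qed measurable
  then have "\<forall>\<^sub>F n in sequentially. potential (1 / (real n + 1)) 0 < 1 / 4"
    by (intro order_tendstoD) auto
  then have "\<exists>n. potential (1 / (real n + 1)) 0 < 1 / 4"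
    by (rule eventually_happens'[OF sequentially_bot])
  then obtain n where "potential (1 / (real n + 1)) 0 < 1 / 4" ..
  then show ?thesis by (intro exI[of _ "1 / (real n + 1)"]) simp
qed

text \<open>Replace the success probabilities of the children by their lower bounds and expand with
  \<open>one_minus_prod_ge\<close>. The many-to-one formula turns the first order term into an
  integral over the walk, and the second order term is \<open>loss\<close>. Heights are relative to
  the base \<open>a\<close>.\<close>

lemma reach_prob_Suc_ge:
  assumes s: "0 < s" and x: "a + x \<le> \<beta> 0" and [measurable]: "R \<in> borel_measurable borel"
    and R: "\<And>y. R y \<le> 1" "\<And>y. s * exp (- y) * max 0 (R y) \<le> reach_prob N (\<lambda>k. \<beta> (Suc k)) (a + y)"
  shows "s * exp (- x) * ((\<integral>y. max 0 (R (x + y)) \<partial>\<kappa>) - loss s x) \<le> reach_prob (Suc N) \<beta> (a + x)"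
proof -
  let ?t = "s * exp (- x)"
  let ?p = "\<lambda>y. reach_prob N (\<lambda>k. \<beta> (Suc k)) (a + (x + y))"
  let ?g = "\<lambda>y. max 0 (R (x + y))"
  let ?r = "\<lambda>y. s * exp (- (x + y)) * ?g y"
  let ?S = "\<lambda>z. \<Sum>i<fst z. ?g (snd z i) * exp (- snd z i)"
  have t: "0 < ?t" using s by simp
  have r: "0 \<le> ?r y" "?r y \<le> ?p y" "?r y \<le> 1" for y
  proof -
    show "0 \<le> ?r y" using s by simp
    show "?r y \<le> ?p y" by (rule R(2))
    then show "?r y \<le> 1" using reach_prob_le_1 by (rule order_trans)
  qed
  have S_meas [measurable]: "?S \<in> borel_measurable \<mu>" by measurable
  have S: "0 \<le> ?S z" "?S z \<le> W z" for z
    unfolding W_def using R(1) by (auto intro!: sum_nonneg sum_mono simp: mult_left_le_one_le)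
  have int_S: "integrable \<mu> ?S"
    by (rule Bochner_Integration.integrable_bound[OF integrable_W]) (use S in \<open>auto intro!: AE_I2\<close>)
  have int_g: "integrable \<kappa> ?g"
    by (rule X.integrable_const_bound[of _ 1]) (use R(1) in \<open>auto intro!: AE_I2\<close>)
  have "ennreal (\<integral>z. ?S z \<partial>\<mu>) = (\<integral>\<^sup>+z. ennreal (?S z) \<partial>\<mu>)"
    by (rule nn_integral_eq_integral[symmetric, OF int_S]) (simp only: S AE_I2)
  also have "\<dots> = (\<integral>\<^sup>+y. ennreal (?g y) \<partial>\<kappa>)" by (rule many_to_one) auto
  also have "\<dots> = ennreal (\<integral>y. ?g y \<partial>\<kappa>)" by (rule nn_integral_eq_integral[OF int_g]) auto
  finally have S_eq: "(\<integral>z. ?S z \<partial>\<mu>) = (\<integral>y. ?g y \<partial>\<kappa>)"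
    by (subst (asm) ennreal_inj) (auto intro!: integral_nonneg_AE AE_I2 S(1))
  let ?w = "\<lambda>z. W z * min 1 (?t * W z)"
  have int_w: "integrable \<mu> ?w"
    by (rule Bochner_Integration.integrable_bound[OF integrable_W]) (use s in \<open>auto simp: mult_left_le intro!: AE_I2\<close>)
  let ?\<Pi> = "\<lambda>z. \<Prod>i<fst z. 1 - ?p (snd z i)"
  have \<Pi>: "0 \<le> ?\<Pi> z" "?\<Pi> z \<le> 1" for z by (auto intro!: prod_nonneg prod_le_1)
  have [measurable]: "?\<Pi> \<in> borel_measurable \<mu>" by measurable
  have int_\<Pi>: "integrable \<mu> ?\<Pi>" by (rule integrable_const_bound[of _ 1]) (auto simp: \<Pi>)
  have pw: "?t * ?S z - ?t * ?w z \<le> 1 - ?\<Pi> z" for z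
  proof -
    have sum_eq: "(\<Sum>i<fst z. ?r (snd z i)) = ?t * ?S z"
    proof -
      have "exp (- (x + u)) = exp (- x) * exp (- u)" for u by (simp flip: exp_add)
      then show ?thesis by (simp only: sum_distrib_left mult_ac)
    qed
    have "(\<Sum>i<fst z. ?r (snd z i)) - (?t * W z) * min 1 (?t * W z) \<le> 1 - (\<Prod>i<fst z. 1 - ?r (snd z i))"
      by (rule one_minus_prod_ge[OF r(1) r(3)]) (use sum_eq S(2)[of z] t in \<open>auto intro: mult_left_mono\<close>)
    also have "\<dots> \<le> 1 - ?\<Pi> z"
      using r by (intro diff_left_mono prod_mono) auto
    finally show ?thesis unfolding sum_eq by (simp add: mult.assoc)
  qed
  have "?t * ((\<integral>y. ?g y \<partial>\<kappa>) - loss s x) = (\<integral>z. ?t * ?S z - ?t * ?w z \<partial>\<mu>)"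
    unfolding loss_def S_eq[symmetric] using int_S int_w by (simp add: right_diff_distrib)
  also have "\<dots> \<le> (\<integral>z. 1 - ?\<Pi> z \<partial>\<mu>)"
    using int_S int_w int_\<Pi> by (intro integral_mono pw) auto
  also have "\<dots> = reach_prob (Suc N) \<beta> (a + x)"
    using int_\<Pi> prob_space[simplified] by (subst reach_prob_Suc) (simp_all add: x add.assoc)
  finally show ?thesis .
qed

section \<open>Exit estimates for the tilted walk\<close>

definition mgf :: real where "mgf = (\<integral>x. exp (\<eta>0 * x) \<partial>\<kappa>)"

lemma mgf_ge_1: "1 \<le> mgf"
proof -
  have "1 \<le> 1 + \<eta>0 * m" using right_moment m_pos by simp
  also have "\<dots> = (\<integral>x. 1 + \<eta>0 * x \<partial>\<kappa>)" by (simp add: m_def)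
  also have "\<dots> \<le> mgf" unfolding mgf_def
    using right_moment by (intro integral_mono) auto
  finally show ?thesis .
qed

definition var :: real where "var = (\<integral>x. (x - m)\<^sup>2 \<partial>\<kappa>)"

lemma var_nonneg: "0 \<le> var" unfolding var_def by simp

text \<open>With \<open>k\<close> steps to go from \<open>x\<close>, the two terms control the probability of ever exceeding
  \<open>H\<close> and the probability that the final position is below \<open>c\<close>.\<close>

definition exit_bound :: "real \<Rightarrow> real \<Rightarrow> nat \<Rightarrow> nat \<Rightarrow> real \<Rightarrow> real" where
  "exit_bound H c T k x = mgf ^ k * exp (\<eta>0 * (x - H)) +
     ((x + m * real k - m * real T)\<^sup>2 + real k * var) / (m * real T - c)\<^sup>2"

text \<open>Both summands are harmonic in space and time: the exponential picks up a factor
  \<open>mgf\<close>, and in the square the centred cross term integrates to \<open>0\<close> and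
  leaves \<open>var\<close>.\<close>

lemma exit_bound_step:
  shows "integrable \<kappa> (\<lambda>y. exit_bound H c T k (x + y))"
    and "(\<integral>y. exit_bound H c T k (x + y) \<partial>\<kappa>) = exit_bound H c T (Suc k) x"
proof -
  let ?a = "x + m * real (Suc k) - m * real T"
  have eq: "exit_bound H c T k (x + y) = mgf ^ k * exp (\<eta>0 * (x - H)) * exp (\<eta>0 * y) +
      (?a\<^sup>2 + 2 * ?a * (y - m) + (y - m)\<^sup>2 + real k * var) / (m * real T - c)\<^sup>2" for y
    unfolding exit_bound_def
    by (simp add: algebra_simps power2_eq_square flip: exp_add)
  have int: "integrable \<kappa> (\<lambda>y. exp (\<eta>0 * y))" "integrable \<kappa> (\<lambda>y. (y - m)\<^sup>2)"
    using right_moment by (auto simp: power2_diff)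
  show "integrable \<kappa> (\<lambda>y. exit_bound H c T k (x + y))" unfolding eq using int by auto
  have "(\<integral>y. y - m \<partial>\<kappa>) = 0" by (simp add: m_def)
  then have "(\<integral>y. exit_bound H c T k (x + y) \<partial>\<kappa>) =
      mgf ^ k * exp (\<eta>0 * (x - H)) * mgf + (?a\<^sup>2 + var + real k * var) / (m * real T - c)\<^sup>2"
    unfolding eq mgf_def var_def using int by simp
  also have "\<dots> = exit_bound H c T (Suc k) x"
    by (simp add: exit_bound_def algebra_simps)
  finally show "(\<integral>y. exit_bound H c T k (x + y) \<partial>\<kappa>) = exit_bound H c T (Suc k) x" .
qed

lemma exit_bound_nonneg: "0 \<le> exit_bound H c T k x"
  using mgf_ge_1 var_nonneg by (auto simp: exit_bound_def)

lemma exit_bound_above: "H < x \<Longrightarrow> 1 \<le> exit_bound H c T k x"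
proof -
  assume "H < x"
  then have "1 * 1 \<le> mgf ^ k * exp (\<eta>0 * (x - H))"
    using mgf_ge_1 right_moment by (intro mult_mono one_le_power) auto
  moreover have "0 \<le> ((x + m * real k - m * real T)\<^sup>2 + real k * var) / (m * real T - c)\<^sup>2"
    using var_nonneg by auto
  ultimately show ?thesis by (simp add: exit_bound_def)
qed

lemma exit_bound_below:
  assumes "x < c" "c < m * real T" shows "1 \<le> exit_bound H c T 0 x"
proof -
  have "(m * real T - c)\<^sup>2 \<le> (m * real T - x)\<^sup>2" using assms by (intro power_mono) auto
  then have "1 \<le> (x - m * real T)\<^sup>2 / (m * real T - c)\<^sup>2"
    using assms by (simp add: power2_commute[of x])
  moreover have "exit_bound H c T 0 x = exp (\<eta>0 * (x - H)) + (x - m * real T)\<^sup>2 / (m * real T - c)\<^sup>2"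
    by (simp add: exit_bound_def)
  moreover have "0 \<le> exp (\<eta>0 * (x - H))" by simp
  ultimately show ?thesis by linarith
qed

lemma measurable_exit_bound [measurable]: "exit_bound H c T k \<in> borel_measurable borel"
  unfolding exit_bound_def[abs_def] by measurable

text \<open>A line climbs with the drift for \<open>T\<close> steps below \<open>a + C * T\<close>;
  then one child jumps back almost to height \<open>a\<close>, where the rest succeeds with
  probability \<open>\<epsilon>\<close>. The same \<open>\<epsilon>\<close> comes out, so blocks can
  be concatenated without loss.\<close>

lemma block_success:
  obtains \<epsilon> C d T0 where "0 < \<epsilon>" "\<epsilon> \<le> 1" "0 < C" "0 < d" "0 < T0"
    and "\<And>T N \<beta> a x. T0 \<le> T \<Longrightarrow> \<forall>k\<le>T. a + C * real T \<le> \<beta> k \<Longrightarrow>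
     \<forall>y\<le>a + lam' * (C * real T) powr b + d. \<epsilon> \<le> reach_prob N (\<lambda>j. \<beta> (Suc T + j)) y \<Longrightarrow>
     x \<le> a \<Longrightarrow> \<epsilon> \<le> reach_prob (N + Suc T) \<beta> x"
proof -
  obtain s where s: "0 < s" "s \<le> 1" "potential s 0 \<le> 1 / 4" using potential_small by blast
  \<comment> \<open>Half of \<open>s\<close> remains, because the potential and the exit bound take
    at most \<open>1 / 4\<close> each at the start.\<close>
  define \<epsilon> where "\<epsilon> = s / 2"
  \<comment> \<open>This gives \<open>mgf ^ T * exp (- \<eta>0 * C * T) = exp (- T)\<close>, so an
    exit through the top is unlikely.\<close>
  define C where "C = (ln mgf + 1) / \<eta>0"
  \<comment> \<open>\<open>c2 * exp d \<ge> 2\<close> makes up for the constant \<open>c2\<close> of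
    the jump and for the ratio \<open>s / \<epsilon> = 2\<close>.\<close>
  define d where "d = max 1 (ln (2 / c2))"
  have \<epsilon>: "0 < \<epsilon>" "\<epsilon> \<le> 1" using s by (auto simp: \<epsilon>_def)
  have C: "0 < C" using mgf_ge_1 right_moment by (auto simp: C_def intro!: divide_pos_pos add_nonneg_pos)
  have d: "0 < d" "2 \<le> c2 * exp d"
  proof -
    have "exp (ln (2 / c2)) \<le> exp d" by (simp add: d_def)
    then show "2 \<le> c2 * exp d" using lower_tail by (simp add: field_simps)
  qed (simp add: d_def)
  have "\<forall>\<^sub>F T in sequentially. d < m * real T \<and>
      exp (- real T) \<le> 1 / 8 \<and> real T * var / (m * real T - d)\<^sup>2 \<le> 1 / 8"
  proof (intro eventually_conj)
    show "\<forall>\<^sub>F T in sequentially. d < m * real T" using m_pos by real_asymp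
    show "\<forall>\<^sub>F T in sequentially. exp (- real T) \<le> 1 / 8" by real_asymp
    have "(\<lambda>T. real T * v / (m * real T - d)\<^sup>2) \<longlonglongrightarrow> 0" for v using m_pos by real_asymp
    then have "\<forall>\<^sub>F T in sequentially. real T * var / (m * real T - d)\<^sup>2 < 1 / 8"
      by (rule order_tendstoD) simp
    then show "\<forall>\<^sub>F T in sequentially. real T * var / (m * real T - d)\<^sup>2 \<le> 1 / 8"
      by eventually_elim simp
  qed
  then obtain T0 where T0: "\<And>T. T \<ge> T0 \<Longrightarrow> d < m * real T"
    "\<And>T. T \<ge> T0 \<Longrightarrow> exp (- real T) \<le> 1 / 8"
    "\<And>T. T \<ge> T0 \<Longrightarrow> real T * var / (m * real T - d)\<^sup>2 \<le> 1 / 8"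
    unfolding eventually_sequentially by blast
  have main: "\<epsilon> \<le> reach_prob (N + Suc T) \<beta> x"
    if T: "T \<ge> T0" and bar: "\<forall>k\<le>T. a + C * real T \<le> \<beta> k"
      and succ: "\<forall>y\<le>a + lam' * (C * real T) powr b + d. \<epsilon> \<le> reach_prob N (\<lambda>j. \<beta> (Suc T + j)) y"
      and x: "x \<le> a" for T N \<beta> a x
  proof -
    define H where "H = C * real T"
    \<comment> \<open>The height allowed after the jump: \<open>lam' * H powr b\<close> compensates
      the stretched exponential cost of a jump of size at most \<open>H\<close>.\<close>
    define D where "D = lam' * H powr b + d"
    have H: "0 \<le> H" using C by (simp add: H_def)
    have D: "0 \<le> D" using lower_tail d by (simp add: D_def)
    let ?B = "exit_bound H d T"
    let ?R = "\<lambda>k y. 1 - potential s y - ?B k y"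
    \<comment> \<open>Backward induction inside the block: \<open>k\<close> steps of climbing, one
      step for the jump, then the remaining \<open>N\<close> generations.\<close>
    have claim: "k \<le> T \<Longrightarrow> s * exp (- y) * max 0 (?R k y) \<le> reach_prob (N + Suc k) (\<lambda>j. \<beta> (T - k + j)) (a + y)" for k y
    proof (induction k arbitrary: y)
      case 0
      \<comment> \<open>When the jump is due, the lower bound is trivial unless the line has climbed
        to at least \<open>d\<close> without exceeding \<open>H\<close>.\<close>
      consider "?R 0 y \<le> 0" | "d \<le> y" "y \<le> H"
        using exit_bound_below[of y d T H] exit_bound_above[of H y d T 0] T0(1)[OF T] potential_nonneg[of s y]
        by fastforce
      then show ?case
      proof cases
        case 1
        then show ?thesis by (simp add: max_absorb1)
      next
        case 2
        let ?p = "\<lambda>u. reach_prob N (\<lambda>j. \<beta> (T + Suc j)) (a + y + u)"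
        let ?\<Pi> = "\<lambda>z. \<Prod>i<fst z. 1 - ?p (snd z i)"
        let ?E = "{z :: nat \<times> (nat \<Rightarrow> real). 1 \<le> fst z \<and> snd z 0 \<le> - (y - D)}"
        have \<Pi>: "0 \<le> ?\<Pi> z" "?\<Pi> z \<le> 1" for z by (auto intro!: prod_nonneg prod_le_1)
        have norm_\<Pi>: "norm (?\<Pi> z) \<le> 1" for z
          using \<Pi>[of z] by (simp only: real_norm_def abs_of_nonneg)
        have [measurable]: "?\<Pi> \<in> borel_measurable \<mu>" by measurable
        have int: "integrable \<mu> ?\<Pi>"
          by (rule integrable_const_bound[of _ 1]) (intro AE_I2 norm_\<Pi>, measurable)
        have "Measurable.pred \<mu> (\<lambda>z. 1 \<le> fst z \<and> snd z 0 \<le> - (y - D))" by measurable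
        then have "?E \<in> events" by (simp add: pred_def)
        then have intE: "integrable \<mu> (\<lambda>z. \<epsilon> * indicator ?E z)"
          by (intro integrable_mult_right integrable_real_indicator) (simp_all add: emeasure_eq_measure)
        have start: "a + y \<le> \<beta> (T + 0)" using bar[rule_format, of T] 2 by (simp add: H_def)
        have pw: "\<epsilon> * indicator ?E z \<le> 1 - ?\<Pi> z" for z
        proof (cases "z \<in> ?E")
          case True
          then have "1 \<le> fst z" and z2: "snd z 0 \<le> - (y - D)" by simp_all
          then have z1: "0 < fst z" by linarith
          have "?\<Pi> z = (1 - ?p (snd z 0)) * (\<Prod>i\<in>{..<fst z} - {0}. 1 - ?p (snd z i))"
            using z1 by (intro prod.remove) auto
          also have "\<dots> \<le> (1 - ?p (snd z 0)) * 1"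
            by (intro mult_left_mono prod_le_1) auto
          finally have "?p (snd z 0) \<le> 1 - ?\<Pi> z" by simp
          moreover have "\<epsilon> \<le> ?p (snd z 0)"
            using succ[rule_format, of "a + y + snd z 0"] z2 by (simp add: D_def H_def)
          ultimately show ?thesis using True by simp
        qed (use \<Pi>[of z] in auto)
        have "s * exp (- y) * max 0 (?R 0 y) \<le> s * exp (- y) * 1"
          using s potential_nonneg[of s y] exit_bound_nonneg[of H d T 0 y] by (intro mult_left_mono) auto
        also have "\<dots> \<le> \<epsilon> * (c2 * exp (- max 0 (y - D) - lam' * max 0 (y - D) powr b))"
        proof -
          have "2 * exp (- y) \<le> c2 * exp (- max 0 (y - D) - lam' * max 0 (y - D) powr b)"
          proof (cases "y \<le> D")
            case True
            \<comment> \<open>No drop is required here, as \<open>max 0 (y - D) = 0\<close>; the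
              factor \<open>exp (- y)\<close> is small enough because
              \<open>d \<le> y\<close>.\<close>
            have "2 * exp (- y) \<le> c2 * exp d * exp (- y)" using d by (intro mult_right_mono) auto
            also have "\<dots> = c2 * exp (d - y)" by (simp add: exp_diff exp_minus field_simps)
            also have "\<dots> \<le> c2 * exp 0" using 2 lower_tail by (intro mult_left_mono) auto
            finally show ?thesis using True by simp
          next
            case False
            have le: "(y - D) powr b \<le> H powr b" using False 2 D b by (intro powr_mono2) auto
            have "2 * exp (- y) \<le> c2 * exp d * exp (- y)" using d by (intro mult_right_mono) auto
            also have "\<dots> = c2 * exp (d - y)" by (simp add: exp_diff exp_minus field_simps)
            also have "\<dots> = c2 * exp (- (y - D) - lam' * H powr b)" by (simp add: D_def)
            also have "\<dots> \<le> c2 * exp (- (y - D) - lam' * (y - D) powr b)"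
              using lower_tail le by (intro mult_left_mono) auto
            finally show ?thesis using False by simp
          qed
          then show ?thesis using s by (simp add: \<epsilon>_def)
        qed
        also have "\<dots> \<le> \<epsilon> * prob ?E" using \<epsilon> by (intro mult_left_mono lower_tail(3)) auto
        also have "\<dots> = (\<integral>z. \<epsilon> * indicator ?E z \<partial>\<mu>)" by simp
        also have "\<dots> \<le> (\<integral>z. 1 - ?\<Pi> z \<partial>\<mu>)" by (rule integral_mono[OF intE _ pw]) (use int in simp)
        also have "\<dots> = reach_prob (Suc N) (\<lambda>j. \<beta> (T + j)) (a + y)"
          using int prob_space[simplified] by (subst reach_prob_Suc) (use start in simp_all)
        finally show ?thesis by simp
      qed
    next
      case (Suc k)
      show ?case
      proof (cases "?R (Suc k) y \<le> 0")
        case True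
        then show ?thesis by (simp add: max_absorb1)
      next
        case False
        have "y \<le> H"
        proof (rule ccontr)
          assume "\<not> y \<le> H"
          then have "1 \<le> ?B (Suc k) y" by (intro exit_bound_above) simp
          then show False using False potential_nonneg[of s y] by linarith
        qed
        have idx: "T - Suc k + Suc j = T - k + j" for j using Suc.prems by simp
        have "s * exp (- y) * max 0 (?R (Suc k) y) \<le>
            s * exp (- y) * ((\<integral>u. max 0 (?R k (y + u)) \<partial>\<kappa>) - loss s y)"
        proof -
          have int: "integrable \<kappa> (\<lambda>u. ?R k (y + u))"
            using potential_superharmonic(1)[OF s(1), of y] exit_bound_step(1)[of H d T k y] by auto
          have "?R (Suc k) y \<le> 1 - (\<integral>u. potential s (y + u) \<partial>\<kappa>) - (\<integral>u. ?B k (y + u) \<partial>\<kappa>) - loss s y"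
            using potential_superharmonic(2)[OF s(1), of y] exit_bound_step(2)[of H d T k y] by simp
          also have "\<dots> = (\<integral>u. ?R k (y + u) \<partial>\<kappa>) - loss s y"
            using potential_superharmonic(1)[OF s(1), of y] exit_bound_step(1)[of H d T k y] by simp
          also have "(\<integral>u. ?R k (y + u) \<partial>\<kappa>) \<le> (\<integral>u. max 0 (?R k (y + u)) \<partial>\<kappa>)"
            using int by (intro integral_mono) auto
          finally show ?thesis using False s by (intro mult_left_mono) (auto simp: max_absorb2)
        qed
        also have "\<dots> \<le> reach_prob (Suc (N + Suc k)) (\<lambda>j. \<beta> (T - Suc k + j)) (a + y)"
        proof (rule reach_prob_Suc_ge[OF s(1)])
          show "a + y \<le> \<beta> (T - Suc k + 0)" using bar[rule_format, of "T - Suc k"] \<open>y \<le> H\<close> by (simp add: H_def)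
          show "?R k u \<le> 1" for u using potential_nonneg[of s u] exit_bound_nonneg[of H d T k u] by simp
          show "s * exp (- u) * max 0 (?R k u) \<le> reach_prob (N + Suc k) (\<lambda>j. \<beta> (T - Suc k + Suc j)) (a + u)" for u
            unfolding idx using Suc.prems by (intro Suc.IH) simp
        qed measurable
        finally show ?thesis by simp
      qed
    qed
    have "mgf ^ T * exp (\<eta>0 * (0 - H)) = exp (- real T)"
    proof -
      have "mgf ^ T = exp (real T * ln mgf)" using mgf_ge_1 by (simp add: exp_of_nat_mult)
      moreover have "\<eta>0 * C = ln mgf + 1" using right_moment by (simp add: C_def)
      then have "\<eta>0 * C * real T = (ln mgf + 1) * real T" by simp
      then have "\<eta>0 * (0 - H) = - (real T * ln mgf) - real T" by (simp add: H_def algebra_simps)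
      ultimately show ?thesis by (simp only: exp_add[symmetric]) simp
    qed
    then have "?B T 0 = exp (- real T) + real T * var / (m * real T - d)\<^sup>2" by (simp add: exit_bound_def)
    then have "?B T 0 \<le> 1 / 4" using T0(2,3)[OF T] by linarith
    then have "1 / 2 \<le> max 0 (?R T 0)" using s by linarith
    then have "s * (1 / 2) \<le> s * max 0 (?R T 0)" by (rule mult_left_mono) (use s(1) in linarith)
    then have "\<epsilon> \<le> reach_prob (N + Suc T) \<beta> a" using claim[OF order_refl, of 0] unfolding \<epsilon>_def by simp
    also have "\<dots> \<le> reach_prob (N + Suc T) \<beta> x" using x by (intro reach_prob_mono) auto
    finally show ?thesis .
  qed
  show ?thesis
  \<comment> \<open>The successor makes the threshold positive.\<close>
  proof (rule that[OF \<epsilon> C d(1), of "Suc T0"])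
    fix T N \<beta> a x
    assume "Suc T0 \<le> T"
    then have "T0 \<le> T" by simp
    then show "\<forall>k\<le>T. a + C * real T \<le> \<beta> k \<Longrightarrow>
      \<forall>y\<le>a + lam' * (C * real T) powr b + d. \<epsilon> \<le> reach_prob N (\<lambda>j. \<beta> (Suc T + j)) y \<Longrightarrow>
      x \<le> a \<Longrightarrow> \<epsilon> \<le> reach_prob (N + Suc T) \<beta> x"
      by (rule main)
  qed simp
qed

lemma fast_ray_exists:
  defines "p \<equiv> 1 / (2 - b)"
  shows "\<exists>C. \<exists>D::nat. 0 < tree.prob {\<omega>. stays (\<lambda>k. real D + C * real k powr p) 0 \<omega>}"
proof -
  have p: "0 < p" "p < 1" using b by (auto simp: p_def)
  \<comment> \<open>This identity singles out \<open>p\<close>: over a block of length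
    \<open>u powr p\<close> the starting height grows by order \<open>u powr (2 * p - 1)\<close>,
    and the jump leaves a height of order \<open>(u powr p) powr b\<close>.\<close>
  have pb: "2 * p - 1 = p * b" using b by (simp add: p_def field_simps)
  obtain \<epsilon> C d T0 where \<epsilon>: "0 < \<epsilon>" "\<epsilon> \<le> 1" and pos: "0 < C" "0 < d" "0 < T0"
    and block: "\<And>T N \<beta> a x. T0 \<le> T \<Longrightarrow> \<forall>k\<le>T. a + C * real T \<le> \<beta> k \<Longrightarrow>
     \<forall>y\<le>a + lam' * (C * real T) powr b + d. \<epsilon> \<le> reach_prob N (\<lambda>j. \<beta> (Suc T + j)) y \<Longrightarrow>
     x \<le> a \<Longrightarrow> \<epsilon> \<le> reach_prob (N + Suc T) \<beta> x"
    by (rule block_success) blast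
  \<comment> \<open>Blocks are indexed by the generation \<open>n\<close> at which they begin; the
    successor ensures \<open>w n \<ge> 1\<close>.\<close>
  define w where "w = (\<lambda>n. real (Suc n) powr p)"
  define T where "T = (\<lambda>n. T0 * nat \<lceil>w n\<rceil>)"
  \<comment> \<open>The height left by the jump is at most \<open>C3 * w n powr b\<close>.
    \<open>C2\<close> is such that \<open>powr_increment\<close> covers it by the growth of
    \<open>C2 * w\<close>, and \<open>C4\<close> adds room for the climb inside a block.\<close>
  define C3 where "C3 = lam' * (2 * C * real T0) powr b + d"
  define C2 where "C2 = 2 * C3 / p"
  define C4 where "C4 = C2 + 2 * C * real T0"
  have w1: "1 \<le> w n" for n using p by (simp add: w_def ge_one_powr_ge_zero)
  have w_mono: "w n \<le> w n'" if "n \<le> n'" for n n' using that p by (auto simp: w_def intro!: powr_mono2)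
  have C3: "0 < C3" using lower_tail pos by (simp add: C3_def add_nonneg_pos)
  have C2: "0 < C2" using C3 p by (simp add: C2_def)
  have C4: "0 < C4" using C2 pos by (simp add: C4_def add_pos_pos)
  have Tw: "w n \<le> real (T n)" "real (T n) \<le> 2 * real T0 * w n" "T0 \<le> T n" for n
  proof -
    have c: "w n \<le> real (nat \<lceil>w n\<rceil>)" "real (nat \<lceil>w n\<rceil>) \<le> 2 * w n"
      using w1[of n] by linarith+
    have "real (nat \<lceil>w n\<rceil>) = 1 * real (nat \<lceil>w n\<rceil>)" by simp
    also have "\<dots> \<le> real T0 * real (nat \<lceil>w n\<rceil>)"
      using pos by (intro mult_right_mono) auto
    finally show "w n \<le> real (T n)" using c(1) unfolding T_def of_nat_mult by linarith
    show "real (T n) \<le> 2 * real T0 * w n"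
      using mult_left_mono[OF c(2), of "real T0"] by (simp add: T_def)
    have "1 \<le> nat \<lceil>w n\<rceil>" using c w1[of n] by linarith
    then show "T0 \<le> T n" by (simp add: T_def)
  qed
  have step: "C2 * w n + lam' * (C * real (T n)) powr b + d \<le> C2 * w (n + Suc (T n))" for n
  proof -
    have "(C * real (T n)) powr b \<le> (C * (2 * real T0 * w n)) powr b"
      using Tw[of n] pos b by (intro powr_mono2 mult_left_mono) auto
    also have "\<dots> = (2 * C * real T0) powr b * w n powr b"
      using pos w1[of n] by (subst powr_mult[symmetric]) (auto simp: mult_ac)
    finally have "lam' * (C * real (T n)) powr b + d \<le> lam' * ((2 * C * real T0) powr b * w n powr b) + d * 1"
      using lower_tail by (simp add: mult_left_mono)
    also have "\<dots> \<le> lam' * ((2 * C * real T0) powr b * w n powr b) + d * w n powr b"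
      using w1[of n] pos b by (intro add_left_mono mult_left_mono ge_one_powr_ge_zero) auto
    also have "\<dots> = C3 * w n powr b" by (simp add: C3_def algebra_simps)
    also have "w n powr b = real (Suc n) powr (2 * p - 1)" by (simp add: w_def powr_powr pb)
    also have "C3 * real (Suc n) powr (2 * p - 1) = C2 * (p / 2 * real (Suc n) powr (2 * p - 1))"
      using p by (simp add: C2_def)
    also have "\<dots> \<le> C2 * ((real (Suc n) + w n) powr p - real (Suc n) powr p)"
      using C2 p by (intro mult_left_mono powr_increment) (auto simp: w_def)
    also have "\<dots> \<le> C2 * (w (n + Suc (T n)) - w n)"
      using C2 p Tw(1)[of n] w1[of n] unfolding w_def
      by (intro mult_left_mono diff_right_mono powr_mono2) auto
    finally show ?thesis by (simp add: algebra_simps)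
  qed
  \<comment> \<open>Strong induction on the horizon: by \<open>step\<close>, a line that starts a
    block below \<open>C2 * w n\<close> starts the next one below the corresponding height
    again.\<close>
  have main: "y \<le> C2 * w n \<Longrightarrow> \<epsilon> \<le> reach_prob N (\<lambda>j. C4 * w (n + j)) y" for N n y
  proof (induction N arbitrary: n y rule: less_induct)
    case (less N)
    have bar: "\<forall>k\<le>T n. C2 * w n + C * real (T n) \<le> C4 * w (n + k)"
    proof (intro allI impI)
      fix k
      have "C * real (T n) \<le> C * (2 * real T0 * w n)" using Tw pos by (intro mult_left_mono) auto
      then have "C2 * w n + C * real (T n) \<le> C4 * w n" by (simp add: C4_def algebra_simps)
      also have "\<dots> \<le> C4 * w (n + k)" using C4 w_mono by (intro mult_left_mono) auto
      finally show "C2 * w n + C * real (T n) \<le> C4 * w (n + k)" .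
    qed
    \<comment> \<open>Truncated subtraction: if the block outlasts the horizon,
      \<open>N' = 0\<close>, and monotonicity in the horizon leads back to \<open>N\<close>.\<close>
    define N' where "N' = N - Suc (T n)"
    have "\<epsilon> \<le> reach_prob (N' + Suc (T n)) (\<lambda>j. C4 * w (n + j)) y"
    proof (rule block[OF Tw(3) bar _ less.prems], intro allI impI)
      fix u assume u: "u \<le> C2 * w n + lam' * (C * real (T n)) powr b + d"
      then have u': "u \<le> C2 * w (n + Suc (T n))" using step[of n] by linarith
      show "\<epsilon> \<le> reach_prob N' (\<lambda>j. C4 * w (n + (Suc (T n) + j))) u"
      proof (cases "N' < N")
        case True
        then show ?thesis using less.IH[OF True u'] by (simp add: add.assoc)
      next
        case False
        \<comment> \<open>Only \<open>N = 0\<close> leads here; the start lies below the barrier,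
          and the probability is \<open>1\<close>.\<close>
        then have "N' = 0" by (simp add: N'_def)
        have "C2 * w (n + Suc (T n)) \<le> C4 * w (n + Suc (T n))"
          using pos w1[of "n + Suc (T n)"] by (intro mult_right_mono) (auto simp: C4_def)
        then show ?thesis using u' \<epsilon> \<open>N' = 0\<close> by (simp add: reach_prob_0)
      qed
    qed
    also have "\<dots> \<le> reach_prob N (\<lambda>j. C4 * w (n + j)) y"
      by (rule reach_prob_horizon) (simp add: N'_def)
    finally show ?case .
  qed
  obtain D :: nat where D: "C4 \<le> real D" using real_arch_simple by blast
  let ?\<beta> = "\<lambda>k. real D + C4 * real k powr p"
  have low: "\<epsilon> \<le> reach_prob N ?\<beta> 0" for N
  proof -
    have "\<epsilon> \<le> reach_prob N (\<lambda>j. C4 * w (0 + j)) 0"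
      using C2 w1[of 0] by (intro main) auto
    also have "\<dots> \<le> reach_prob N ?\<beta> 0"
    proof (rule reach_prob_mono)
      fix k
      have "C4 * w (0 + k) \<le> C4 * (real k powr p + 1)"
        using one_add_powr_le[of p "real k"] p C4 by (intro mult_left_mono) (auto simp: w_def)
      then show "C4 * w (0 + k) \<le> real D + C4 * real k powr p" using D by (simp add: algebra_simps)
    qed simp
    finally show ?thesis .
  qed
  \<comment> \<open>Continuity from above carries the bound, which is uniform in the horizon, over
    to infinite lines.\<close>
  have "(\<lambda>N. tree.prob {\<omega>. reach N ?\<beta> 0 \<omega>}) \<longlonglongrightarrow> tree.prob (\<Inter>N. {\<omega>. reach N ?\<beta> 0 \<omega>})"
    by (rule tree.finite_Lim_measure_decseq) (auto simp: decseq_def intro: reach_horizon_mono)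
  then have "\<epsilon> \<le> tree.prob (\<Inter>N. {\<omega>. reach N ?\<beta> 0 \<omega>})"
    by (rule LIMSEQ_le_const) (use low in \<open>auto simp: reach_prob_def\<close>)
  also have "(\<Inter>N. {\<omega>. reach N ?\<beta> 0 \<omega>}) = {\<omega>. stays ?\<beta> 0 \<omega>}" by (auto simp: stays_def)
  finally show ?thesis using \<epsilon> by (intro exI[of _ C4] exI[of _ D]) linarith
qed

end

section \<open>Moments of the tilted walk\<close>

locale stretched_exponential_law = real_distribution \<kappa> for \<kappa> :: "real measure" +
  fixes l :: "real \<Rightarrow> real" and a lam b x0 l_inf :: real
  assumes pars: "0 < lam" "0 < b" "b < 1"
    and l_meas [measurable]: "l \<in> borel_measurable borel"
    and l_lim: "(l \<longlongrightarrow> l_inf) at_bot" "0 < l_inf"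
    and tail: "\<And>x. x \<le> x0 \<Longrightarrow> emeasure \<kappa> {..x} =
         (\<integral>\<^sup>+ y\<in>{..x}. ennreal (l y * \<bar>y\<bar> powr a * exp (- lam * \<bar>y\<bar> powr b)) \<partial>lborel)"
begin

text \<open>Half of the rate \<open>lam\<close> absorbs the constant and the power and still leaves
  a factor \<open>1 / y\<^sup>2\<close>, whose integral beyond \<open>x \<ge> 1\<close> is
  \<open>1 / x \<le> 1\<close>.\<close>

lemma tail_bound:
  "\<exists>x1. \<forall>x\<ge>x1. prob {..- x} \<le> exp (- (lam / 2) * x powr b)"
proof -
  have e1: "\<forall>\<^sub>F x in at_top. l (- x) \<le> 2 * l_inf"
  proof -
    have "\<forall>\<^sub>F y in at_bot. l y < 2 * l_inf" using l_lim by (intro order_tendstoD) auto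
    then have "\<forall>\<^sub>F x in at_top. l (- x) < 2 * l_inf"
      by (rule eventually_compose_filterlim[OF _ filterlim_uminus_at_bot_at_top])
    then show ?thesis by eventually_elim simp
  qed
  have e2: "\<forall>\<^sub>F x in at_top. 2 * l_inf * (x powr a * exp (- lam * x powr b)) \<le> exp (- (lam / 2) * x powr b) / x\<^sup>2"
    using l_lim pars by real_asymp
  obtain x1 where x1: "\<And>x. x \<ge> x1 \<Longrightarrow> l (- x) \<le> 2 * l_inf"
    "\<And>x. x \<ge> x1 \<Longrightarrow> 2 * l_inf * (x powr a * exp (- lam * x powr b)) \<le> exp (- (lam / 2) * x powr b) / x\<^sup>2"
    using eventually_conj[OF e1 e2] by (auto simp: eventually_at_top_linorder)
  have "prob {..- x} \<le> exp (- (lam / 2) * x powr b)" if x: "x \<ge> max 1 (max x1 (- x0))" for x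
  proof -
    have "emeasure \<kappa> {..- x} = (\<integral>\<^sup>+ y. ennreal (l y * \<bar>y\<bar> powr a * exp (- lam * \<bar>y\<bar> powr b)) * indicator {..- x} y \<partial>lborel)"
      using x by (intro tail) auto
    also have "\<dots> = (\<integral>\<^sup>+ y. ennreal (l (- y) * \<bar>y\<bar> powr a * exp (- lam * \<bar>y\<bar> powr b)) * indicator {x..} y \<partial>lborel)"
      by (subst nn_integral_real_affine[where c="- 1" and t=0]) (auto simp: indicator_def intro!: nn_integral_cong)
    also have "\<dots> \<le> (\<integral>\<^sup>+ y. ennreal (exp (- (lam / 2) * x powr b)) * (ennreal (1 / y\<^sup>2) * indicator {x..} y) \<partial>lborel)"
    proof (rule nn_integral_mono)
      fix y
      show "ennreal (l (- y) * \<bar>y\<bar> powr a * exp (- lam * \<bar>y\<bar> powr b)) * indicator {x..} y \<le>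
          ennreal (exp (- (lam / 2) * x powr b)) * (ennreal (1 / y\<^sup>2) * indicator {x..} y)"
      proof (cases "x \<le> y")
        case True
        then have y: "1 \<le> y" "x1 \<le> y" using x by auto
        have "l (- y) * \<bar>y\<bar> powr a * exp (- lam * \<bar>y\<bar> powr b) \<le> 2 * l_inf * (y powr a * exp (- lam * y powr b))"
          using x1(1)[OF y(2)] y by (simp add: mult.assoc)
        also have "\<dots> \<le> exp (- (lam / 2) * y powr b) / y\<^sup>2" by (rule x1(2)[OF y(2)])
        also have "\<dots> \<le> exp (- (lam / 2) * x powr b) / y\<^sup>2"
          using True x pars by (intro divide_right_mono) (auto intro!: powr_mono2 mult_left_mono)
        finally show ?thesis using True by (simp add: ennreal_mult[symmetric] ennreal_leI)
      qed simp
    qed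
    also have "\<dots> = ennreal (exp (- (lam / 2) * x powr b)) * (\<integral>\<^sup>+ y. ennreal (1 / y\<^sup>2) * indicator {x..} y \<partial>lborel)"
      by (rule nn_integral_cmult) measurable
    also have "(\<integral>\<^sup>+ y. ennreal (1 / y\<^sup>2) * indicator {x..} y \<partial>lborel) = ennreal (0 - - (1 / x))"
    proof (rule nn_integral_FTC_atLeast)
      show "((\<lambda>y :: real. - (1 / y)) \<longlongrightarrow> 0) at_top" by real_asymp
      fix y assume "x \<le> y"
      then show "((\<lambda>y. - (1 / y)) has_real_derivative 1 / y\<^sup>2) (at y)"
        using x by (auto intro!: derivative_eq_intros simp: power2_eq_square)
    qed auto
    also have "ennreal (exp (- (lam / 2) * x powr b)) * ennreal (0 - - (1 / x)) \<le> ennreal (exp (- (lam / 2) * x powr b)) * 1"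
      using x by (intro mult_left_mono) auto
    finally show ?thesis by (simp add: emeasure_eq_measure)
  qed
  then show ?thesis by blast
qed

text \<open>Cut the left half-line into unit layers. The contributions are summable because
  \<open>lam / 4 < lam / 2\<close> and because \<open>b < 1\<close> keeps
  \<open>(k + 1) powr b - k powr b\<close> bounded.\<close>

lemma left_moment: "integrable \<kappa> (\<lambda>x. exp (lam / 4 * max 0 (- x) powr b))"
proof -
  let ?c = "lam / 4"
  let ?f = "\<lambda>k. exp (?c * (real k + 1) powr b) * prob {..- real k}"
  obtain x1 where x1: "\<And>x. x1 \<le> x \<Longrightarrow> prob {..- x} \<le> exp (- (lam / 2) * x powr b)"
    using tail_bound by blast
  have "summable ?f"
  proof (rule summable_comparison_test_ev)
    show "summable (\<lambda>k. 1 / real k ^ 2)" using inverse_power_summable[of 2] by (simp add: inverse_eq_divide)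
    have "\<forall>\<^sub>F k in sequentially. exp (?c * (real k + 1) powr b) * exp (- (lam / 2) * real k powr b) \<le> 1 / real k ^ 2"
      using pars by real_asymp
    moreover have "\<forall>\<^sub>F k in sequentially. x1 \<le> real k" by real_asymp
    ultimately show "\<forall>\<^sub>F k in sequentially. norm (?f k) \<le> 1 / real k ^ 2"
    proof eventually_elim
      case (elim k)
      have "?f k \<le> exp (?c * (real k + 1) powr b) * exp (- (lam / 2) * real k powr b)"
        using x1[OF elim(2)] by (intro mult_left_mono) auto
      from order_trans[OF this elim(1)] show ?case by simp
    qed
  qed
  then have fin: "(\<Sum>k. ennreal (?f k)) < top"
    by (simp add: less_top[symmetric] ennreal_suminf_neq_top)
  show ?thesis
  proof (rule integrableI_nonneg)
    have "(\<integral>\<^sup>+x. ennreal (exp (?c * max 0 (- x) powr b)) \<partial>\<kappa>) \<le>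
        (\<integral>\<^sup>+x. 1 + (\<Sum>k. ennreal (exp (?c * (real k + 1) powr b)) * indicator {..- real k} x) \<partial>\<kappa>)"
    proof (rule nn_integral_mono)
      fix x
      show "ennreal (exp (?c * max 0 (- x) powr b)) \<le>
          1 + (\<Sum>k. ennreal (exp (?c * (real k + 1) powr b)) * indicator {..- real k} x)"
      proof (cases "0 \<le> x")
        case False
        define k where "k = nat \<lfloor>- x\<rfloor>"
        have k: "real k \<le> - x" "- x \<le> real k + 1" using False unfolding k_def by linarith+
        define h where "h = (\<lambda>k. ennreal (exp (?c * (real k + 1) powr b)) * indicator {..- real k} x)"
        have "ennreal (exp (?c * max 0 (- x) powr b)) \<le> h k"
          unfolding h_def using k False pars by (auto intro!: ennreal_leI mult_left_mono powr_mono2)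
        also have "\<dots> \<le> (\<Sum>k. h k)" using sum_le_suminf[of h "{k}"] by simp
        also have "\<dots> \<le> 1 + (\<Sum>k. h k)" by simp
        finally show ?thesis unfolding h_def .
      qed (use pars in simp)
    qed
    also have "\<dots> = 1 + (\<Sum>k. ennreal (?f k))"
      using emeasure_space_1 by (simp add: nn_integral_add nn_integral_suminf nn_integral_cmult emeasure_eq_measure ennreal_mult)
    also have "\<dots> < \<infinity>" using fin by simp
    finally show "(\<integral>\<^sup>+x. ennreal (exp (?c * max 0 (- x) powr b)) \<partial>\<kappa>) < \<infinity>" .
  qed auto
qed

text \<open>A unit window is used instead of a tail because the weight \<open>exp (- x)\<close>
  between \<open>X\<close> and the displacements is bounded on it. Doubling \<open>lam\<close>
  absorbs the power and the constant.\<close>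

lemma window_bound:
  "\<exists>z1\<ge>0. \<forall>z\<ge>z1. exp (- 2 * lam * (z + 1) powr b) \<le> prob {- z - 1<..- z}"
proof -
  have e1: "\<forall>\<^sub>F x in at_top. l_inf / 2 \<le> l (- x)"
  proof -
    have "\<forall>\<^sub>F y in at_bot. l_inf / 2 < l y" using l_lim by (intro order_tendstoD) auto
    then have "\<forall>\<^sub>F x in at_top. l_inf / 2 < l (- x)"
      by (rule eventually_compose_filterlim[OF _ filterlim_uminus_at_bot_at_top])
    then show ?thesis by eventually_elim simp
  qed
  have e2: "\<forall>\<^sub>F x in at_top. exp (- 2 * lam * x powr b) \<le> l_inf / 2 * (x powr a * exp (- lam * x powr b))"
    using l_lim pars by real_asymp
  obtain x1 where x1: "\<And>x. x \<ge> x1 \<Longrightarrow> l_inf / 2 \<le> l (- x)"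
    "\<And>x. x \<ge> x1 \<Longrightarrow> exp (- 2 * lam * x powr b) \<le> l_inf / 2 * (x powr a * exp (- lam * x powr b))"
    using eventually_conj[OF e1 e2] by (auto simp: eventually_at_top_linorder)
  have "exp (- 2 * lam * (z + 1) powr b) \<le> prob {- z - 1<..- z}" if z: "z \<ge> max 1 (max x1 (- x0))" for z
  proof -
    let ?d = "\<lambda>y. ennreal (l y * \<bar>y\<bar> powr a * exp (- lam * \<bar>y\<bar> powr b))"
    \<comment> \<open>The window is the difference of two tails, and the finite mass of the smaller
      one cancels.\<close>
    have "emeasure \<kappa> {..- z - 1} + emeasure \<kappa> {- z - 1<..- z} = emeasure \<kappa> ({..- z - 1} \<union> {- z - 1<..- z})"
      by (rule plus_emeasure) auto
    also have "{..- z - 1} \<union> {- z - 1<..- z} = {..- z}" by auto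
    also have "emeasure \<kappa> {..- z} = (\<integral>\<^sup>+ y\<in>{..- z}. ?d y \<partial>lborel)" using z by (intro tail) auto
    also have "\<dots> = (\<integral>\<^sup>+ y. ?d y * indicator {..- z - 1} y + ?d y * indicator {- z - 1<..- z} y \<partial>lborel)"
      by (intro nn_integral_cong) (auto simp: indicator_def)
    also have "\<dots> = (\<integral>\<^sup>+ y\<in>{..- z - 1}. ?d y \<partial>lborel) + (\<integral>\<^sup>+ y\<in>{- z - 1<..- z}. ?d y \<partial>lborel)"
      by (rule nn_integral_add) auto
    also have "(\<integral>\<^sup>+ y\<in>{..- z - 1}. ?d y \<partial>lborel) = emeasure \<kappa> {..- z - 1}" using z by (intro tail[symmetric]) auto
    finally have eq: "emeasure \<kappa> {- z - 1<..- z} = (\<integral>\<^sup>+ y\<in>{- z - 1<..- z}. ?d y \<partial>lborel)"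
      by (simp add: ennreal_add_left_cancel)
    have "ennreal (exp (- 2 * lam * (z + 1) powr b)) = (\<integral>\<^sup>+ y\<in>{- z - 1<..- z}. ennreal (exp (- 2 * lam * (z + 1) powr b)) \<partial>lborel)"
      by (simp add: nn_integral_cmult_indicator)
    also have "\<dots> \<le> (\<integral>\<^sup>+ y\<in>{- z - 1<..- z}. ?d y \<partial>lborel)"
    proof (rule nn_integral_mono)
      fix y
      show "ennreal (exp (- 2 * lam * (z + 1) powr b)) * indicator {- z - 1<..- z} y \<le> ?d y * indicator {- z - 1<..- z} y"
      proof (cases "y \<in> {- z - 1<..- z}")
        case True
        then have y: "x1 \<le> - y" "- y \<le> z + 1" "0 < - y" using z by auto
        have "exp (- 2 * lam * (z + 1) powr b) \<le> exp (- 2 * lam * (- y) powr b)"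
          using y pars by (auto intro!: mult_left_mono powr_mono2)
        also have "\<dots> \<le> l_inf / 2 * ((- y) powr a * exp (- lam * (- y) powr b))" by (rule x1(2)[OF y(1)])
        also have "\<dots> \<le> l (- (- y)) * ((- y) powr a * exp (- lam * (- y) powr b))"
          by (intro mult_right_mono x1(1)[OF y(1)]) auto
        also have "\<dots> = l y * \<bar>y\<bar> powr a * exp (- lam * \<bar>y\<bar> powr b)" using y by (simp add: mult.assoc)
        finally show ?thesis using True by (simp add: ennreal_leI)
      qed simp
    qed
    finally show ?thesis unfolding eq[symmetric] by (simp add: emeasure_eq_measure)
  qed
  then show ?thesis by (intro exI[of _ "max 1 (max x1 (- x0))"]) auto
qed

end

text \<open>Put \<open>\<beta> = 1 - t\<close>. A quotient between \<open>d - 1\<close> and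
  \<open>d / 2\<close> excludes the values \<open>0\<close> and \<open>\<infinity>\<close> of the
  transform, and its upper bound says that the logarithm exceeds \<open>(- d / 2) * t\<close>; the
  tangent of \<open>exp\<close> at \<open>0\<close> does the rest.\<close>

lemma exponential_moments_of_derivative:
  fixes \<kappa> :: "real measure"
  assumes sets [measurable_cong]: "sets \<kappa> = sets borel" and d: "d < 0"
    and lim: "((\<lambda>\<beta>. ln_ennreal (\<integral>\<^sup>+x. ennreal (exp ((1 - \<beta>) * x)) \<partial>\<kappa>) / ereal (\<beta> - 1)) \<longlongrightarrow> ereal d) (at_left 1)"
  shows "\<exists>t1>0. \<forall>t. 0 < t \<longrightarrow> t < t1 \<longrightarrow>
    integrable \<kappa> (\<lambda>x. exp (t * x)) \<and> 1 + (- d / 2) * t \<le> (\<integral>x. exp (t * x) \<partial>\<kappa>)"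
proof -
  have ev1: "\<forall>\<^sub>F \<beta> in at_left 1. ereal (d - 1) < ln_ennreal (\<integral>\<^sup>+x. ennreal (exp ((1 - \<beta>) * x)) \<partial>\<kappa>) / ereal (\<beta> - 1)"
    by (rule order_tendstoD(1)[OF lim]) simp
  have ev2: "\<forall>\<^sub>F \<beta> in at_left 1. ln_ennreal (\<integral>\<^sup>+x. ennreal (exp ((1 - \<beta>) * x)) \<partial>\<kappa>) / ereal (\<beta> - 1) < ereal (d / 2)"
    by (rule order_tendstoD(2)[OF lim]) (use d in simp)
  obtain \<beta>0 where \<beta>0: "\<beta>0 < 1"
    "\<And>\<beta>. \<beta>0 < \<beta> \<Longrightarrow> \<beta> < 1 \<Longrightarrow> ereal (d - 1) < ln_ennreal (\<integral>\<^sup>+x. ennreal (exp ((1 - \<beta>) * x)) \<partial>\<kappa>) / ereal (\<beta> - 1)"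
    "\<And>\<beta>. \<beta>0 < \<beta> \<Longrightarrow> \<beta> < 1 \<Longrightarrow> ln_ennreal (\<integral>\<^sup>+x. ennreal (exp ((1 - \<beta>) * x)) \<partial>\<kappa>) / ereal (\<beta> - 1) < ereal (d / 2)"
    using eventually_conj[OF ev1 ev2] unfolding eventually_at_left_field by blast
  have "integrable \<kappa> (\<lambda>x. exp (t * x)) \<and> 1 + (- d / 2) * t \<le> (\<integral>x. exp (t * x) \<partial>\<kappa>)"
    if t: "0 < t" "t < 1 - \<beta>0" for t
  proof -
    let ?E = "\<integral>\<^sup>+x. ennreal (exp (t * x)) \<partial>\<kappa>"
    have q: "ereal (d - 1) < ln_ennreal ?E / ereal (- t)" "ln_ennreal ?E / ereal (- t) < ereal (d / 2)"
      using \<beta>0(2,3)[of "1 - t"] t by simp_all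
    have "?E \<noteq> 0" using q(2) t by (auto simp: ln_ennreal_def)
    moreover have "?E \<noteq> \<infinity>" using q(1) t by (auto simp: ln_ennreal_def)
    ultimately obtain r where r: "?E = ennreal r" "0 < r"
      by (metis ennreal_0 ennreal_cases infinity_ennreal_def less_eq_real_def)
    have int: "integrable \<kappa> (\<lambda>x. exp (t * x))"
      by (rule integrableI_nonneg) (auto simp: r)
    then have Er: "(\<integral>x. exp (t * x) \<partial>\<kappa>) = r" using r by (subst integral_eq_nn_integral) auto
    have "ln r / (- t) < d / 2" using q(2) r t by (simp add: ln_ennreal_def)
    then have "(- d / 2) * t < ln r" using t by (simp add: field_simps)
    then have "exp ((- d / 2) * t) < exp (ln r)" by (subst exp_less_cancel_iff)
    then have "1 + (- d / 2) * t \<le> r" using exp_ge_add_one_self[of "(- d / 2) * t"] r by simp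
    then show ?thesis using int Er by simp
  qed
  then show ?thesis using \<beta>0(1) by (intro exI[of _ "1 - \<beta>0"]) auto
qed

section \<open>The branching random walk\<close>

lemma sum_generation_1:
  "(\<Sum>u\<in>generation \<nu> \<omega> 1. f (position Y \<omega> u)) = (\<Sum>i<\<nu> [] \<omega>. f (Y [] i \<omega>))"
proof -
  have "generation \<nu> \<omega> 1 = (\<lambda>i. [i]) ` {..<\<nu> [] \<omega>}"
    by (auto simp: generation_def genealogical_tree_def length_Suc_conv)
  then show ?thesis
    by (simp add: sum.reindex inj_on_def position_def)
qed

text \<open>The given law covers bounded \<open>g\<close>; truncation at \<open>k\<close> and
  monotone convergence on both sides extend it to nonnegative \<open>g\<close>.\<close>

lemma nn_many_to_one:
  fixes n :: "'a \<Rightarrow> nat" and y :: "nat \<Rightarrow> 'a \<Rightarrow> real" and X :: "'b \<Rightarrow> real"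
  assumes "prob_space P" and [measurable]: "X \<in> borel_measurable P"
    "n \<in> M \<rightarrow>\<^sub>M count_space UNIV" "\<And>i. y i \<in> borel_measurable M"
    and law: "\<And>g. g \<in> borel_measurable borel \<Longrightarrow> bounded (range g) \<Longrightarrow>
      (\<integral>x. g (X x) \<partial>P) = (\<integral>\<omega>. (\<Sum>i<n \<omega>. g (y i \<omega>) * exp (- y i \<omega>)) \<partial>M)"
    and [measurable]: "g \<in> borel_measurable borel" and g: "\<And>x. 0 \<le> g x"
  shows "(\<integral>\<^sup>+\<omega>. ennreal (\<Sum>i<n \<omega>. g (y i \<omega>) * exp (- y i \<omega>)) \<partial>M) = (\<integral>\<^sup>+x. ennreal (g (X x)) \<partial>P)"
proof -
  interpret P: prob_space P by fact
  have cs: "(\<lambda>\<omega>. \<Sum>i<n \<omega>. h (y i \<omega>) * exp (- y i \<omega>)) \<in> borel_measurable M"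
    if [measurable]: "h \<in> borel_measurable borel" for h :: "real \<Rightarrow> real" by measurable
  \<comment> \<open>For \<open>g = 1\<close> the integral equals \<open>1\<close>, whereas the
    integral of a non-integrable function is \<open>0\<close> by convention.\<close>
  have W: "integrable M (\<lambda>\<omega>. \<Sum>i<n \<omega>. exp (- y i \<omega>))"
    using law[of "\<lambda>_. 1"] P.prob_space not_integrable_integral_eq by fastforce
  have bdd: "(\<integral>\<^sup>+\<omega>. ennreal (\<Sum>i<n \<omega>. h (y i \<omega>) * exp (- y i \<omega>)) \<partial>M) = (\<integral>\<^sup>+x. ennreal (h (X x)) \<partial>P)"
    if [measurable]: "h \<in> borel_measurable borel" and h: "\<And>x. 0 \<le> h x" "\<And>x. h x \<le> C" for h C
  proof -
    have C: "0 \<le> C" using h(1,2)[of 0] by linarith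
    have nn: "0 \<le> (\<Sum>i<n \<omega>. h (y i \<omega>) * exp (- y i \<omega>))" for \<omega> using h by (intro sum_nonneg) auto
    have intM: "integrable M (\<lambda>\<omega>. \<Sum>i<n \<omega>. h (y i \<omega>) * exp (- y i \<omega>))"
    proof (rule Bochner_Integration.integrable_bound)
      show "integrable M (\<lambda>\<omega>. C * (\<Sum>i<n \<omega>. exp (- y i \<omega>)))" using W by simp
      show "AE \<omega> in M. norm (\<Sum>i<n \<omega>. h (y i \<omega>) * exp (- y i \<omega>)) \<le> norm (C * (\<Sum>i<n \<omega>. exp (- y i \<omega>)))"
      proof (rule AE_I2)
        fix \<omega>
        have "(\<Sum>i<n \<omega>. h (y i \<omega>) * exp (- y i \<omega>)) \<le> C * (\<Sum>i<n \<omega>. exp (- y i \<omega>))"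
          unfolding sum_distrib_left using h by (intro sum_mono mult_right_mono) auto
        moreover have "0 \<le> C * (\<Sum>i<n \<omega>. exp (- y i \<omega>))" using C by (intro mult_nonneg_nonneg sum_nonneg) auto
        ultimately show "norm (\<Sum>i<n \<omega>. h (y i \<omega>) * exp (- y i \<omega>)) \<le> norm (C * (\<Sum>i<n \<omega>. exp (- y i \<omega>)))"
          using nn[of \<omega>] by (simp only: real_norm_def abs_of_nonneg)
      qed
    qed (rule cs, measurable)
    have intP: "integrable P (\<lambda>x. h (X x))"
      by (rule P.integrable_const_bound[of _ C]) (use h in auto)
    have "bounded (range h)" using h by (intro boundedI[of _ C]) auto
    then have "(\<integral>x. h (X x) \<partial>P) = (\<integral>\<omega>. (\<Sum>i<n \<omega>. h (y i \<omega>) * exp (- y i \<omega>)) \<partial>M)"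
      by (intro law) measurable
    then show ?thesis
      using nn_integral_eq_integral[OF intM] nn_integral_eq_integral[OF intP] nn h by simp
  qed
  let ?h = "\<lambda>k x. min (g x) (real k)"
  have L1: "(\<lambda>k. \<integral>\<^sup>+\<omega>. ennreal (\<Sum>i<n \<omega>. ?h k (y i \<omega>) * exp (- y i \<omega>)) \<partial>M) \<longlonglongrightarrow>
      (\<integral>\<^sup>+\<omega>. ennreal (\<Sum>i<n \<omega>. g (y i \<omega>) * exp (- y i \<omega>)) \<partial>M)"
  proof (rule nn_integral_LIMSEQ)
    show "incseq (\<lambda>k \<omega>. ennreal (\<Sum>i<n \<omega>. ?h k (y i \<omega>) * exp (- y i \<omega>)))"
      by (auto simp: incseq_def le_fun_def intro!: ennreal_leI sum_mono mult_right_mono)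
    show "(\<lambda>\<omega>. ennreal (\<Sum>i<n \<omega>. ?h k (y i \<omega>) * exp (- y i \<omega>))) \<in> borel_measurable M" for k
      by (intro measurable_compose[OF cs measurable_ennreal]) measurable
    show "(\<lambda>k. ennreal (\<Sum>i<n \<omega>. ?h k (y i \<omega>) * exp (- y i \<omega>))) \<longlonglongrightarrow> ennreal (\<Sum>i<n \<omega>. g (y i \<omega>) * exp (- y i \<omega>))" for \<omega>
    proof (intro tendsto_ennrealI tendsto_sum tendsto_mult tendsto_const tendsto_eventually)
      fix i
      show "\<forall>\<^sub>F k in sequentially. ?h k (y i \<omega>) = g (y i \<omega>)"
        using eventually_ge_at_top[of "nat \<lceil>g (y i \<omega>)\<rceil>"] by eventually_elim linarith
    qed
  qed
  have L2: "(\<lambda>k. \<integral>\<^sup>+x. ennreal (?h k (X x)) \<partial>P) \<longlonglongrightarrow> (\<integral>\<^sup>+x. ennreal (g (X x)) \<partial>P)"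
  proof (rule nn_integral_LIMSEQ)
    show "incseq (\<lambda>k x. ennreal (?h k (X x)))"
      by (auto simp: incseq_def le_fun_def intro!: ennreal_leI)
    show "(\<lambda>x. ennreal (?h k (X x))) \<in> borel_measurable P" for k by measurable
    show "(\<lambda>k. ennreal (?h k (X x))) \<longlonglongrightarrow> ennreal (g (X x))" for x
    proof (intro tendsto_ennrealI tendsto_eventually)
      show "\<forall>\<^sub>F k in sequentially. ?h k (X x) = g (X x)"
        using eventually_ge_at_top[of "nat \<lceil>g (X x)\<rceil>"] by eventually_elim linarith
    qed
  qed
  have "(\<integral>\<^sup>+\<omega>. ennreal (\<Sum>i<n \<omega>. ?h k (y i \<omega>) * exp (- y i \<omega>)) \<partial>M) = (\<integral>\<^sup>+x. ennreal (?h k (X x)) \<partial>P)" for k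
    by (rule bdd[of "?h k" "real k"]) (use g in auto)
  with L1 have "(\<lambda>k. \<integral>\<^sup>+x. ennreal (?h k (X x)) \<partial>P) \<longlonglongrightarrow> (\<integral>\<^sup>+\<omega>. ennreal (\<Sum>i<n \<omega>. g (y i \<omega>) * exp (- y i \<omega>)) \<partial>M)"
    by simp
  then show ?thesis using L2 by (rule LIMSEQ_unique)
qed

section \<open>Passage to the canonical tree and first moments of the children\<close>

context branching_random_walk begin

definition point :: "nat list \<Rightarrow> 'a \<Rightarrow> nat \<times> (nat \<Rightarrow> real)" where
  "point u \<omega> = (\<nu> u \<omega>, \<lambda>i. Y u i \<omega>)"

definition root_law :: "(nat \<times> (nat \<Rightarrow> real)) measure" where
  "root_law = distr M offspring_space (point [])"

lemma measurable_point [measurable]: "point u \<in> M \<rightarrow>\<^sub>M offspring_space"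
  using independent_copies unfolding indep_vars_def2 point_def[abs_def] by auto

lemma measurable_nu [measurable]: "\<nu> u \<in> M \<rightarrow>\<^sub>M count_space UNIV"
proof -
  have "fst \<in> offspring_space \<rightarrow>\<^sub>M count_space UNIV" unfolding offspring_space_def by measurable
  from measurable_compose[OF measurable_point this, of u] show ?thesis by (simp add: point_def)
qed

lemma measurable_Y [measurable]: "Y u i \<in> borel_measurable M"
proof -
  have "(\<lambda>z. snd z i) \<in> borel_measurable offspring_space" unfolding offspring_space_def by measurable
  from measurable_compose[OF measurable_point this, of u] show ?thesis by (simp add: point_def)
qed

sublocale root: offspring_law root_law
proof -
  interpret R: prob_space root_law unfolding root_law_def by (rule prob_space_distr) measurable
  show "offspring_law root_law" by unfold_locales (simp add: root_law_def)
qed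

text \<open>Independence and equality in law of the labels give the whole family the law
  \<open>root.tree_law\<close>, so almost sure statements pull back along it.\<close>

lemma AE_tree_law:
  assumes "AE \<omega> in root.tree_law. Q \<omega>"
  shows "AE \<omega> in M. Q (\<lambda>u. point u \<omega>)"
proof -
  have meas: "(\<lambda>\<omega> u. point u \<omega>) \<in> M \<rightarrow>\<^sub>M (\<Pi>\<^sub>M u\<in>UNIV. offspring_space)"
    by (rule measurable_PiM_single') (auto simp: measurable_space[OF measurable_point])
  have "distr M (\<Pi>\<^sub>M u\<in>UNIV. offspring_space) (\<lambda>\<omega>. \<lambda>u\<in>UNIV. point u \<omega>) =
      (\<Pi>\<^sub>M u\<in>UNIV. distr M offspring_space (point u))"
    using independent_copies by (subst (asm) indep_vars_iff_distr_eq_PiM) (auto simp: point_def[symmetric])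
  moreover have "distr M offspring_space (point u) = root_law" for u
    using identical_copies[of u] by (simp add: root_law_def point_def[abs_def])
  ultimately have eq: "distr M (\<Pi>\<^sub>M u\<in>UNIV. offspring_space) (\<lambda>\<omega> u. point u \<omega>) = root.tree_law"
    by (simp add: restrict_UNIV root.tree_law_def)
  show ?thesis by (rule AE_distrD[OF meas]) (simp only: eq assms)
qed

lemma independent_child:
  assumes A: "A \<in> sets borel"
  shows "prob {\<omega> \<in> space M. i < \<nu> [] \<omega> \<and> Y [] i \<omega> \<in> A} =
     prob {\<omega> \<in> space M. i < \<nu> [] \<omega>} * prob {\<omega> \<in> space M. Y [] 0 \<omega> \<in> A}"
proof -
  let ?X = "case_nat (\<lambda>\<omega>. real (\<nu> [] \<omega>)) (Y [])"
  let ?A = "case_nat {real i<..} (\<lambda>_. A)"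
  have "prob (\<Inter>j\<in>{0, Suc i}. ?X j -` ?A j \<inter> space M) = (\<Prod>j\<in>{0, Suc i}. prob (?X j -` ?A j \<inter> space M))"
    by (rule indep_varsD[OF nu_and_displacements_independent]) (use A in auto)
  moreover have "(\<Inter>j\<in>{0, Suc i}. ?X j -` ?A j \<inter> space M) = {\<omega> \<in> space M. i < \<nu> [] \<omega> \<and> Y [] i \<omega> \<in> A}"
    by auto
  moreover have "?X 0 -` ?A 0 \<inter> space M = {\<omega> \<in> space M. i < \<nu> [] \<omega>}" by auto
  moreover have "prob (?X (Suc i) -` ?A (Suc i) \<inter> space M) = prob {\<omega> \<in> space M. Y [] 0 \<omega> \<in> A}"
  proof -
    have "measure (distr M borel (Y [] i)) A = measure (distr M borel (Y [] 0)) A"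
      by (simp only: displacements_identical[of i])
    then show ?thesis using A by (simp add: measure_distr vimage_def Int_def conj_commute)
  qed
  ultimately show ?thesis by simp
qed

text \<open>Wald's identity: the existence of child \<open>i\<close> is independent of its
  displacement, and the case of the whole line identifies the sum of the probabilities of
  \<open>i < \<nu>\<close> with the mean.\<close>

lemma nn_integral_children_in:
  assumes A [measurable]: "A \<in> sets borel"
  shows "(\<integral>\<^sup>+\<omega>. (\<Sum>i<\<nu> [] \<omega>. indicator A (Y [] i \<omega>)) \<partial>M) =
     (\<integral>\<^sup>+\<omega>. of_nat (\<nu> [] \<omega>) \<partial>M) * ennreal (prob {\<omega> \<in> space M. Y [] 0 \<omega> \<in> A})"
proof -
  have gen: "(\<integral>\<^sup>+\<omega>. (\<Sum>i<\<nu> [] \<omega>. indicator B (Y [] i \<omega>)) \<partial>M) =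
      (\<Sum>i. ennreal (prob {\<omega> \<in> space M. i < \<nu> [] \<omega>})) * ennreal (prob {\<omega> \<in> space M. Y [] 0 \<omega> \<in> B})"
    if [measurable]: "B \<in> sets borel" for B
  proof -
    let ?E = "\<lambda>i. {\<omega> \<in> space M. i < \<nu> [] \<omega> \<and> Y [] i \<omega> \<in> B}"
    have "(\<integral>\<^sup>+\<omega>. (\<Sum>i<\<nu> [] \<omega>. indicator B (Y [] i \<omega>)) \<partial>M) = (\<integral>\<^sup>+\<omega>. (\<Sum>i. indicator (?E i) \<omega>) \<partial>M)"
    proof (rule nn_integral_cong)
      fix \<omega> assume "\<omega> \<in> space M"
      then have "(\<Sum>i. indicator (?E i) \<omega> :: ennreal) = (\<Sum>i<\<nu> [] \<omega>. indicator (?E i) \<omega>)"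
        by (intro suminf_finite) auto
      also have "\<dots> = (\<Sum>i<\<nu> [] \<omega>. indicator B (Y [] i \<omega>))"
        using \<open>\<omega> \<in> space M\<close> by (intro sum.cong) (auto simp: indicator_def)
      finally show "(\<Sum>i<\<nu> [] \<omega>. indicator B (Y [] i \<omega>)) = (\<Sum>i. indicator (?E i) \<omega> :: ennreal)" by simp
    qed
    also have "\<dots> = (\<Sum>i. emeasure M (?E i))" by (subst nn_integral_suminf) auto
    also have "\<dots> = (\<Sum>i. ennreal (prob {\<omega> \<in> space M. i < \<nu> [] \<omega>}) * ennreal (prob {\<omega> \<in> space M. Y [] 0 \<omega> \<in> B}))"
      by (simp only: emeasure_eq_measure independent_child[OF that] ennreal_mult measure_nonneg)
    also have "(\<Sum>i. ennreal (prob {\<omega> \<in> space M. i < \<nu> [] \<omega>}) * ennreal (prob {\<omega> \<in> space M. Y [] 0 \<omega> \<in> B})) =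
        (\<Sum>i. ennreal (prob {\<omega> \<in> space M. i < \<nu> [] \<omega>})) * ennreal (prob {\<omega> \<in> space M. Y [] 0 \<omega> \<in> B})"
      by (rule ennreal_suminf_multc)
    finally show ?thesis .
  qed
  have "(\<integral>\<^sup>+\<omega>. of_nat (\<nu> [] \<omega>) \<partial>M) = (\<Sum>i. ennreal (prob {\<omega> \<in> space M. i < \<nu> [] \<omega>}))"
  proof -
    have "(\<integral>\<^sup>+\<omega>. of_nat (\<nu> [] \<omega>) \<partial>M) = (\<integral>\<^sup>+\<omega>. (\<Sum>i<\<nu> [] \<omega>. indicator UNIV (Y [] i \<omega>)) \<partial>M)"
      by simp
    also have "\<dots> = (\<Sum>i. ennreal (prob {\<omega> \<in> space M. i < \<nu> [] \<omega>})) * ennreal (prob {\<omega> \<in> space M. Y [] 0 \<omega> \<in> UNIV})"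
      by (rule gen) simp
    also have "prob {\<omega> \<in> space M. Y [] 0 \<omega> \<in> UNIV} = 1" by (simp add: prob_space)
    finally show ?thesis by simp
  qed
  then show ?thesis by (simp only: gen[OF A])
qed

end

theorem theorem1p5:
  fixes M :: "'a measure"
    and \<nu> :: "nat list \<Rightarrow> 'a \<Rightarrow> nat"
    and Y :: "nat list \<Rightarrow> nat \<Rightarrow> 'a \<Rightarrow> real"
    and P :: "'b measure"
    and X :: "'b \<Rightarrow> real"
    and l :: "real \<Rightarrow> real"
    and a lam b x0 l_inf :: real
  assumes brw: "branching_random_walk M \<nu> Y"
    and mean_offspring:
      "integrable M (\<lambda>\<omega>. real (\<nu> [] \<omega>))" "1 < (\<integral>\<omega>. real (\<nu> [] \<omega>) \<partial>M)"
    and non_lattice: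
      "\<not> (\<exists>h>0. AE \<omega> in M. \<forall>u\<in>generation \<nu> \<omega> 1. \<exists>k::int. position Y \<omega> u = h * of_int k)"
    and phi_1: "log_laplace M \<nu> Y 1 = 0"
    and phi_left_deriv:
      "\<exists>d<0. ((\<lambda>\<beta>. (log_laplace M \<nu> Y \<beta> - log_laplace M \<nu> Y 1) / ereal (\<beta> - 1))
               \<longlongrightarrow> ereal d) (at_left 1)"
    and phi_infinite: "\<And>\<beta>. 1 < \<beta> \<Longrightarrow> log_laplace M \<nu> Y \<beta> = \<infinity>"
    and prob_P: "prob_space P"
    and X_measurable: "X \<in> borel_measurable P"
    and X_law:
      "\<And>g :: real \<Rightarrow> real. g \<in> borel_measurable borel \<Longrightarrow> bounded (range g) \<Longrightarrow>
         (\<integral>x. g (X x) \<partial>P) =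
         (\<integral>\<omega>. (\<Sum>u\<in>generation \<nu> \<omega> 1. g (position Y \<omega> u) * exp (- position Y \<omega> u)) \<partial>M)"
    and parameters: "0 < lam" "x0 < 0" "0 < b" "b < 1 / 2"
    and l_nonneg: "\<And>y. 0 \<le> l y"
    and l_measurable: "l \<in> borel_measurable borel"
    and l_limit: "(l \<longlongrightarrow> l_inf) at_bot" "0 < l_inf"
    and X_tail:
      "\<And>x. x \<le> x0 \<Longrightarrow>
         emeasure P {z \<in> space P. X z \<le> x} =
         (\<integral>\<^sup>+ y\<in>{..x}. ennreal (l y * \<bar>y\<bar> powr a * exp (- lam * \<bar>y\<bar> powr b)) \<partial>lborel)"
    and W1_log_W1: "integrable M (\<lambda>\<omega>. W1 \<nu> Y \<omega> * log_plus (W1 \<nu> Y \<omega>))"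
  shows "\<exists>a_star>0. AE \<omega> in M. infinite (genealogical_tree \<nu> \<omega>) \<longrightarrow>
           (INF \<Theta>\<in>rays \<nu> \<omega>.
              limsup (\<lambda>n. ereal (position Y \<omega> (\<Theta> n) / real n powr (1 / (2 - b)))))
           = ereal a_star"
proof -

  \<comment> \<open>The tilted law and its moments\<close>
  interpret branching_random_walk M \<nu> Y by (rule brw)
  interpret P: prob_space P by (rule prob_P)
  note [measurable] = X_measurable l_measurable
  define \<kappa> where "\<kappa> = distr P borel X"
  interpret K: prob_space \<kappa> unfolding \<kappa>_def by (rule P.prob_space_distr) measurable
  interpret tail: stretched_exponential_law \<kappa> l a lam b x0 l_inf
  proof unfold_locales
    show "sets \<kappa> = sets borel" by (simp add: \<kappa>_def)
    fix x :: real assume x: "x \<le> x0"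
    have "emeasure \<kappa> {..x} = emeasure P {z \<in> space P. X z \<le> x}"
      unfolding \<kappa>_def by (subst emeasure_distr) (auto intro!: arg_cong[where f="emeasure P"])
    then show "emeasure \<kappa> {..x} = (\<integral>\<^sup>+ y\<in>{..x}. ennreal (l y * \<bar>y\<bar> powr a * exp (- lam * \<bar>y\<bar> powr b)) \<partial>lborel)"
      using X_tail[OF x] by simp
  qed (use parameters l_limit in auto)
  have mto_M: "(\<integral>\<^sup>+\<omega>. ennreal (\<Sum>i<\<nu> [] \<omega>. g (Y [] i \<omega>) * exp (- Y [] i \<omega>)) \<partial>M) = (\<integral>\<^sup>+x. ennreal (g x) \<partial>\<kappa>)"
    if [measurable]: "g \<in> borel_measurable borel" and g: "\<And>x. 0 \<le> g x" for g :: "real \<Rightarrow> real"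
  proof -
    have "(\<integral>\<^sup>+\<omega>. ennreal (\<Sum>i<\<nu> [] \<omega>. g (Y [] i \<omega>) * exp (- Y [] i \<omega>)) \<partial>M) = (\<integral>\<^sup>+x. ennreal (g (X x)) \<partial>P)"
    proof (rule nn_many_to_one[OF prob_P])
      show "(\<integral>x. h (X x) \<partial>P) = (\<integral>\<omega>. (\<Sum>i<\<nu> [] \<omega>. h (Y [] i \<omega>) * exp (- Y [] i \<omega>)) \<partial>M)"
        if "h \<in> borel_measurable borel" "bounded (range h)" for h :: "real \<Rightarrow> real"
      proof -
        have "(\<Sum>u\<in>generation \<nu> \<omega> 1. h (position Y \<omega> u) * exp (- position Y \<omega> u)) =
            (\<Sum>i<\<nu> [] \<omega>. h (Y [] i \<omega>) * exp (- Y [] i \<omega>))" for \<omega>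
          by (rule sum_generation_1[where f="\<lambda>x. h x * exp (- x)"])
        then show ?thesis using X_law[OF that] by (simp only:)
      qed
    qed (use g in auto)
    then show ?thesis unfolding \<kappa>_def by (simp add: nn_integral_distr)
  qed
  have mto: "(\<integral>\<^sup>+z. ennreal (\<Sum>i<fst z. g (snd z i) * exp (- snd z i)) \<partial>root_law) = (\<integral>\<^sup>+x. ennreal (g x) \<partial>\<kappa>)"
    if [measurable]: "g \<in> borel_measurable borel" and g: "\<And>x. 0 \<le> g x" for g :: "real \<Rightarrow> real"
  proof -
    have "(\<lambda>z. ennreal (\<Sum>i<fst z. g (snd z i) * exp (- snd z i))) \<in> borel_measurable root_law" by measurable
    then have "(\<lambda>z. ennreal (\<Sum>i<fst z. g (snd z i) * exp (- snd z i))) \<in> borel_measurable offspring_space"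
      by (simp add: root_law_def)
    then show ?thesis unfolding root_law_def
      by (subst nn_integral_distr) (simp_all add: point_def mto_M[OF that])
  qed
  obtain d where d: "d < 0" "((\<lambda>\<beta>. (log_laplace M \<nu> Y \<beta> - log_laplace M \<nu> Y 1) / ereal (\<beta> - 1)) \<longlongrightarrow> ereal d) (at_left 1)"
    using phi_left_deriv by blast
  \<comment> \<open>At \<open>\<beta> = 1 - t\<close> this is the logarithm of the moment generating
    function of \<open>\<kappa>\<close> at \<open>t\<close>, so the left derivative at
    \<open>1\<close> is minus the mean of \<open>X\<close>.\<close>
  have laplace: "log_laplace M \<nu> Y \<beta> = ln_ennreal (\<integral>\<^sup>+x. ennreal (exp ((1 - \<beta>) * x)) \<partial>\<kappa>)" for \<beta>
  proof -
    have "exp (- \<beta> * x) = exp ((1 - \<beta>) * x) * exp (- x)" for x :: real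
      by (simp add: algebra_simps flip: exp_add)
    then show ?thesis
      unfolding log_laplace_def sum_generation_1[of "\<lambda>x. exp (- \<beta> * x)"]
      using mto_M[of "\<lambda>x. exp ((1 - \<beta>) * x)"] by simp
  qed
  have "((\<lambda>\<beta>. ln_ennreal (\<integral>\<^sup>+x. ennreal (exp ((1 - \<beta>) * x)) \<partial>\<kappa>) / ereal (\<beta> - 1)) \<longlongrightarrow> ereal d) (at_left 1)"
    using d(2) unfolding phi_1 by (simp add: laplace)
  from exponential_moments_of_derivative[OF _ d(1) this]
  obtain t1 where t1: "0 < t1" "\<And>t. 0 < t \<Longrightarrow> t < t1 \<Longrightarrow> integrable \<kappa> (\<lambda>x. exp (t * x)) \<and>
      1 + (- d / 2) * t \<le> (\<integral>x. exp (t * x) \<partial>\<kappa>)"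
    by (auto simp: \<kappa>_def)
  \<comment> \<open>\<open>t1 / 2\<close> lies inside the interval of finite exponential
    moments.\<close>
  interpret moments: stretched_left_tail \<kappa> b "lam / 4" "t1 / 2"
    by unfold_locales (use parameters tail.left_moment t1(1) t1(2)[of "t1 / 2"] in simp_all)
  have "- d / 2 \<le> (\<integral>x. x \<partial>\<kappa>)" by (rule moments.drift_ge[OF t1])
  then have drift: "0 < (\<integral>x. x \<partial>\<kappa>)" using d(1) by simp
  interpret T: tilted_offspring root_law \<kappa> b "lam / 4" "t1 / 2"
    by unfold_locales (rule mto, assumption+, rule drift)

  \<comment> \<open>Lower tail of a single displacement\<close>
  define m0 where "m0 = (\<integral>\<omega>. real (\<nu> [] \<omega>) \<partial>M)"
  have m0: "1 < m0" using mean_offspring by (simp add: m0_def)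
  have nn_m0: "(\<integral>\<^sup>+\<omega>. of_nat (\<nu> [] \<omega>) \<partial>M) = ennreal m0"
    using nn_integral_eq_integral[OF mean_offspring(1)] by (simp add: m0_def ennreal_of_nat_eq_real_of_nat)
  define F where "F z = prob {\<omega> \<in> space M. Y [] 0 \<omega> \<in> {..- z}}" for z
  obtain z1 where z1: "0 \<le> z1" "\<And>z. z1 \<le> z \<Longrightarrow> exp (- 2 * lam * (z + 1) powr b) \<le> K.prob {- z - 1<..- z}"
    using tail.window_bound by blast
  \<comment> \<open>On the window \<open>exp (- x)\<close> is less than \<open>exp (z + 1)\<close>,
    so the tilted mass is at most this factor times the mean number of children at or below
    \<open>- z\<close>.\<close>
  have window: "K.prob {- z - 1<..- z} \<le> exp (z + 1) * m0 * F z" for z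
  proof -
    let ?I = "\<lambda>x. indicator {- z - 1<..- z} x :: real"
    have "ennreal (K.prob {- z - 1<..- z}) = (\<integral>\<^sup>+x. ennreal (?I x) \<partial>\<kappa>)"
      by (simp add: K.emeasure_eq_measure[symmetric] ennreal_indicator)
    also have "\<dots> = (\<integral>\<^sup>+\<omega>. ennreal (\<Sum>i<\<nu> [] \<omega>. ?I (Y [] i \<omega>) * exp (- Y [] i \<omega>)) \<partial>M)"
      by (rule mto_M[symmetric]) auto
    also have "\<dots> \<le> (\<integral>\<^sup>+\<omega>. ennreal (exp (z + 1)) * (\<Sum>i<\<nu> [] \<omega>. indicator {..- z} (Y [] i \<omega>)) \<partial>M)"
    proof (rule nn_integral_mono)
      fix \<omega>
      have "(\<Sum>i<\<nu> [] \<omega>. ?I (Y [] i \<omega>) * exp (- Y [] i \<omega>)) \<le> (\<Sum>i<\<nu> [] \<omega>. exp (z + 1) * indicator {..- z} (Y [] i \<omega>))"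
        by (intro sum_mono) (auto simp: indicator_def)
      then have "ennreal (\<Sum>i<\<nu> [] \<omega>. ?I (Y [] i \<omega>) * exp (- Y [] i \<omega>)) \<le>
          ennreal (exp (z + 1) * (\<Sum>i<\<nu> [] \<omega>. indicator {..- z} (Y [] i \<omega>)))"
        by (simp add: ennreal_leI sum_distrib_left)
      also have "\<dots> = ennreal (exp (z + 1)) * (\<Sum>i<\<nu> [] \<omega>. ennreal (indicator {..- z} (Y [] i \<omega>)))"
        by (simp only: ennreal_mult[OF exp_ge_zero sum_nonneg] indicator_pos_le sum_ennreal)
      finally show "ennreal (\<Sum>i<\<nu> [] \<omega>. ?I (Y [] i \<omega>) * exp (- Y [] i \<omega>)) \<le>
          ennreal (exp (z + 1)) * (\<Sum>i<\<nu> [] \<omega>. indicator {..- z} (Y [] i \<omega>))"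
        by (simp add: ennreal_indicator)
    qed
    also have "\<dots> = ennreal (exp (z + 1)) * (\<integral>\<^sup>+\<omega>. (\<Sum>i<\<nu> [] \<omega>. indicator {..- z} (Y [] i \<omega>)) \<partial>M)"
      by (rule nn_integral_cmult) measurable
    also have "\<dots> = ennreal (exp (z + 1)) * (ennreal m0 * ennreal (F z))"
      by (subst nn_integral_children_in) (simp_all add: nn_m0 F_def)
    also have "\<dots> = ennreal (exp (z + 1) * m0 * F z)"
      using m0 by (simp add: ennreal_mult F_def mult.assoc)
    finally show ?thesis
      using m0 by (subst (asm) ennreal_le_iff) (auto simp: F_def)
  qed
  have F_low: "exp (- (z + 1) - 2 * lam * (z + 1) powr b) / m0 \<le> F z" if "z1 \<le> z" for z
  proof -
    have "exp (- 2 * lam * (z + 1) powr b) \<le> exp (z + 1) * m0 * F z"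
      using z1(2)[OF that] window[of z] by linarith
    then have "exp (- (z + 1)) * exp (- 2 * lam * (z + 1) powr b) \<le> exp (- (z + 1)) * (exp (z + 1) * m0 * F z)"
      by (intro mult_left_mono) auto
    also have "\<dots> = m0 * F z" by (simp add: mult.assoc[symmetric] flip: exp_add)
    finally show ?thesis using m0 by (simp add: field_simps flip: exp_add)
  qed
  define q1 where "q1 = prob {\<omega> \<in> space M. 0 < \<nu> [] \<omega>}"
  have q1: "0 < q1"
  proof (rule ccontr)
    assume "\<not> 0 < q1"
    then have "prob {\<omega> \<in> space M. 0 < \<nu> [] \<omega>} = 0" by (simp add: q1_def not_less antisym)
    then have "AE \<omega> in M. \<nu> [] \<omega> = 0"
      by (intro AE_I[of _ _ "{\<omega> \<in> space M. 0 < \<nu> [] \<omega>}"]) (auto simp: emeasure_eq_measure)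
    then have "(\<integral>\<omega>. real (\<nu> [] \<omega>) \<partial>M) = (\<integral>\<omega>. 0 \<partial>M)" by (intro integral_cong_AE) auto
    then show False using mean_offspring(2) by simp
  qed
  \<comment> \<open>The factor \<open>q1\<close> is the probability of having a child; the
    exponential is the price for replacing \<open>z\<close> by \<open>max z1 z + 1\<close>
    below.\<close>
  define c2 where "c2 = q1 * exp (- (z1 + 1) - 2 * lam * (z1 powr b + 1)) / m0"
  have c2: "0 < c2" using q1 m0 by (simp add: c2_def)
  have powr_1: "(z + 1) powr b \<le> z powr b + 1" if "0 \<le> z" for z
    using one_add_powr_le[of b z] that parameters by (simp add: add.commute)
  have lower: "c2 * exp (- max 0 z - 2 * lam * max 0 z powr b) \<le>
      root.prob {y. 1 \<le> fst y \<and> snd y 0 \<le> - z}" for z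
  proof -
    have "Measurable.pred root_law (\<lambda>y. 1 \<le> fst y \<and> snd y 0 \<le> - z)" by measurable
    then have "{y. 1 \<le> fst y \<and> snd y 0 \<le> - z} \<in> root.events" by (simp add: pred_def)
    then have "root.prob {y. 1 \<le> fst y \<and> snd y 0 \<le> - z} = prob {\<omega> \<in> space M. 0 < \<nu> [] \<omega> \<and> Y [] 0 \<omega> \<in> {..- z}}"
      unfolding root_law_def
      by (subst measure_distr) (auto simp: point_def Suc_le_eq intro!: arg_cong[where f=prob])
    also have "\<dots> = q1 * F z" by (subst independent_child) (auto simp: q1_def F_def)
    finally have eq: "root.prob {y. 1 \<le> fst y \<and> snd y 0 \<le> - z} = q1 * F z" .
    define z' where "z' = max z1 z"
    have "F z' \<le> F z" unfolding F_def z'_def by (intro finite_measure_mono) auto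
    moreover have "exp (- (z1 + 1) - 2 * lam * (z1 powr b + 1)) / m0 * exp (- max 0 z - 2 * lam * max 0 z powr b) \<le> F z'"
    proof -
      have "z' powr b \<le> z1 powr b + max 0 z powr b"
        using z1(1) by (cases "z1 \<le> z") (simp_all add: z'_def max_def add_increasing)
      moreover have "0 \<le> z'" using z1(1) by (simp add: z'_def le_max_iff_disj)
      ultimately have "(z' + 1) powr b \<le> z1 powr b + 1 + max 0 z powr b"
        using powr_1[of z'] by linarith
      then have "2 * lam * (z' + 1) powr b \<le> 2 * lam * (z1 powr b + 1 + max 0 z powr b)"
        using parameters by (intro mult_left_mono) auto
      moreover have "z' \<le> z1 + max 0 z" using z1(1) by (auto simp: z'_def)
      ultimately have "- (z1 + 1) - 2 * lam * (z1 powr b + 1) + (- max 0 z - 2 * lam * max 0 z powr b) \<le>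
          - (z' + 1) - 2 * lam * (z' + 1) powr b" by (simp add: algebra_simps)
      then have "exp (- (z1 + 1) - 2 * lam * (z1 powr b + 1) + (- max 0 z - 2 * lam * max 0 z powr b)) / m0 \<le>
          exp (- (z' + 1) - 2 * lam * (z' + 1) powr b) / m0"
        using m0 by (intro divide_right_mono) auto
      also have "\<dots> \<le> F z'" by (rule F_low) (simp add: z'_def)
      finally show ?thesis by (simp add: exp_add)
    qed
    ultimately have "exp (- (z1 + 1) - 2 * lam * (z1 powr b + 1)) / m0 * exp (- max 0 z - 2 * lam * max 0 z powr b) \<le> F z"
      by linarith
    then have "q1 * (exp (- (z1 + 1) - 2 * lam * (z1 powr b + 1)) / m0 * exp (- max 0 z - 2 * lam * max 0 z powr b)) \<le> q1 * F z"
      using q1 by (intro mult_left_mono) auto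
    then show ?thesis unfolding eq c2_def by (simp add: mult.assoc)
  qed
  have LlogL: "integrable root_law (\<lambda>z. (\<Sum>i<fst z. exp (- snd z i)) * log_plus (\<Sum>i<fst z. exp (- snd z i)))"
  proof -
    have "(\<lambda>z. (\<Sum>i<fst z. exp (- snd z i)) * log_plus (\<Sum>i<fst z. exp (- snd z i))) \<in> borel_measurable root_law"
      unfolding log_plus_def by measurable
    then have "(\<lambda>z. (\<Sum>i<fst z. exp (- snd z i)) * log_plus (\<Sum>i<fst z. exp (- snd z i))) \<in> borel_measurable offspring_space"
      by (simp add: root_law_def)
    moreover have "W1 \<nu> Y \<omega> = (\<Sum>i<\<nu> [] \<omega>. exp (- Y [] i \<omega>))" for \<omega>
      unfolding W1_def by (rule sum_generation_1)
    ultimately show ?thesis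
      unfolding root_law_def using W1_log_W1 by (subst integrable_distr_eq) (simp_all add: point_def)
  qed
  interpret L: leaping_offspring root_law \<kappa> b "lam / 4" "t1 / 2" c2 "2 * lam"
    by unfold_locales (use c2 parameters in simp, use c2 parameters in simp, rule lower, rule LlogL)

  \<comment> \<open>The almost sure constant and its transfer to the original space\<close>
  have nontriv: "\<not> (AE z in root_law. fst z \<le> 1)"
  proof
    assume "AE z in root_law. fst z \<le> 1"
    then have "AE \<omega> in M. fst (point [] \<omega>) \<le> 1" unfolding root_law_def by (rule AE_distrD[rotated]) measurable
    then have "(\<integral>\<omega>. real (\<nu> [] \<omega>) \<partial>M) \<le> (\<integral>\<omega>. 1 \<partial>M)"
      using mean_offspring(1) by (intro integral_mono_AE) (auto simp: point_def)
    then show False using mean_offspring(2) prob_space by simp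
  qed
  obtain c where c: "0 < c" "\<And>r D. 0 \<le> r \<Longrightarrow> r < c \<Longrightarrow>
      root.tree.prob {\<omega>. stays (\<lambda>k. real D + r * real k powr (1 / (2 - b))) 0 \<omega>} = 0"
    using T.slow_rays_null by blast
  obtain C D where CD: "0 < root.tree.prob {\<omega>. stays (\<lambda>k. real D + C * real k powr (1 / (2 - b))) 0 \<omega>}"
    using L.fast_ray_exists by blast
  have p: "0 < 1 / (2 - b)" "1 / (2 - b) \<le> 1" using parameters by auto
  obtain a_star where a_star: "0 < a_star" and
    AE: "AE \<omega> in root.tree_law. infinite (genealogical_tree tree_nu \<omega>) \<longrightarrow>
     (INF \<Theta>\<in>rays tree_nu \<omega>. limsup (\<lambda>n. ereal (position tree_Y \<omega> (\<Theta> n) / real n powr (1 / (2 - b))))) = ereal a_star"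
    using root.constant_rate[OF p nontriv c CD] by blast
  have tree_eq: "genealogical_tree tree_nu (\<lambda>u. point u \<omega>) = genealogical_tree \<nu> \<omega>" for \<omega>
    by (simp add: genealogical_tree_def point_def)
  have rays_eq: "rays tree_nu (\<lambda>u. point u \<omega>) = rays \<nu> \<omega>" for \<omega>
    by (simp add: rays_def tree_eq)
  have pos_eq: "position tree_Y (\<lambda>u. point u \<omega>) v = position Y \<omega> v" for \<omega> v
    by (simp add: position_def point_def)
  from AE_tree_law[OF AE] a_star show ?thesis
    unfolding tree_eq rays_eq pos_eq by (intro exI[of _ a_star] conjI)
qed

end
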